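(* (Forward direction.) Let $V$ be a finite-dimensional complex vector space, $G\subset \mathrm{GL}(V)$ a compact group whose identity component is a torus $T$, $F\subseteq G$ a finite subgroup and $v\in V$. Assume: (a) $G=FT=TF$ and the natural map $F\to G/T$ is an isomorphism; (b) $Gv\subseteq T^{\mathbb C}v$; (c) $T$ acts on $V$ with simple spectrum, and all coordinates of $v$ in a basis of $V$ consisting of $T$-eigenvectors are nonzero; (d) $fv=v$ for all $f\in F$; (e) $\mathrm{span}_{\mathbb C}\,Tv=V$. Then $(V,G,F,T,v)$ can be realized by Construction M of the context: there are data $\mathfrak t, L, K, F$ as there and a linear isomorphism $V\to C(K)$ carrying $G,F,T$ to the groups $G,F,T$ of the construction and carrying $v$ to an element of $(\mathbb C^* )^n\cap C(K)^F$. (Converse.) If $V=C(K)$, $G,F,T$ are given by Construction M and $v\in(\mathbb C^* )^n\cap C(K)^F$, then (a)–(e) hold.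
   Context: $T^{\mathbb C}=\exp(\mathfrak t^{\mathbb C})\subset\mathrm{GL}(V)$ is the complexification of the torus $T$, where $\mathfrak t$ is the Lie algebra of $T$ and $\mathfrak t^{\mathbb C}=\mathfrak t+i\mathfrak t$. Simple spectrum means that every $T$-isotypical component of $V$ has complex dimension at most $1$. Construction M. Let $\mathfrak t$ be a finite-dimensional real vector space with dual $\mathfrak t^*$, $L\subset\mathfrak t$ a lattice, $L^*\subset\mathfrak t^*$ the dual lattice, and $K\subset L^*$ a finite set generating $L^*$ as a group. Let $F$ be a finite subgroup of $\mathrm{GL}(\mathfrak t)$ whose induced (contragredient) action on $\mathfrak t^*$ maps $K$ onto itself. Put $n=\mathrm{card}\,K$ and $V=C(K)$, the algebra of all complex-valued functions on $K$; $(\mathbb C^* )^n$ denotes the group of nowhere vanishing functions in $C(K)$ and $C(K)^F$ the set of $F$-invariant functions. $F$ acts on $C(K)$ by $(fu)(y)=u(f^{-1}y)$. For $x\in\mathfrak t^{\mathbb C}$ define $\exp(x)\in C(K)$ by $\exp(x)(y)=e^{2\pi i\,y(x)}$, $y\in K$ (with $y$ extended complex-linearly). Then $L$ is the kernel of $\exp$ on $\mathfrak t$; put $T=\exp(\mathfrak t)\cong\mathfrak t/L$, $T^{\mathbb C}=\exp(\mathfrak t^{\mathbb C})\subseteq(\mathbb C^* )^n$, acting on $C(K)$ by multiplication, and $G=FT\subset\mathrm{GL}(C(K))$. *)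

theory Defs
  imports
    "HOL-Analysis.Analysis"
    "HOL-Algebra.Bij"
    "HOL-Algebra.Product_Groups"
    "HOL-Computational_Algebra.Group_Closure"
    "HOL-Library.Function_Algebras"
begin

text \<open>
  A finite-dimensional vector space is a finite-dimensional subspace \<open>V\<close> of an ambient space given
  by an explicit scalar multiplication \<open>s\<close>; \<open>V\<close> may be the whole type or \<open>{0}\<close>. The carrier is
  needed because the space of functions on a finite set \<open>K\<close> below is not a type. Operators on \<open>V\<close>
  are extensional functions, as in \<open>BijGroup\<close>.
\<close>

definition findim_space :: "('k::field \<Rightarrow> 'v::ab_group_add \<Rightarrow> 'v) \<Rightarrow> 'v set \<Rightarrow> bool" where
  "findim_space s V \<longleftrightarrow>
     vector_space s \<and> module.subspace s V \<and> (\<exists>B. finite B \<and> module.span s B = V)"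

definition is_basis :: "('k::field \<Rightarrow> 'v::ab_group_add \<Rightarrow> 'v) \<Rightarrow> 'v set \<Rightarrow> 'v set \<Rightarrow> bool" where
  "is_basis s V B \<longleftrightarrow> \<not> module.dependent s B \<and> module.span s B = V"

definition lin_on ::
  "('k::field \<Rightarrow> 'v::ab_group_add \<Rightarrow> 'v) \<Rightarrow> 'v set \<Rightarrow> ('k \<Rightarrow> 'w::ab_group_add \<Rightarrow> 'w) \<Rightarrow> ('v \<Rightarrow> 'w) \<Rightarrow> bool"
where
  "lin_on s V s' A \<longleftrightarrow>
     (\<forall>x\<in>V. \<forall>y\<in>V. A (x + y) = A x + A y) \<and> (\<forall>c. \<forall>x\<in>V. A (s c x) = s' c (A x))"

definition End_space :: "('k::field \<Rightarrow> 'v::ab_group_add \<Rightarrow> 'v) \<Rightarrow> 'v set \<Rightarrow> ('v \<Rightarrow> 'v) set" where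
  "End_space s V = {A \<in> V \<rightarrow>\<^sub>E V. lin_on s V s A}"

definition GL :: "('k::field \<Rightarrow> 'v::ab_group_add \<Rightarrow> 'v) \<Rightarrow> 'v set \<Rightarrow> ('v \<Rightarrow> 'v) monoid" where
  "GL s V = BijGroup V \<lparr>carrier := {A \<in> Bij V. lin_on s V s A}\<rparr>"

text \<open>
  The usual topology on the operators of a finite-dimensional complex space, described without a
  choice of basis or norm: the initial topology for all matrix coefficients \<open>A \<mapsto> \<phi> (A x)\<close>.
\<close>

definition lin_functionals :: "(complex \<Rightarrow> 'v::ab_group_add \<Rightarrow> 'v) \<Rightarrow> 'v set \<Rightarrow> ('v \<Rightarrow> complex) set" where
  "lin_functionals s V = {\<phi> \<in> extensional V. lin_on s V (*) \<phi>}"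

definition op_topology :: "(complex \<Rightarrow> 'v::ab_group_add \<Rightarrow> 'v) \<Rightarrow> 'v set \<Rightarrow> ('v \<Rightarrow> 'v) topology" where
  "op_topology s V =
     pullback_topology (End_space s V)
       (\<lambda>A. \<lambda>(\<phi>, x) \<in> lin_functionals s V \<times> V. \<phi> (A x))
       (product_topology (\<lambda>_. euclidean) (lin_functionals s V \<times> V))"

definition op_exp :: "(complex \<Rightarrow> 'v::ab_group_add \<Rightarrow> 'v) \<Rightarrow> 'v set \<Rightarrow> ('v \<Rightarrow> 'v) \<Rightarrow> 'v \<Rightarrow> 'v" where
  "op_exp s V X =
     (THE A. limitin (op_topology s V)
        (\<lambda>N. \<lambda>x\<in>V. \<Sum>n<N. s (1 / fact n) ((X ^^ n) x)) A sequentially)"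

definition lie_algebra ::
  "(complex \<Rightarrow> 'v::ab_group_add \<Rightarrow> 'v) \<Rightarrow> 'v set \<Rightarrow> ('v \<Rightarrow> 'v) set \<Rightarrow> ('v \<Rightarrow> 'v) set"
where
  "lie_algebra s V T =
     {X \<in> End_space s V. \<forall>r::real. op_exp s V (\<lambda>x\<in>V. s (of_real r) (X x)) \<in> T}"

definition complexified_torus ::
  "(complex \<Rightarrow> 'v::ab_group_add \<Rightarrow> 'v) \<Rightarrow> 'v set \<Rightarrow> ('v \<Rightarrow> 'v) set \<Rightarrow> ('v \<Rightarrow> 'v) set"
where
  "complexified_torus s V T =
     {op_exp s V (\<lambda>x\<in>V. X x + s \<i> (Y x)) | X Y. X \<in> lie_algebra s V T \<and> Y \<in> lie_algebra s V T}"

definition circle_group :: "complex monoid" where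
  "circle_group = \<lparr>carrier = sphere 0 1, mult = (*), one = 1\<rparr>"

definition is_torus :: "('a, 'b) monoid_scheme \<Rightarrow> 'a topology \<Rightarrow> bool" where
  "is_torus H X \<longleftrightarrow>
     (\<exists>(k::nat) h. h \<in> iso (product_group {..<k} (\<lambda>_. circle_group)) H \<and>
        homeomorphic_map (product_topology (\<lambda>_. top_of_set (sphere 0 1)) {..<k}) X h)"

definition torus_setting ::
  "(complex \<Rightarrow> 'v::ab_group_add \<Rightarrow> 'v) \<Rightarrow> 'v set \<Rightarrow>
   ('v \<Rightarrow> 'v) set \<Rightarrow> ('v \<Rightarrow> 'v) set \<Rightarrow> ('v \<Rightarrow> 'v) set \<Rightarrow> 'v \<Rightarrow> bool"
where
  "torus_setting s V G F T v \<longleftrightarrow>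
     findim_space s V \<and>
     subgroup G (GL s V) \<and> compactin (op_topology s V) G \<and>
     T = connected_component_of_set (subtopology (op_topology s V) G) \<one>\<^bsub>GL s V\<^esub> \<and>
     is_torus (GL s V \<lparr>carrier := T\<rparr>) (subtopology (op_topology s V) T) \<and>
     subgroup F (GL s V) \<and> F \<subseteq> G \<and> finite F \<and> v \<in> V"

definition invariant_subspace ::
  "(complex \<Rightarrow> 'v::ab_group_add \<Rightarrow> 'v) \<Rightarrow> 'v set \<Rightarrow> ('v \<Rightarrow> 'v) set \<Rightarrow> 'v set \<Rightarrow> bool"
where
  "invariant_subspace s V T W \<longleftrightarrow> module.subspace s W \<and> W \<subseteq> V \<and> (\<forall>\<tau>\<in>T. \<tau> ` W \<subseteq> W)"

definition irreducible_subspace ::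
  "(complex \<Rightarrow> 'v::ab_group_add \<Rightarrow> 'v) \<Rightarrow> 'v set \<Rightarrow> ('v \<Rightarrow> 'v) set \<Rightarrow> 'v set \<Rightarrow> bool"
where
  "irreducible_subspace s V T W \<longleftrightarrow>
     invariant_subspace s V T W \<and> W \<noteq> {0} \<and>
     (\<forall>U. invariant_subspace s V T U \<and> U \<subseteq> W \<longrightarrow> U = {0} \<or> U = W)"

definition equivariantly_isomorphic ::
  "(complex \<Rightarrow> 'v::ab_group_add \<Rightarrow> 'v) \<Rightarrow> ('v \<Rightarrow> 'v) set \<Rightarrow> 'v set \<Rightarrow> 'v set \<Rightarrow> bool"
where
  "equivariantly_isomorphic s T W W' \<longleftrightarrow>
     (\<exists>\<psi>. bij_betw \<psi> W W' \<and> lin_on s W s \<psi> \<and> (\<forall>\<tau>\<in>T. \<forall>w\<in>W. \<psi> (\<tau> w) = \<tau> (\<psi> w)))"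

definition isotypical_component ::
  "(complex \<Rightarrow> 'v::ab_group_add \<Rightarrow> 'v) \<Rightarrow> 'v set \<Rightarrow> ('v \<Rightarrow> 'v) set \<Rightarrow> 'v set \<Rightarrow> 'v set"
where
  "isotypical_component s V T W =
     module.span s
       (\<Union>{W'. irreducible_subspace s V T W' \<and> equivariantly_isomorphic s T W W'})"

definition simple_spectrum ::
  "(complex \<Rightarrow> 'v::ab_group_add \<Rightarrow> 'v) \<Rightarrow> 'v set \<Rightarrow> ('v \<Rightarrow> 'v) set \<Rightarrow> bool"
where
  "simple_spectrum s V T \<longleftrightarrow>
     (\<forall>W. irreducible_subspace s V T W \<longrightarrow>
        vector_space.dim s (isotypical_component s V T W) \<le> 1)"

definition joint_eigenvector ::
  "(complex \<Rightarrow> 'v::ab_group_add \<Rightarrow> 'v) \<Rightarrow> ('v \<Rightarrow> 'v) set \<Rightarrow> 'v \<Rightarrow> bool"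
where
  "joint_eigenvector s T b \<longleftrightarrow> b \<noteq> 0 \<and> (\<forall>\<tau>\<in>T. \<exists>c. \<tau> b = s c b)"

definition cond_a ::
  "(complex \<Rightarrow> 'v::ab_group_add \<Rightarrow> 'v) \<Rightarrow> 'v set \<Rightarrow>
   ('v \<Rightarrow> 'v) set \<Rightarrow> ('v \<Rightarrow> 'v) set \<Rightarrow> ('v \<Rightarrow> 'v) set \<Rightarrow> bool"
where
  "cond_a s V G F T \<longleftrightarrow>
     G = F <#>\<^bsub>GL s V\<^esub> T \<and> G = T <#>\<^bsub>GL s V\<^esub> F \<and>
     (\<lambda>f. T #>\<^bsub>GL s V\<^esub> f) \<in> iso (GL s V \<lparr>carrier := F\<rparr>) (GL s V \<lparr>carrier := G\<rparr> Mod T)"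

definition cond_b ::
  "(complex \<Rightarrow> 'v::ab_group_add \<Rightarrow> 'v) \<Rightarrow> 'v set \<Rightarrow> ('v \<Rightarrow> 'v) set \<Rightarrow> ('v \<Rightarrow> 'v) set \<Rightarrow> 'v \<Rightarrow> bool"
where
  "cond_b s V G T v \<longleftrightarrow> (\<lambda>g. g v) ` G \<subseteq> (\<lambda>g. g v) ` complexified_torus s V T"

definition cond_c ::
  "(complex \<Rightarrow> 'v::ab_group_add \<Rightarrow> 'v) \<Rightarrow> 'v set \<Rightarrow> ('v \<Rightarrow> 'v) set \<Rightarrow> 'v \<Rightarrow> bool"
where
  "cond_c s V T v \<longleftrightarrow>
     simple_spectrum s V T \<and>
     (\<exists>B. is_basis s V B \<and> (\<forall>b\<in>B. joint_eigenvector s T b) \<and>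
        (\<forall>b\<in>B. module.representation s B v b \<noteq> 0))"

definition cond_d :: "('v \<Rightarrow> 'v) set \<Rightarrow> 'v \<Rightarrow> bool" where
  "cond_d F v \<longleftrightarrow> (\<forall>f\<in>F. f v = v)"

definition cond_e ::
  "(complex \<Rightarrow> 'v::ab_group_add \<Rightarrow> 'v) \<Rightarrow> 'v set \<Rightarrow> ('v \<Rightarrow> 'v) set \<Rightarrow> 'v \<Rightarrow> bool"
where
  "cond_e s V T v \<longleftrightarrow> module.span s ((\<lambda>\<tau>. \<tau> v) ` T) = V"

definition conds_abcde ::
  "(complex \<Rightarrow> 'v::ab_group_add \<Rightarrow> 'v) \<Rightarrow> 'v set \<Rightarrow>
   ('v \<Rightarrow> 'v) set \<Rightarrow> ('v \<Rightarrow> 'v) set \<Rightarrow> ('v \<Rightarrow> 'v) set \<Rightarrow> 'v \<Rightarrow> bool"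
where
  "conds_abcde s V G F T v \<longleftrightarrow>
     cond_a s V G F T \<and> cond_b s V G T v \<and> cond_c s V T v \<and> cond_d F v \<and> cond_e s V T v"


subsection \<open>Construction M\<close>

text \<open>
  Here \<open>s\<close> is the scalar multiplication of the real space \<open>t\<close>. Functionals on \<open>t\<close> and
  functions on \<open>K\<close> are extended by zero, so that the pointwise operations on the function
  types are those of the dual space and of \<open>C(K)\<close>.
\<close>

definition is_lattice :: "(real \<Rightarrow> 't::ab_group_add \<Rightarrow> 't) \<Rightarrow> 't set \<Rightarrow> 't set \<Rightarrow> bool" where
  "is_lattice s t L \<longleftrightarrow>
     (\<exists>B. finite B \<and> is_basis s t B \<and> L = range (\<lambda>c::'t \<Rightarrow> int. \<Sum>b\<in>B. s (of_int (c b)) b))"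

definition dual_space :: "(real \<Rightarrow> 't::ab_group_add \<Rightarrow> 't) \<Rightarrow> 't set \<Rightarrow> ('t \<Rightarrow> real) set" where
  "dual_space s t = {y. lin_on s t (*) y \<and> (\<forall>x. x \<notin> t \<longrightarrow> y x = 0)}"

definition dual_lattice :: "(real \<Rightarrow> 't::ab_group_add \<Rightarrow> 't) \<Rightarrow> 't set \<Rightarrow> 't set \<Rightarrow> ('t \<Rightarrow> real) set" where
  "dual_lattice s t L = {y \<in> dual_space s t. \<forall>x\<in>L. y x \<in> \<int>}"

definition contragredient ::
  "(real \<Rightarrow> 't::ab_group_add \<Rightarrow> 't) \<Rightarrow> 't set \<Rightarrow> ('t \<Rightarrow> 't) \<Rightarrow> ('t \<Rightarrow> real) \<Rightarrow> 't \<Rightarrow> real"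
where
  "contragredient s t f y = (\<lambda>x. if x \<in> t then y ((inv\<^bsub>GL s t\<^esub> f) x) else 0)"

definition M_data ::
  "(real \<Rightarrow> 't::ab_group_add \<Rightarrow> 't) \<Rightarrow> 't set \<Rightarrow> 't set \<Rightarrow> ('t \<Rightarrow> real) set \<Rightarrow> ('t \<Rightarrow> 't) set \<Rightarrow> bool"
where
  "M_data s t L K F \<longleftrightarrow>
     findim_space s t \<and> is_lattice s t L \<and>
     finite K \<and> K \<subseteq> dual_lattice s t L \<and> group_closure K = dual_lattice s t L \<and>
     subgroup F (GL s t) \<and> finite F \<and> (\<forall>f\<in>F. contragredient s t f ` K = K)"

definition pointwise_scale :: "'k::times \<Rightarrow> ('a \<Rightarrow> 'k) \<Rightarrow> 'a \<Rightarrow> 'k" where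
  "pointwise_scale c u = (\<lambda>x. c * u x)"

definition C_fun :: "'a set \<Rightarrow> ('a \<Rightarrow> complex) set" where
  "C_fun K = {u. \<forall>y. y \<notin> K \<longrightarrow> u y = 0}"

definition nowhere_vanishing :: "'a set \<Rightarrow> ('a \<Rightarrow> complex) set" where
  "nowhere_vanishing K = {u \<in> C_fun K. \<forall>y\<in>K. u y \<noteq> 0}"

definition M_action ::
  "(real \<Rightarrow> 't::ab_group_add \<Rightarrow> 't) \<Rightarrow> 't set \<Rightarrow> ('t \<Rightarrow> real) set \<Rightarrow>
   ('t \<Rightarrow> 't) \<Rightarrow> (('t \<Rightarrow> real) \<Rightarrow> complex) \<Rightarrow> ('t \<Rightarrow> real) \<Rightarrow> complex"
where
  "M_action s t K f =
     (\<lambda>u \<in> C_fun K. \<lambda>y. if y \<in> K then u (contragredient s t (inv\<^bsub>GL s t\<^esub> f) y) else 0)"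

definition invariant_functions ::
  "(real \<Rightarrow> 't::ab_group_add \<Rightarrow> 't) \<Rightarrow> 't set \<Rightarrow> ('t \<Rightarrow> real) set \<Rightarrow> ('t \<Rightarrow> 't) set \<Rightarrow>
   (('t \<Rightarrow> real) \<Rightarrow> complex) set"
where
  "invariant_functions s t K F = {u \<in> C_fun K. \<forall>f\<in>F. M_action s t K f u = u}"

text \<open>
  The pair \<open>(a, b)\<close> stands for the element \<open>a + i b\<close> of the complexification of \<open>t\<close>.
\<close>

definition M_exp :: "('t \<Rightarrow> real) set \<Rightarrow> 't \<times> 't \<Rightarrow> ('t \<Rightarrow> real) \<Rightarrow> complex" where
  "M_exp K = (\<lambda>(a, b). \<lambda>y. if y \<in> K
     then exp (2 * of_real pi * \<i> * (of_real (y a) + \<i> * of_real (y b))) else 0)"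

definition mult_op :: "'a set \<Rightarrow> ('a \<Rightarrow> complex) \<Rightarrow> ('a \<Rightarrow> complex) \<Rightarrow> 'a \<Rightarrow> complex" where
  "mult_op K u = (\<lambda>w \<in> C_fun K. \<lambda>y. u y * w y)"

definition M_torus ::
  "'t::ab_group_add set \<Rightarrow> ('t \<Rightarrow> real) set \<Rightarrow> ((('t \<Rightarrow> real) \<Rightarrow> complex) \<Rightarrow> ('t \<Rightarrow> real) \<Rightarrow> complex) set"
where
  "M_torus t K = (\<lambda>a. mult_op K (M_exp K (a, 0))) ` t"

definition M_finite ::
  "(real \<Rightarrow> 't::ab_group_add \<Rightarrow> 't) \<Rightarrow> 't set \<Rightarrow> ('t \<Rightarrow> real) set \<Rightarrow> ('t \<Rightarrow> 't) set \<Rightarrow>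
   ((('t \<Rightarrow> real) \<Rightarrow> complex) \<Rightarrow> ('t \<Rightarrow> real) \<Rightarrow> complex) set"
where
  "M_finite s t K F = M_action s t K ` F"

definition M_group ::
  "(real \<Rightarrow> 't::ab_group_add \<Rightarrow> 't) \<Rightarrow> 't set \<Rightarrow> ('t \<Rightarrow> real) set \<Rightarrow> ('t \<Rightarrow> 't) set \<Rightarrow>
   ((('t \<Rightarrow> real) \<Rightarrow> complex) \<Rightarrow> ('t \<Rightarrow> real) \<Rightarrow> complex) set"
where
  "M_group s t K F = M_finite s t K F <#>\<^bsub>GL pointwise_scale (C_fun K)\<^esub> M_torus t K"

definition conj_op :: "'v set \<Rightarrow> 'w set \<Rightarrow> ('v \<Rightarrow> 'w) \<Rightarrow> ('v \<Rightarrow> 'v) \<Rightarrow> 'w \<Rightarrow> 'w" where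
  "conj_op V W \<Phi> A = (\<lambda>w\<in>W. \<Phi> (A (inv_into V \<Phi> w)))"

text \<open>
  The real space of the construction is sought among the finite-dimensional subspaces of
  \<open>nat \<Rightarrow> real\<close>, which represent all isomorphism classes of finite-dimensional real spaces.
\<close>

definition M_realizable ::
  "(complex \<Rightarrow> 'v::ab_group_add \<Rightarrow> 'v) \<Rightarrow> 'v set \<Rightarrow>
   ('v \<Rightarrow> 'v) set \<Rightarrow> ('v \<Rightarrow> 'v) set \<Rightarrow> ('v \<Rightarrow> 'v) set \<Rightarrow> 'v \<Rightarrow> bool"
where
  "M_realizable s V G F T v \<longleftrightarrow>
     (\<exists>(t :: (nat \<Rightarrow> real) set) L K F\<^sub>0 \<Phi>.
        M_data pointwise_scale t L K F\<^sub>0 \<and>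
        bij_betw \<Phi> V (C_fun K) \<and> lin_on s V pointwise_scale \<Phi> \<and>
        conj_op V (C_fun K) \<Phi> ` G = M_group pointwise_scale t K F\<^sub>0 \<and>
        conj_op V (C_fun K) \<Phi> ` F = M_finite pointwise_scale t K F\<^sub>0 \<and>
        conj_op V (C_fun K) \<Phi> ` T = M_torus t K \<and>
        \<Phi> v \<in> nowhere_vanishing K \<inter> invariant_functions pointwise_scale t K F\<^sub>0)"

end

theory Submission
  imports Defs
begin

text \<open>
  Forward direction: parametrise \<open>T\<close> by \<open>(S\<^sup>1)\<^sup>k\<close> and let \<open>t\<close> be \<open>\<real>\<^sup>k\<close> with the lattice \<open>\<int>\<^sup>k\<close>. On an
  eigenbasis, scaled so that \<open>v\<close> is the sum of its vectors, \<open>T\<close> acts by characters with integral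
  exponents; these weights form \<open>K\<close>. They are distinct because \<open>Tv\<close> spans \<open>V\<close>, and they generate
  the dual lattice because \<open>T\<close> acts faithfully: a proper subgroup of \<open>\<int>\<^sup>k\<close> is annihilated by a
  nontrivial character of \<open>\<int>\<^sup>k\<close>. An element of \<open>F\<close> normalises \<open>T\<close>, so it maps eigenlines to
  eigenlines, and as it fixes \<open>v\<close> it permutes the basis. The induced permutation of \<open>K\<close> preserves
  integral relations, hence comes from a linear map of \<open>t\<close>.

  Converse: a basis of \<open>L\<close> identifies \<open>T\<close> with a product of circles. As \<open>G\<close> is a finite union of
  compact cosets of \<open>T\<close>, the subgroup \<open>T\<close> is open, closed and connected in \<open>G\<close>. Distinct elements of
  \<open>K\<close> are separated by \<open>T\<close>, so a \<open>T\<close>-invariant subspace contains every unit function at which one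
  of its members does not vanish; this gives the simple spectrum and \<open>span Tv = V\<close>.
\<close>

section \<open>Characters\<close>

text \<open>One device recurs in both directions. Characters of the torus see linear functions only
  modulo the integers, but a linear function on a real vector space all of whose values are integers
  vanishes, since some multiple of a nonzero real number is not an integer. This separates distinct
  elements of \<open>K\<close> by torus elements and turns congruences between weights into
  equations. The delicate point of the forward direction is the linearity of the action of
  \<open>F\<close> on the real space. Conjugating a torus element by f determines its new parameter
  only up to a lattice vector, and nothing makes a choice of such parameters linear. The remedy is
  arithmetical: each coordinate is an integral combination of weights, and permuting the weights in
  this formula yields a linear candidate \<open>lift f\<close>. It differs from any chosen parameter
  by a lattice vector, so the device applies. Hence the fact that the weights generate the dual
  lattice is both a requirement on \<open>K\<close> and the tool that constructs the group acting on
  the real space.\<close>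

lemma additive_continuous_imp_linear:
  fixes g :: "real \<Rightarrow> 'a::real_normed_vector"
  assumes cont: "continuous_on UNIV g" and add: "\<And>x y. g (x + y) = g x + g y"
  shows "g x = x *\<^sub>R g 1"
proof -
  have g0: "g 0 = 0" using add[of 0 0] by simp
  have gm: "g (- x) = - g x" for x using add[of x "-x"] g0 by (simp add: eq_neg_iff_add_eq_0 add.commute)
  have gn: "g (of_nat n * x) = of_nat n *\<^sub>R g x" for n x
    by (induction n) (auto simp: g0 add algebra_simps)
  have gi: "g (of_int i * x) = of_int i *\<^sub>R g x" for i x
    by (cases i rule: int_cases2) (auto simp: gn gm)
  have gq: "g q = q *\<^sub>R g 1" if "q \<in> \<rat>" for q
  proof -
    from that obtain a b where q: "q = of_int a / of_int b" "b > 0"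
      by (cases q rule: Rats_cases') auto
    have "of_int b *\<^sub>R g q = g (of_int a * 1)" using q by (simp flip: gi)
    also have "\<dots> = of_int b *\<^sub>R (q *\<^sub>R g 1)" unfolding gi using q by simp
    finally show ?thesis using q(2) by (metis less_irrefl of_int_0_eq_iff real_vector.scale_left_imp_eq)
  qed
  \<comment> \<open>Additivity settles the rational points; the set of agreement is closed and the
    rationals are dense.\<close>
  have "closed {x. g x = x *\<^sub>R g 1}"
    by (intro closed_Collect_eq cont continuous_intros)
  then have "closure \<rat> \<subseteq> {x. g x = x *\<^sub>R g 1}"
    using gq by (intro closure_minimal subsetI CollectI)
  then show ?thesis by (auto simp: Rats_closure_real)
qed

text \<open>A continuous logarithm \<open>g\<close> of \<open>\<phi>\<close> is additive up to a
  defect \<open>D x y\<close>, a multiple of 2 pi i. For fixed \<open>x\<close> this defect is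
  continuous in \<open>y\<close> with discrete values, hence constant. So a shift of
  \<open>g\<close> is continuous and additive, therefore linear, and \<open>\<phi> 1 = 1\<close>
  makes its slope an integral multiple of 2 pi i.\<close>

lemma continuous_periodic_character:
  fixes \<phi> :: "real \<Rightarrow> complex"
  assumes cont: "continuous_on UNIV \<phi>" and mult: "\<And>x y. \<phi> (x + y) = \<phi> x * \<phi> y" and one: "\<phi> 1 = 1"
  shows "\<exists>m::int. \<forall>x. \<phi> x = exp (2 * of_real pi * \<i> * of_real (of_int m * x))"
proof -
  have nz: "\<phi> x \<noteq> 0" for x using mult[of x "1 - x"] one by auto
  obtain g where g: "continuous_on UNIV g" "\<And>x. \<phi> x = exp (g x)"
    using continuous_logarithm_on_contractible[OF cont convex_imp_contractible[OF convex_UNIV]] nz by auto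
  define D where "D x y = g (x + y) - g x - g y" for x y
  have D0: "D x y = D x 0" for x y
  proof -
    have cD: "continuous_on UNIV (D x)" unfolding D_def
      by (intro continuous_intros continuous_on_compose2[OF g(1)]) auto
    have rng: "D x y \<in> range (\<lambda>n::int. 2 * of_int n * of_real pi * \<i>)" for y
    proof -
      have "exp (D x y) = 1" using mult[of x y] nz[of x] nz[of y] unfolding D_def g(2) by (simp add: exp_diff)
      then obtain n :: int where "Re (D x y) = 0" "Im (D x y) = of_int (2 * n) * pi" by (auto simp: exp_eq_1)
      then have "D x y = 2 * of_int n * of_real pi * \<i>" by (simp add: complex_eq_iff)
      then show ?thesis by (rule range_eqI)
    qed
    have "D x constant_on UNIV"
    proof (rule continuous_discrete_range_constant[OF connected_UNIV cD])
      fix z :: real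
      show "\<exists>e>0. \<forall>y. y \<in> UNIV \<and> D x y \<noteq> D x z \<longrightarrow> e \<le> cmod (D x y - D x z)"
      proof (intro exI[of _ 1] conjI allI impI)
        fix y assume ne: "y \<in> UNIV \<and> D x y \<noteq> D x z"
        obtain a b :: int where ab: "D x y = 2 * of_int a * of_real pi * \<i>" "D x z = 2 * of_int b * of_real pi * \<i>"
          using rng[of y] rng[of z] by auto
        have "D x y - D x z = of_real (2 * pi * of_int (a - b)) * \<i>" using ab by (simp add: algebra_simps)
        then have "cmod (D x y - D x z) = 2 * pi * \<bar>of_int (a - b) :: real\<bar>" by (simp only: norm_mult norm_of_real) (simp add: abs_mult)
        moreover have "\<bar>of_int (a - b) :: real\<bar> \<ge> 1" using ne ab by (cases "a = b") (auto simp flip: of_int_diff of_int_abs)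
        moreover have "2 * pi * \<bar>of_int (a - b) :: real\<bar> \<ge> 1 * \<bar>of_int (a - b) :: real\<bar>" by (rule mult_right_mono) (use pi_ge_two in auto)
        ultimately show "1 \<le> cmod (D x y - D x z)" by (metis mult_1 order_trans)
      qed simp
    qed
    then show ?thesis by (auto simp: constant_on_def)
  qed
  \<comment> \<open>\<open>D x 0\<close> is \<open>- g 0\<close> for every \<open>x\<close>, so
    subtracting \<open>g 0\<close> removes the defect altogether.\<close>
  have Dc: "D x y = - g 0" for x y using D0 by (simp add: D_def)
  define G where "G x = g x - g 0" for x
  have "G (x + y) = G x + G y" for x y using Dc[of x y] by (simp add: G_def D_def algebra_simps)
  then have lin: "G x = x *\<^sub>R G 1" for x
    by (intro additive_continuous_imp_linear) (auto simp: G_def intro!: continuous_intros g)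
  have \<phi>G: "\<phi> x = exp (G x)" for x
  proof -
    have "\<phi> 0 = 1" using mult[of 0 1] one by simp
    then show ?thesis by (simp add: G_def exp_diff flip: g(2))
  qed
  have "exp (G 1) = 1" using \<phi>G one by simp
  then obtain m :: int where "Re (G 1) = 0" "Im (G 1) = of_int (2 * m) * pi" by (auto simp: exp_eq_1)
  then have "G 1 = 2 * of_int m * of_real pi * \<i>" by (simp add: complex_eq_iff)
  then show ?thesis
    by (intro exI[of _ m] allI) (simp add: \<phi>G, subst lin, simp add: scaleR_conv_of_real mult_ac)
qed

section \<open>Extension of characters of subgroups of integer vectors\<close>

lemma int_subgroup_principal:
  fixes D :: "int set"
  assumes "0 \<in> D" and diff: "\<And>a b. a \<in> D \<Longrightarrow> b \<in> D \<Longrightarrow> a - b \<in> D"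
  shows "\<exists>d. D = {n. d dvd n}"
proof (intro exI[of _ "Gcd D"] equalityI subsetI)
  show "x \<in> {n. Gcd D dvd n}" if "x \<in> D" for x using that by simp
  have "group_closure D = D"
  proof
    show "group_closure D \<subseteq> D"
    proof
      fix x assume "x \<in> group_closure D"
      then show "x \<in> D" by induction (use assms in auto)
    qed
  qed (auto intro: group_closure.base)
  \<comment> \<open>Bezout: the gcd is an integral combination of elements of \<open>D\<close>. For
    \<open>D = {0}\<close> it is 0, a generator that the choices of values below treat as a separate
    case.\<close>
  then have "Gcd D \<in> D" using Gcd_group_closure_in_group_closure[of D] by simp
  fix x assume "x \<in> {n. Gcd D dvd n}"
  then obtain c where "x = Gcd D * c" by auto
  then show "x \<in> D" using group_closure_mult_left[of "Gcd D" D c] \<open>Gcd D \<in> D\<close> \<open>group_closure D = D\<close> by simp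
qed

text \<open>Characters are written additively, as real functions that are additive modulo the integers.\<close>

definition additive_mod_int :: "(nat \<Rightarrow> int) set \<Rightarrow> ((nat \<Rightarrow> int) \<Rightarrow> real) \<Rightarrow> bool" where
  "additive_mod_int A \<theta> \<longleftrightarrow> (\<forall>a\<in>A. \<forall>b\<in>A. \<theta> (a + b) - \<theta> a - \<theta> b \<in> \<int>)"

definition int_subgroup :: "(nat \<Rightarrow> int) set \<Rightarrow> bool" where
  "int_subgroup A \<longleftrightarrow> 0 \<in> A \<and> (\<forall>a\<in>A. \<forall>b\<in>A. a - b \<in> A)"

definition int_scale :: "int \<Rightarrow> (nat \<Rightarrow> int) \<Rightarrow> nat \<Rightarrow> int" where
  "int_scale n g = (\<lambda>j. n * g j)"

lemma int_scale_simps: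
  "int_scale 0 g = 0" "int_scale (a + b) g = int_scale a g + int_scale b g"
  "int_scale (a - b) g = int_scale a g - int_scale b g" "int_scale 1 g = g"
  "int_scale (- a) g = - int_scale a g" "int_scale (a * b) g = int_scale a (int_scale b g)"
  by (auto simp: int_scale_def fun_eq_iff algebra_simps)

lemma int_subgroupD:
  assumes "int_subgroup A"
  shows "0 \<in> A" "a \<in> A \<Longrightarrow> b \<in> A \<Longrightarrow> a - b \<in> A" "a \<in> A \<Longrightarrow> - a \<in> A" "a \<in> A \<Longrightarrow> b \<in> A \<Longrightarrow> a + b \<in> A"
proof -
  show 0: "0 \<in> A" and d: "\<And>a b. a \<in> A \<Longrightarrow> b \<in> A \<Longrightarrow> a - b \<in> A" using assms by (auto simp: int_subgroup_def)
  show m: "- a \<in> A" if "a \<in> A" for a using d[OF 0 that] by simp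
  show "a + b \<in> A" if "a \<in> A" "b \<in> A" using d[OF that(1) m[OF that(2)]] by simp
qed

lemma int_subgroup_scale:
  assumes A: "int_subgroup A" and g: "g \<in> A"
  shows "int_scale n g \<in> A"
proof -
  have nat: "int_scale (int i) g \<in> A" for i
    by (induction i) (simp_all only: of_nat_0 of_nat_Suc int_scale_simps int_subgroupD[OF A] g)
  show ?thesis
    by (cases n rule: int_cases2) (use nat int_subgroupD[OF A] in \<open>auto simp: int_scale_simps\<close>)
qed

lemma additive_mod_int_zero:
  assumes A: "int_subgroup A" and \<theta>: "additive_mod_int A \<theta>"
  shows "\<theta> 0 \<in> \<int>"
proof -
  have "\<theta> (0 + 0) - \<theta> 0 - \<theta> 0 \<in> \<int>" using \<theta> int_subgroupD(1)[OF A] unfolding additive_mod_int_def by blast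
  then have "- \<theta> 0 \<in> \<int>" by simp
  then show ?thesis using Ints_minus by fastforce
qed

lemma additive_mod_int_scale:
  assumes A: "int_subgroup A" and \<theta>: "additive_mod_int A \<theta>" and g: "g \<in> A"
  shows "\<theta> (int_scale n g) - of_int n * \<theta> g \<in> \<int>"
proof -
  have step: "\<theta> (int_scale (n + 1) g) - of_int (n + 1) * \<theta> g \<in> \<int> \<longleftrightarrow> \<theta> (int_scale n g) - of_int n * \<theta> g \<in> \<int>" for n
  proof -
    have z: "\<theta> (int_scale n g + g) - \<theta> (int_scale n g) - \<theta> g \<in> \<int>"
      using \<theta> g int_subgroup_scale[OF A g, of n] by (auto simp: additive_mod_int_def)
    have "\<theta> (int_scale (n + 1) g) - of_int (n + 1) * \<theta> g =
      (\<theta> (int_scale n g + g) - \<theta> (int_scale n g) - \<theta> g) + (\<theta> (int_scale n g) - of_int n * \<theta> g)"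
      by (simp add: int_scale_simps algebra_simps)
    then show ?thesis using z by (metis Ints_add Ints_diff add_diff_cancel_left')
  qed
  have z0: "\<theta> (int_scale 0 g) - of_int 0 * \<theta> g \<in> \<int>" using additive_mod_int_zero[OF A \<theta>] by (simp add: int_scale_simps)
  show ?thesis
  proof (induction n rule: int_induct[where k = 0])
    case (step1 i) then show ?case using step by blast
  next
    case (step2 i) then show ?case using step[of "i - 1"] by simp
  qed (rule z0)
qed

text \<open>On the enlarged subgroup of all \<open>a + int_scale n g\<close> the new character has
  to be \<open>\<theta> a + of_int n * w\<close>. The condition on \<open>w\<close> says that this
  is independent of the representation modulo the integers.\<close>

lemma additive_mod_int_extend:
  assumes A: "int_subgroup A" and \<theta>: "additive_mod_int A \<theta>"
    and w: "\<And>n. int_scale n g \<in> A \<Longrightarrow> of_int n * w - \<theta> (int_scale n g) \<in> \<int>"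
  shows "\<exists>A' \<psi>. int_subgroup A' \<and> A \<subseteq> A' \<and> g \<in> A' \<and> additive_mod_int A' \<psi> \<and>
    (\<forall>a\<in>A. \<psi> a - \<theta> a \<in> \<int>) \<and> \<psi> g - w \<in> \<int>"
proof -
  define A' where "A' = {a + int_scale n g | a n. a \<in> A}"
  note sub = int_subgroupD[OF A]
  have \<theta>add: "\<theta> (a + b) - \<theta> a - \<theta> b \<in> \<int>" if "a \<in> A" "b \<in> A" for a b
    using \<theta> that by (auto simp: additive_mod_int_def)
  have \<theta>0: "\<theta> 0 \<in> \<int>" by (rule additive_mod_int_zero[OF A \<theta>])
  have wd: "(\<theta> a + of_int n * w) - (\<theta> b + of_int m * w) \<in> \<int>"
    if "a \<in> A" "b \<in> A" and eq: "a + int_scale n g = b + int_scale m g" for a b n m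
  proof -
    have e: "int_scale (n - m) g = b - a" using eq by (simp add: int_scale_simps algebra_simps)
    then have 1: "of_int (n - m) * w - \<theta> (b - a) \<in> \<int>" using w[of "n - m"] sub(2) that by simp
    have 2: "\<theta> (a + (b - a)) - \<theta> a - \<theta> (b - a) \<in> \<int>" using \<theta>add that sub(2) by blast
    have "(\<theta> a + of_int n * w) - (\<theta> b + of_int m * w) =
      (of_int (n - m) * w - \<theta> (b - a)) - (\<theta> (a + (b - a)) - \<theta> a - \<theta> (b - a))" by (simp add: algebra_simps)
    then show ?thesis using 1 2 by (metis Ints_diff)
  qed
  \<comment> \<open>A representation of \<open>x\<close> is chosen arbitrarily; this is why
    \<open>\<psi>\<close> extends \<open>\<theta>\<close> only modulo the integers.\<close>
  define \<psi> where "\<psi> x = (SOME r. \<exists>a n. a \<in> A \<and> x = a + int_scale n g \<and> r = \<theta> a + of_int n * w)" for x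
  have \<psi>: "\<psi> (a + int_scale n g) - (\<theta> a + of_int n * w) \<in> \<int>" if "a \<in> A" for a n
  proof -
    have "\<exists>b m. b \<in> A \<and> a + int_scale n g = b + int_scale m g \<and> \<psi> (a + int_scale n g) = \<theta> b + of_int m * w"
      unfolding \<psi>_def by (rule someI_ex) (use that in blast)
    then show ?thesis using wd that by metis
  qed
  have "int_subgroup A'"
    unfolding int_subgroup_def
  proof (intro conjI ballI)
    show "0 \<in> A'" unfolding A'_def using sub(1) by (auto intro!: exI[of _ 0] simp: int_scale_simps)
    fix x y assume "x \<in> A'" "y \<in> A'"
    then obtain a n b m where "a \<in> A" "b \<in> A" "x = a + int_scale n g" "y = b + int_scale m g" by (auto simp: A'_def)
    then have "x - y = (a - b) + int_scale (n - m) g" "a - b \<in> A" using sub by (auto simp: int_scale_simps algebra_simps)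
    then show "x - y \<in> A'" unfolding A'_def by blast
  qed
  moreover have "A \<subseteq> A'" unfolding A'_def
  proof
    fix a assume "a \<in> A"
    then show "a \<in> {a + int_scale n g | a n. a \<in> A}"
      by (auto simp: int_scale_simps intro!: exI[of _ a] exI[of _ "0::int"])
  qed
  moreover have "g \<in> A'" unfolding A'_def using sub(1)
    by (intro CollectI exI[of _ "0 :: nat \<Rightarrow> int"] exI[of _ "1::int"]) (simp add: int_scale_simps)
  moreover have "additive_mod_int A' \<psi>" unfolding additive_mod_int_def
  proof (intro ballI)
    fix x y assume "x \<in> A'" "y \<in> A'"
    then obtain a n b m where ab: "a \<in> A" "b \<in> A" "x = a + int_scale n g" "y = b + int_scale m g" by (auto simp: A'_def)
    then have xy: "x + y = (a + b) + int_scale (n + m) g" by (auto simp: int_scale_simps algebra_simps)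
    have "\<psi> (x + y) - \<psi> x - \<psi> y = (\<psi> (x + y) - (\<theta> (a + b) + of_int (n + m) * w)) - (\<psi> x - (\<theta> a + of_int n * w))
      - (\<psi> y - (\<theta> b + of_int m * w)) + (\<theta> (a + b) - \<theta> a - \<theta> b)" by (simp add: algebra_simps)
    also have "\<dots> \<in> \<int>"
      using Ints_add[OF Ints_diff[OF Ints_diff[OF \<psi>[of "a + b" "n + m"] \<psi>[OF ab(1), of n]] \<psi>[OF ab(2), of m]] \<theta>add[OF ab(1,2)]]
        sub(4)[OF ab(1,2)] unfolding xy by (simp only: ab)
    finally show "\<psi> (x + y) - \<psi> x - \<psi> y \<in> \<int>" .
  qed
  moreover have "\<psi> a - \<theta> a \<in> \<int>" if "a \<in> A" for a using \<psi>[OF that, of 0] by (simp add: int_scale_simps)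
  moreover have "\<psi> g - w \<in> \<int>"
  proof -
    have "\<psi> g - w = (\<psi> (0 + int_scale 1 g) - (\<theta> 0 + of_int 1 * w)) + \<theta> 0" by (simp add: int_scale_simps)
    then show ?thesis using \<psi>[OF sub(1), of 1] \<theta>0 by (metis Ints_add)
  qed
  ultimately show ?thesis by blast
qed

lemma int_subgroup_multiples:
  assumes A: "int_subgroup A"
  shows "\<exists>d. \<forall>n. int_scale n g \<in> A \<longleftrightarrow> d dvd n"
proof -
  have "\<exists>d. {n. int_scale n g \<in> A} = {n. d dvd n}"
    by (rule int_subgroup_principal) (simp_all add: int_scale_simps int_subgroupD[OF A])
  then show ?thesis by blast
qed

text \<open>Divisibility of the reals modulo the integers: the multiples of \<open>g\<close> that
  lie in \<open>A\<close> are governed by a single \<open>d\<close>, so dividing the value at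
  \<open>int_scale d g\<close> by \<open>d\<close> meets every constraint. If \<open>d = 0\<close>,
  only \<open>n = 0\<close> imposes a condition, and that one holds for any
  \<open>w\<close>.\<close>

lemma additive_mod_int_extension_value:
  assumes A: "int_subgroup A" and \<theta>: "additive_mod_int A \<theta>"
  shows "\<exists>w. \<forall>n. int_scale n g \<in> A \<longrightarrow> of_int n * w - \<theta> (int_scale n g) \<in> \<int>"
proof -
  obtain d where d: "\<And>n. int_scale n g \<in> A \<longleftrightarrow> d dvd n" using int_subgroup_multiples[OF A] by metis
  define w where "w = \<theta> (int_scale d g) / of_int d"
  have "of_int n * w - \<theta> (int_scale n g) \<in> \<int>" if n: "int_scale n g \<in> A" for n
  proof -
    obtain q where q: "n = q * d" using d n by (metis dvdE mult.commute)
    have "\<theta> (int_scale q (int_scale d g)) - of_int q * \<theta> (int_scale d g) \<in> \<int>"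
      using additive_mod_int_scale[OF A \<theta>, of "int_scale d g" q] d by (simp add: set_eq_iff)
    then have "of_int q * \<theta> (int_scale d g) - \<theta> (int_scale n g) \<in> \<int>"
      using Ints_minus by (fastforce simp: q int_scale_simps)
    moreover have "of_int n * w = of_int q * \<theta> (int_scale d g)" if "d \<noteq> 0" using that by (simp add: q w_def)
    moreover have "\<theta> 0 \<in> \<int>" by (rule additive_mod_int_zero[OF A \<theta>])
    ultimately show ?thesis using q by (cases "d = 0") (simp_all only: int_scale_simps(1) not_False_eq_True, simp_all)
  qed
  then show ?thesis by blast
qed

text \<open>If \<open>M\<close> is proper, a character killing \<open>M\<close> but not some unit vector extends one generator at a time.\<close>

lemma int_subgroup_eq_full:
  assumes M: "int_subgroup M" and supp: "\<And>\<mu> j. \<mu> \<in> M \<Longrightarrow> j \<ge> k \<Longrightarrow> \<mu> j = 0"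
    and ann: "\<And>x. (\<forall>\<mu>\<in>M. (\<Sum>j<k. of_int (\<mu> j) * x j) \<in> \<int>) \<Longrightarrow> (\<forall>j<k. (x j :: real) \<in> \<int>)"
    and i: "i < k"
  shows "(\<lambda>j. of_bool (j = i)) \<in> M"
proof (rule ccontr)
  define e :: "nat \<Rightarrow> nat \<Rightarrow> int" where "e i = (\<lambda>j. of_bool (j = i))" for i
  assume "(\<lambda>j. of_bool (j = i)) \<notin> M"
  then have ei: "e i \<notin> M" by (simp add: e_def)
  obtain d where d: "\<And>n. int_scale n (e i) \<in> M \<longleftrightarrow> d dvd n" using int_subgroup_multiples[OF M] by metis
  have d1: "\<bar>d\<bar> \<noteq> 1" using d[of 1] ei by (simp add: int_scale_simps)
  \<comment> \<open>As \<open>e i\<close> is not in \<open>M\<close>, \<open>d\<close> is not a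
    unit, so \<open>1 / d\<close> is not an integer. If \<open>d = 0\<close>, no nonzero multiple of
    \<open>e i\<close> lies in \<open>M\<close>, and any nonintegral value such as 1/2 is
    admissible.\<close>
  define w :: real where "w = (if d = 0 then 1/2 else 1 / of_int d)"
  have "w \<notin> \<int>"
  proof
    assume "w \<in> \<int>"
    then obtain z where "w = of_int z" by (auto elim: Ints_cases)
    then have "real_of_int (z * (if d = 0 then 2 else d)) = of_int 1" by (auto simp: w_def field_simps split: if_splits)
    then have "z * (if d = 0 then 2 else d) = 1" by (simp only: of_int_eq_iff)
    then show False using d1 by (auto split: if_splits simp: zmult_eq_1_iff)
  qed
  have w: "of_int n * w - 0 \<in> \<int>" if "int_scale n (e i) \<in> M" for n
    using d[of n] that by (auto simp: w_def)
  have "additive_mod_int M (\<lambda>_. 0)" by (simp add: additive_mod_int_def)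
  from additive_mod_int_extend[where g = "e i", OF M this w] obtain A0 \<psi>0 where A0: "int_subgroup A0" "M \<subseteq> A0" "e i \<in> A0"
    "additive_mod_int A0 \<psi>0" "\<And>a. a \<in> M \<Longrightarrow> \<psi>0 a \<in> \<int>" "\<psi>0 (e i) - w \<in> \<int>" by auto
  \<comment> \<open>The value at \<open>e i\<close> is fixed first; adjoining the other unit vectors
    afterwards changes it by integers only.\<close>
  have "\<exists>A \<psi>. int_subgroup A \<and> M \<subseteq> A \<and> e i \<in> A \<and> (\<forall>j<l. e j \<in> A) \<and> additive_mod_int A \<psi> \<and>
    (\<forall>a\<in>M. \<psi> a \<in> \<int>) \<and> \<psi> (e i) - w \<in> \<int>" for l
  proof (induction l)
    case 0 then show ?case using A0 by blast
  next
    case (Suc l)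
    then obtain A \<psi> where A: "int_subgroup A" "M \<subseteq> A" "e i \<in> A" "\<forall>j<l. e j \<in> A" "additive_mod_int A \<psi>"
      "\<forall>a\<in>M. \<psi> a \<in> \<int>" "\<psi> (e i) - w \<in> \<int>" by blast
    obtain w' where "\<And>n. int_scale n (e l) \<in> A \<Longrightarrow> of_int n * w' - \<psi> (int_scale n (e l)) \<in> \<int>"
      using additive_mod_int_extension_value[OF A(1,5)] by blast
    from additive_mod_int_extend[OF A(1,5) this] obtain A' \<psi>' where A': "int_subgroup A'" "A \<subseteq> A'" "e l \<in> A'"
      "additive_mod_int A' \<psi>'" "\<forall>a\<in>A. \<psi>' a - \<psi> a \<in> \<int>" by blast
    have eq: "\<psi>' a \<in> \<int> \<longleftrightarrow> \<psi> a \<in> \<int>" if "a \<in> A" for a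
    proof -
      have i: "\<psi>' a - \<psi> a \<in> \<int>" using A'(5) that by blast
      show ?thesis using Ints_add[OF i, of "\<psi> a"] Ints_diff[OF _ i, of "\<psi>' a"] by auto
    qed
    have "\<psi>' (e i) - w \<in> \<int>"
    proof -
      have "\<psi>' (e i) - \<psi> (e i) \<in> \<int>" using A'(5) A(3) by blast
      from Ints_add[OF this A(7)] show ?thesis by simp
    qed
    then show ?case using A A' eq by (intro exI[of _ A'] exI[of _ \<psi>']) (auto simp: less_Suc_eq)
  qed
  from this[of k] obtain A \<psi> where A: "int_subgroup A" "M \<subseteq> A" "e i \<in> A" "\<forall>j<k. e j \<in> A" "additive_mod_int A \<psi>"
      "\<forall>a\<in>M. \<psi> a \<in> \<int>" "\<psi> (e i) - w \<in> \<int>" by blast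
  \<comment> \<open>Modulo the integers, \<open>\<psi>\<close> is the pairing with the real vector
    of its values on the unit vectors. The partial sums have to stay in \<open>A\<close>, where
    additivity is available.\<close>
  have sums: "(\<Sum>j<l. int_scale (\<mu> j) (e j)) \<in> A \<and>
      \<psi> (\<Sum>j<l. int_scale (\<mu> j) (e j)) - (\<Sum>j<l. of_int (\<mu> j) * \<psi> (e j)) \<in> \<int>" if "l \<le> k" for l \<mu>
    using that
  proof (induction l)
    case 0
    show ?case using int_subgroupD(1)[OF A(1)] additive_mod_int_zero[OF A(1,5)] by (simp add: zero_fun_def)
  next
    case (Suc l)
    define S where "S = (\<Sum>j<l. int_scale (\<mu> j) (e j))"
    have S: "S \<in> A" "\<psi> S - (\<Sum>j<l. of_int (\<mu> j) * \<psi> (e j)) \<in> \<int>" using Suc by (auto simp: S_def)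
    have el: "e l \<in> A" using A(4) Suc.prems by auto
    define t where "t = int_scale (\<mu> l) (e l)"
    have t: "t \<in> A" "\<psi> t - of_int (\<mu> l) * \<psi> (e l) \<in> \<int>"
      using int_subgroup_scale[OF A(1) el] additive_mod_int_scale[OF A(1,5) el] by (auto simp: t_def)
    have "\<psi> (S + t) - \<psi> S - \<psi> t \<in> \<int>" using A(5) S t by (auto simp: additive_mod_int_def)
    then have "(\<psi> (S + t) - \<psi> S - \<psi> t) + (\<psi> S - (\<Sum>j<l. of_int (\<mu> j) * \<psi> (e j))) + (\<psi> t - of_int (\<mu> l) * \<psi> (e l)) \<in> \<int>"
      using S t by (intro Ints_add)
    moreover have "S + t \<in> A" using S t int_subgroupD(4)[OF A(1)] by blast
    ultimately show ?case by (simp add: algebra_simps plus_fun_def flip: S_def t_def)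
  qed
  have "\<forall>\<mu>\<in>M. (\<Sum>j<k. of_int (\<mu> j) * \<psi> (e j)) \<in> \<int>"
  proof
    fix \<mu> assume \<mu>: "\<mu> \<in> M"
    have "(\<Sum>j<k. int_scale (\<mu> j) (e j)) = \<mu>"
    proof
      fix l
      have "(\<Sum>j<k. int_scale (\<mu> j) (e j)) l = (\<Sum>j<k. if j = l then \<mu> l else 0)"
        by (induction k) (auto simp: int_scale_def e_def)
      then show "(\<Sum>j<k. int_scale (\<mu> j) (e j)) l = \<mu> l" using supp[OF \<mu>, of l] by (auto simp: sum.delta)
    qed
    then have 1: "\<psi> \<mu> - (\<Sum>j<k. of_int (\<mu> j) * \<psi> (e j)) \<in> \<int>" using sums[of k \<mu>] by simp
    have 2: "\<psi> \<mu> \<in> \<int>" using A(6) \<mu> by blast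
    show "(\<Sum>j<k. of_int (\<mu> j) * \<psi> (e j)) \<in> \<int>" using Ints_diff[OF 2 1] by simp
  qed
  \<comment> \<open>This vector pairs integrally with \<open>M\<close>, so it is integral, although
    its entry at \<open>i\<close> is congruent to \<open>w\<close>.\<close>
  from ann[of "\<lambda>j. \<psi> (e j)", OF this] i have 1: "\<psi> (e i) \<in> \<int>" by simp
  have "w \<in> \<int>" using Ints_diff[OF 1 A(7)] by simp
  with \<open>w \<notin> \<int>\<close> show False by simp
qed

section \<open>Linear groups\<close>

locale carrier_space = vector_space s for s :: "'k::field \<Rightarrow> 'v::ab_group_add \<Rightarrow> 'v" +
  fixes V :: "'v set"
  assumes subspace_V: "subspace V"

lemma findim_space_imp_carrier_space: "findim_space s V \<Longrightarrow> carrier_space s V"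
  by (simp add: findim_space_def carrier_space_def carrier_space_axioms_def)

context carrier_space
begin

lemma lin_on_zero: "lin_on s V s' A \<Longrightarrow> A 0 = 0"
  using subspace_0[OF subspace_V] unfolding lin_on_def by (metis add_cancel_right_right)

lemma lin_on_sum:
  assumes A: "lin_on s V s' A" and f: "\<And>i. i \<in> I \<Longrightarrow> f i \<in> V"
  shows "A (\<Sum>i\<in>I. f i) = (\<Sum>i\<in>I. A (f i))"
  using f
proof (induction I rule: infinite_finite_induct)
  case (insert x F)
  then have "A (f x + sum f F) = A (f x) + A (sum f F)"
    using A subspace_sum[OF subspace_V, of F f] by (auto simp: lin_on_def)
  with insert show ?case by simp
qed (auto simp: lin_on_zero[OF A])

lemma lin_on_lincomb:
  assumes A: "lin_on s V s' A" and f: "\<And>i. i \<in> I \<Longrightarrow> f i \<in> V"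
  shows "A (\<Sum>i\<in>I. s (c i) (f i)) = (\<Sum>i\<in>I. s' (c i) (A (f i)))"
proof -
  have "A (\<Sum>i\<in>I. s (c i) (f i)) = (\<Sum>i\<in>I. A (s (c i) (f i)))"
    by (intro lin_on_sum[OF A] subspace_scale[OF subspace_V] f)
  also have "\<dots> = (\<Sum>i\<in>I. s' (c i) (A (f i)))"
    using A f by (intro sum.cong) (auto simp: lin_on_def)
  finally show ?thesis .
qed

lemma lin_on_eq_on_basis:
  assumes A: "lin_on s V s' A" "lin_on s V s' A'" and B: "finite B" "span B = V"
    and eq: "\<And>b. b \<in> B \<Longrightarrow> A b = A' b" and x: "x \<in> V"
  shows "A x = A' x"
proof -
  from x B obtain c where "x = (\<Sum>b\<in>B. s (c b) b)" by (auto simp: span_finite)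
  moreover have "\<And>b. b \<in> B \<Longrightarrow> b \<in> V" using B span_base by blast
  ultimately show ?thesis using lin_on_lincomb[OF A(1), of B "\<lambda>b. b" c] lin_on_lincomb[OF A(2), of B "\<lambda>b. b" c] eq by simp
qed

lemma carrier_GL: "carrier (GL s V) = {A \<in> Bij V. lin_on s V s A}"
  by (simp add: GL_def)

lemma one_GL: "\<one>\<^bsub>GL s V\<^esub> = (\<lambda>x\<in>V. x)"
  by (simp add: GL_def BijGroup_def)

lemma mult_GL: "A \<in> carrier (GL s V) \<Longrightarrow> A' \<in> carrier (GL s V) \<Longrightarrow> A \<otimes>\<^bsub>GL s V\<^esub> A' = compose V A A'"
  by (simp add: GL_def BijGroup_def)

lemma GL_closed: "A \<in> carrier (GL s V) \<Longrightarrow> x \<in> V \<Longrightarrow> A x \<in> V"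
  using Bij_imp_funcset by (auto simp: carrier_GL)

lemma GL_add: "A \<in> carrier (GL s V) \<Longrightarrow> x \<in> V \<Longrightarrow> y \<in> V \<Longrightarrow> A (x + y) = A x + A y"
  and GL_scale: "A \<in> carrier (GL s V) \<Longrightarrow> x \<in> V \<Longrightarrow> A (s c x) = s c (A x)"
  by (auto simp: carrier_GL lin_on_def)

lemma GL_inj: "A \<in> carrier (GL s V) \<Longrightarrow> inj_on A V"
  by (auto simp: carrier_GL Bij_def bij_betw_def)

lemma GL_eqI:
  "A \<in> carrier (GL s V) \<Longrightarrow> A' \<in> carrier (GL s V) \<Longrightarrow> (\<And>x. x \<in> V \<Longrightarrow> A x = A' x) \<Longrightarrow> A = A'"
  by (auto simp: carrier_GL Bij_def intro: extensionalityI)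

lemma subgroup_GL: "subgroup {A \<in> Bij V. lin_on s V s A} (BijGroup V)"
proof (rule subgroup.intro)
  fix A assume "A \<in> {A \<in> Bij V. lin_on s V s A}"
  then have A: "A \<in> Bij V" "lin_on s V s A" by auto
  have bij: "bij_betw A V V" using A by (simp add: Bij_def)
  have l: "inv_into V A y \<in> V" "A (inv_into V A y) = y" if "y \<in> V" for y
    using that bij by (auto simp: bij_betw_def f_inv_into_f inv_into_into)
  have r: "inv_into V A (A x) = x" if "x \<in> V" for x using that bij by (simp add: bij_betw_def)
  have "inv_into V A (x + y) = inv_into V A x + inv_into V A y" if "x \<in> V" "y \<in> V" for x y
    using r[of "inv_into V A x + inv_into V A y"] A(2) l that subspace_add[OF subspace_V] by (simp add: lin_on_def)
  moreover have "inv_into V A (s c x) = s c (inv_into V A x)" if "x \<in> V" for c x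
    using r[of "s c (inv_into V A x)"] A(2) l that subspace_scale[OF subspace_V] by (simp add: lin_on_def)
  ultimately have "lin_on s V s (\<lambda>x\<in>V. inv_into V A x)"
    by (auto simp: lin_on_def subspace_add[OF subspace_V] subspace_scale[OF subspace_V])
  then show "inv\<^bsub>BijGroup V\<^esub> A \<in> {A \<in> Bij V. lin_on s V s A}"
    using A by (auto simp: inv_BijGroup restrict_inv_into_Bij)
next
  fix A A' assume "A \<in> {A \<in> Bij V. lin_on s V s A}" "A' \<in> {A \<in> Bij V. lin_on s V s A}"
  then show "A \<otimes>\<^bsub>BijGroup V\<^esub> A' \<in> {A \<in> Bij V. lin_on s V s A}"
    using Bij_imp_funcset[of A' V] compose_Bij[of A V A']
    by (auto simp: BijGroup_def lin_on_def compose_def subspace_add[OF subspace_V] subspace_scale[OF subspace_V] Pi_iff)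
qed (auto simp: BijGroup_def id_Bij lin_on_def subspace_add[OF subspace_V] subspace_scale[OF subspace_V])

lemma group_GL: "group (GL s V)"
  using group.subgroup_imp_group[OF group_BijGroup subgroup_GL] by (simp add: GL_def)

lemma GL_inv_apply:
  assumes "A \<in> carrier (GL s V)" "x \<in> V"
  shows "(inv\<^bsub>GL s V\<^esub> A) (A x) = x" "A ((inv\<^bsub>GL s V\<^esub> A) x) = x"
proof -
  interpret group "GL s V" by (rule group_GL)
  have "(inv\<^bsub>GL s V\<^esub> A \<otimes>\<^bsub>GL s V\<^esub> A) x = x" "(A \<otimes>\<^bsub>GL s V\<^esub> inv\<^bsub>GL s V\<^esub> A) x = x"
    using assms by (simp_all only: l_inv r_inv one_GL restrict_apply simp_thms if_True)
  then show "(inv\<^bsub>GL s V\<^esub> A) (A x) = x" "A ((inv\<^bsub>GL s V\<^esub> A) x) = x"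
    using assms by (simp_all add: mult_GL compose_eq)
qed

lemma GL_inv_equality:
  assumes "A \<in> carrier (GL s V)" "A' \<in> carrier (GL s V)" "\<And>x. x \<in> V \<Longrightarrow> A' (A x) = x"
  shows "inv\<^bsub>GL s V\<^esub> A = A'"
proof (rule group.inv_equality[OF group_GL])
  show "A' \<otimes>\<^bsub>GL s V\<^esub> A = \<one>\<^bsub>GL s V\<^esub>"
    using assms by (auto simp: mult_GL one_GL compose_def)
qed (use assms in auto)

lemma GL_memI:
  assumes "A \<in> extensional V" "lin_on s V s A" "\<And>x. x \<in> V \<Longrightarrow> A x \<in> V" "\<And>x. x \<in> V \<Longrightarrow> A' x \<in> V"
    "\<And>x. x \<in> V \<Longrightarrow> A (A' x) = x" "\<And>x. x \<in> V \<Longrightarrow> A' (A x) = x"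
  shows "A \<in> carrier (GL s V)"
  using assms by (auto simp: carrier_GL Bij_def intro!: bij_betw_byWitness[where f' = A'])

lemma GL_subset_End: "carrier (GL s V) \<subseteq> End_space s V"
  using Bij_imp_funcset by (fastforce simp: carrier_GL End_space_def PiE_def Bij_def)

end

section \<open>The topology on operators\<close>

lemma topspace_op_topology: "topspace (op_topology s V) = End_space s V"
  by (auto simp: op_topology_def topspace_pullback_topology)

lemma continuous_map_matrix_coefficient:
  assumes "\<phi> \<in> lin_functionals s V" "x \<in> V"
  shows "continuous_map (op_topology s V) euclidean (\<lambda>A. \<phi> (A x))"
proof -
  have "continuous_map (product_topology (\<lambda>_. euclidean) (lin_functionals s V \<times> V)) (euclidean :: complex topology) (\<lambda>g. g (\<phi>, x))"
    by (rule continuous_map_product_projection) (use assms in auto)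
  from continuous_map_pullback[OF this, of "End_space s V" "\<lambda>A. \<lambda>(\<phi>, x) \<in> lin_functionals s V \<times> V. \<phi> (A x)"]
  show ?thesis using assms by (simp add: op_topology_def o_def)
qed

text \<open>Universal property of the initial topology: only matrix coefficients have to be
  tested.\<close>

lemma continuous_map_into_op_topology:
  assumes "\<And>p. p \<in> topspace X \<Longrightarrow> f p \<in> End_space s V"
    and "\<And>\<phi> x. \<phi> \<in> lin_functionals s V \<Longrightarrow> x \<in> V \<Longrightarrow> continuous_map X euclidean (\<lambda>p. \<phi> (f p x))"
  shows "continuous_map X (op_topology s V) f"
  unfolding op_topology_def
  by (rule continuous_map_pullback') (use assms in \<open>auto simp: continuous_map_componentwise\<close>)

lemma limitin_pullback_topology:
  assumes "l \<in> A" "eventually (\<lambda>n. \<sigma> n \<in> A) net" "limitin T (\<lambda>n. f (\<sigma> n)) (f l) net"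
  shows "limitin (pullback_topology A f T) \<sigma> l net"
  unfolding limitin_def
proof (intro conjI allI impI)
  show "l \<in> topspace (pullback_topology A f T)"
    using assms limitin_topspace by (fastforce simp: topspace_pullback_topology)
  fix U assume "openin (pullback_topology A f T) U \<and> l \<in> U"
  then obtain W where "openin T W" "U = f -` W \<inter> A" "f l \<in> W" by (auto simp: openin_pullback_topology)
  moreover from this have "eventually (\<lambda>n. f (\<sigma> n) \<in> W) net" using assms limitinD by fastforce
  ultimately show "eventually (\<lambda>n. \<sigma> n \<in> U) net" using assms(2) by (auto elim: eventually_elim2)
qed

section \<open>Spaces of functions with finite support\<close>

lemma vector_space_pointwise_scale: "vector_space (pointwise_scale :: 'k::field \<Rightarrow> ('a \<Rightarrow> 'k) \<Rightarrow> 'a \<Rightarrow> 'k)"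
  by unfold_locales (auto simp: pointwise_scale_def fun_eq_iff algebra_simps)

interpretation fs: vector_space "pointwise_scale :: 'k::field \<Rightarrow> ('a \<Rightarrow> 'k) \<Rightarrow> 'a \<Rightarrow> 'k"
  by (rule vector_space_pointwise_scale)

lemma sum_fun_apply: "(\<Sum>i\<in>I. f i) x = (\<Sum>i\<in>I. f i x)"
  by (induction I rule: infinite_finite_induct) auto

text \<open>\<open>C_fun\<close> is tied to complex values; the same space over an arbitrary field
  also provides the real model \<open>supported {..<k}\<close> of the space t.\<close>

definition supported :: "'a set \<Rightarrow> ('a \<Rightarrow> 'k::field) set" where
  "supported K = {u. \<forall>y. y \<notin> K \<longrightarrow> u y = 0}"

definition unit_fun :: "'a \<Rightarrow> 'a \<Rightarrow> 'k::field" where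
  "unit_fun y = (\<lambda>x. if x = y then 1 else 0)"

lemma C_fun_eq_supported: "C_fun K = supported K"
  by (simp add: C_fun_def supported_def)

lemma inj_unit_fun: "inj unit_fun"
  by (auto simp: inj_def unit_fun_def fun_eq_iff split: if_splits)

lemma unit_fun_expansion:
  assumes "finite K" "u \<in> supported K"
  shows "u = (\<Sum>y\<in>K. pointwise_scale (u y) (unit_fun y))"
  using assms by (auto simp: fun_eq_iff sum_fun_apply pointwise_scale_def unit_fun_def supported_def if_distrib cong: if_cong)

lemma subspace_supported: "fs.subspace (supported K)"
  by (auto simp: fs.subspace_def supported_def pointwise_scale_def)

lemma unit_fun_in_supported: "y \<in> K \<Longrightarrow> unit_fun y \<in> supported K"
  by (auto simp: unit_fun_def supported_def)

lemma span_unit_fun: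
  assumes "finite K"
  shows "fs.span (unit_fun ` K) = supported K"
proof
  show "fs.span (unit_fun ` K) \<subseteq> supported K"
    by (rule fs.span_minimal) (auto simp: subspace_supported unit_fun_in_supported)
  show "supported K \<subseteq> fs.span (unit_fun ` K)"
  proof
    fix u assume "u \<in> supported K"
    then have "u = (\<Sum>y\<in>K. pointwise_scale (u y) (unit_fun y))" using assms by (intro unit_fun_expansion)
    also have "\<dots> \<in> fs.span (unit_fun ` K)"
      by (intro fs.span_sum fs.span_scale fs.span_base imageI)
    finally show "u \<in> fs.span (unit_fun ` K)" .
  qed
qed

lemma independent_unit_fun:
  assumes "finite K"
  shows "fs.independent (unit_fun ` K :: ('a \<Rightarrow> 'k::field) set)"
proof
  assume "fs.dependent (unit_fun ` K :: ('a \<Rightarrow> 'k) set)"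
  then obtain c :: "('a \<Rightarrow> 'k) \<Rightarrow> 'k" and y where c: "y \<in> K" "c (unit_fun y) \<noteq> 0" "(\<Sum>v\<in>unit_fun ` K. pointwise_scale (c v) v) = 0"
    using assms by (auto simp: fs.dependent_finite)
  have "(\<Sum>v\<in>unit_fun ` K. pointwise_scale (c v) v) y = (\<Sum>z\<in>K. c (unit_fun z) * unit_fun z y)"
    by (subst sum.reindex) (auto simp: sum_fun_apply pointwise_scale_def intro: inj_on_subset[OF inj_unit_fun])
  also have "\<dots> = c (unit_fun y)" using assms c(1) by (simp add: unit_fun_def if_distrib cong: if_cong)
  finally show False using c by simp
qed

lemma is_basis_unit_fun: "finite K \<Longrightarrow> is_basis pointwise_scale (supported K) (unit_fun ` K)"
  by (simp add: is_basis_def independent_unit_fun span_unit_fun)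

lemma representation_unit_fun:
  assumes "finite K" "u \<in> supported K" "y \<in> K"
  shows "fs.representation (unit_fun ` K) u (unit_fun y) = u y"
proof -
  have "u y = (\<Sum>b\<in>unit_fun ` K. pointwise_scale (fs.representation (unit_fun ` K) u b) b) y"
    using assms by (subst fs.sum_representation_eq) (auto simp: independent_unit_fun span_unit_fun)
  also have "\<dots> = (\<Sum>z\<in>K. fs.representation (unit_fun ` K) u (unit_fun z) * unit_fun z y)"
    by (subst sum.reindex) (auto simp: sum_fun_apply pointwise_scale_def intro: inj_on_subset[OF inj_unit_fun])
  also have "\<dots> = fs.representation (unit_fun ` K) u (unit_fun y)"
    using assms by (simp add: unit_fun_def if_distrib cong: if_cong)
  finally show ?thesis by simp
qed

lemma findim_space_supported: "finite K \<Longrightarrow> findim_space pointwise_scale (supported K)"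
  unfolding findim_space_def
  by (intro conjI vector_space_pointwise_scale subspace_supported exI[of _ "unit_fun ` K"]) (auto simp: span_unit_fun)

lemma carrier_space_supported: "carrier_space pointwise_scale (supported K)"
  by (intro carrier_space.intro carrier_space_axioms.intro vector_space_pointwise_scale subspace_supported)

lemma evaluation_in_lin_functionals: "(\<lambda>u\<in>C_fun K. u y) \<in> lin_functionals pointwise_scale (C_fun K)"
  by (auto simp: lin_functionals_def lin_on_def pointwise_scale_def C_fun_def)

lemma continuous_map_evaluation:
  assumes "u \<in> C_fun K"
  shows "continuous_map (op_topology pointwise_scale (C_fun K)) euclidean (\<lambda>A. A u y)"
proof -
  have "continuous_map (op_topology pointwise_scale (C_fun K)) euclidean (\<lambda>A. (\<lambda>u\<in>C_fun K. u y) (A u))"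
    by (rule continuous_map_matrix_coefficient[OF evaluation_in_lin_functionals assms])
  then show ?thesis
    by (rule continuous_map_eq) (use assms in \<open>auto simp: topspace_op_topology End_space_def\<close>)
qed

lemma lin_functional_expansion:
  assumes "finite K" "\<phi> \<in> lin_functionals pointwise_scale (C_fun K)" "u \<in> C_fun K"
  shows "\<phi> u = (\<Sum>y\<in>K. u y * \<phi> (unit_fun y))"
proof -
  interpret carrier_space pointwise_scale "C_fun K" unfolding C_fun_eq_supported by (rule carrier_space_supported)
  have "\<phi> u = \<phi> (\<Sum>y\<in>K. pointwise_scale (u y) (unit_fun y))"
    using unit_fun_expansion assms by (metis C_fun_eq_supported)
  also have "\<dots> = (\<Sum>y\<in>K. u y * \<phi> (unit_fun y))"
    using assms by (intro lin_on_lincomb) (auto simp: lin_functionals_def C_fun_eq_supported unit_fun_in_supported)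
  finally show ?thesis .
qed

text \<open>A functional on the functions on a finite set is a finite combination of evaluations, so
  the values \<open>f p u y\<close> control all matrix coefficients.\<close>

lemma continuous_map_into_op_C_fun:
  assumes "finite K" and End: "\<And>p. p \<in> topspace X \<Longrightarrow> f p \<in> End_space pointwise_scale (C_fun K)"
    and cont: "\<And>u y. u \<in> C_fun K \<Longrightarrow> y \<in> K \<Longrightarrow> continuous_map X euclidean (\<lambda>p. f p u y)"
  shows "continuous_map X (op_topology pointwise_scale (C_fun K)) f"
proof (rule continuous_map_into_op_topology[OF End])
  fix \<phi> and u :: "'a \<Rightarrow> complex" assume \<phi>: "\<phi> \<in> lin_functionals pointwise_scale (C_fun K)" and u: "u \<in> C_fun K"
  have "continuous_map X euclidean (\<lambda>p. \<Sum>y\<in>K. f p u y * \<phi> (unit_fun y))"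
    using cont[OF u] by (auto simp: continuous_map_atin intro!: tendsto_intros)
  then show "continuous_map X euclidean (\<lambda>p. \<phi> (f p u))"
    by (rule continuous_map_eq)
      (use End u in \<open>auto simp: End_space_def intro!: lin_functional_expansion[OF assms(1) \<phi>, symmetric]\<close>)
qed

text \<open>Values at points of \<open>K\<close> separate operators and depend continuously on them.
  The property makes the limit in \<open>op_exp\<close> unique, compact cosets closed, and
  continuous bijections from a compact space homeomorphisms.\<close>

lemma Hausdorff_op_C_fun: "Hausdorff_space (op_topology pointwise_scale (C_fun K))"
  unfolding Hausdorff_space_def topspace_op_topology
proof (intro allI impI)
  fix A A' assume *: "A \<in> End_space pointwise_scale (C_fun K) \<and> A' \<in> End_space pointwise_scale (C_fun K) \<and> A \<noteq> A'"
  then obtain u where u: "u \<in> C_fun K" "A u \<noteq> A' u"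
    unfolding End_space_def by (metis (no_types, lifting) PiE_ext mem_Collect_eq)
  then obtain y where y: "A u y \<noteq> A' u y" by blast
  then obtain U W where UW: "open U" "open W" "A u y \<in> U" "A' u y \<in> W" "U \<inter> W = {}" by (meson hausdorff)
  let ?X = "op_topology pointwise_scale (C_fun K)"
  have op: "openin ?X {B \<in> topspace ?X. B u y \<in> S}" if "open S" for S
    using continuous_map_evaluation[OF u(1), of y] that unfolding continuous_map_def by auto
  show "\<exists>U V. openin ?X U \<and> openin ?X V \<and> A \<in> U \<and> A' \<in> V \<and> disjnt U V"
    using op[OF UW(1)] op[OF UW(2)] UW *
    by (intro exI[of _ "{B \<in> topspace ?X. B u y \<in> U}"] exI[of _ "{B \<in> topspace ?X. B u y \<in> W}"])
      (auto simp: disjnt_def topspace_op_topology)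
qed

lemma limitin_op_C_fun:
  assumes "finite K" and A: "A \<in> End_space pointwise_scale (C_fun K)"
    and \<sigma>: "\<And>n. \<sigma> n \<in> End_space pointwise_scale (C_fun K)"
    and lim: "\<And>u y. u \<in> C_fun K \<Longrightarrow> y \<in> K \<Longrightarrow> ((\<lambda>n. \<sigma> n u y) \<longlongrightarrow> A u y) net"
  shows "limitin (op_topology pointwise_scale (C_fun K)) \<sigma> A net"
  unfolding op_topology_def
proof (rule limitin_pullback_topology[OF A])
  let ?I = "lin_functionals pointwise_scale (C_fun K) \<times> C_fun K"
  show "limitin (product_topology (\<lambda>_. euclidean) ?I) (\<lambda>n. \<lambda>(\<phi>, x)\<in>?I. \<phi> (\<sigma> n x)) (\<lambda>(\<phi>, x)\<in>?I. \<phi> (A x)) net"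
    unfolding limitin_componentwise
  proof (intro conjI ballI)
    fix i assume "i \<in> ?I"
    then obtain \<phi> u where i: "i = (\<phi>, u)" "\<phi> \<in> lin_functionals pointwise_scale (C_fun K)" "u \<in> C_fun K" by auto
    have "((\<lambda>n. \<Sum>y\<in>K. \<sigma> n u y * \<phi> (unit_fun y)) \<longlongrightarrow> (\<Sum>y\<in>K. A u y * \<phi> (unit_fun y))) net"
      by (intro tendsto_intros lim i)
    moreover have "A u \<in> C_fun K" "\<sigma> n u \<in> C_fun K" for n using A \<sigma> i(3) by (auto simp: End_space_def)
    ultimately have "((\<lambda>n. \<phi> (\<sigma> n u)) \<longlongrightarrow> \<phi> (A u)) net"
      using i by (simp add: lin_functional_expansion[OF assms(1)])
    then show "limitin euclidean (\<lambda>n. (\<lambda>(\<phi>, x)\<in>?I. \<phi> (\<sigma> n x)) i) ((\<lambda>(\<phi>, x)\<in>?I. \<phi> (A x)) i) net"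
      using i by simp
  qed auto
qed (use \<sigma> in auto)

section \<open>Multiplication operators\<close>

lemma mult_op_apply: "u \<in> C_fun K \<Longrightarrow> mult_op K d u = (\<lambda>y. d y * u y)"
  by (simp add: mult_op_def)

lemma mult_op_closed: "u \<in> C_fun K \<Longrightarrow> mult_op K d u \<in> C_fun K"
  by (simp add: mult_op_def C_fun_def)

lemma mult_op_in_End: "mult_op K d \<in> End_space pointwise_scale (C_fun K)"
  by (auto simp: End_space_def mult_op_def C_fun_def lin_on_def pointwise_scale_def fun_eq_iff algebra_simps)

lemma mult_op_cong: "(\<And>y. y \<in> K \<Longrightarrow> d y = d' y) \<Longrightarrow> mult_op K d = mult_op K d'"
  by (auto simp: mult_op_def fun_eq_iff restrict_def C_fun_def)

lemma mult_op_eq_iff: "mult_op K d = mult_op K d' \<longleftrightarrow> (\<forall>y\<in>K. d y = d' y)"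
proof
  assume eq: "mult_op K d = mult_op K d'"
  have "(\<lambda>y. if y \<in> K then 1 else 0) \<in> C_fun K" by (simp add: C_fun_def)
  from mult_op_apply[OF this, of d] mult_op_apply[OF this, of d']
  have "(\<lambda>y. d y * (if y \<in> K then 1 else 0)) = (\<lambda>y. d' y * (if y \<in> K then 1 else 0))"
    unfolding eq by simp
  from fun_cong[OF this] show "\<forall>y\<in>K. d y = d' y" by (metis mult.right_neutral)
qed (blast intro: mult_op_cong)

lemma compose_mult_op: "compose (C_fun K) (mult_op K d) (mult_op K d') = mult_op K (\<lambda>y. d y * d' y)"
proof
  fix u show "compose (C_fun K) (mult_op K d) (mult_op K d') u = mult_op K (\<lambda>y. d y * d' y) u"
  proof (cases "u \<in> C_fun K")
    case True
    then have "(\<lambda>y. d' y * u y) \<in> C_fun K" by (simp add: C_fun_def)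
    with True show ?thesis by (simp add: compose_def mult_op_apply mult.assoc)
  qed (simp add: compose_def mult_op_def)
qed

lemma mult_op_one: "mult_op K (\<lambda>y. 1) = (\<lambda>u\<in>C_fun K. u)"
  by (auto simp: mult_op_def)

lemma mult_op_in_GL:
  assumes "\<And>y. y \<in> K \<Longrightarrow> d y \<noteq> 0"
  shows "mult_op K d \<in> carrier (GL pointwise_scale (C_fun K))"
proof -
  interpret carrier_space pointwise_scale "C_fun K" unfolding C_fun_eq_supported by (rule carrier_space_supported)
  show ?thesis
  proof (rule GL_memI[where A' = "mult_op K (\<lambda>y. 1 / d y)"])
    fix u :: "'a \<Rightarrow> complex" assume u: "u \<in> C_fun K"
    then have "\<And>y. d y * (u y / d y) = u y" using assms unfolding C_fun_def by fastforce
    then show "mult_op K d (mult_op K (\<lambda>y. 1 / d y) u) = u" "mult_op K (\<lambda>y. 1 / d y) (mult_op K d u) = u"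
      using u by (auto simp: mult_op_def C_fun_def fun_eq_iff)
  qed (use mult_op_in_End[of K d] in \<open>auto simp: mult_op_closed End_space_def PiE_def\<close>)
qed

text \<open>The partial sums of the exponential series are multiplications by the partial sums of
  the scalar series, so convergence is pointwise on \<open>K\<close>; uniqueness of limits then
  resolves the \<open>THE\<close> in \<open>op_exp\<close>.\<close>

lemma op_exp_mult_op:
  assumes "finite K"
  shows "op_exp pointwise_scale (C_fun K) (mult_op K d) = mult_op K (\<lambda>y. exp (d y))"
proof -
  let ?S = "\<lambda>N. \<lambda>x\<in>C_fun K. \<Sum>n<N. pointwise_scale (1 / fact n) ((mult_op K d ^^ n) x)"
  have pw: "(mult_op K d ^^ n) u = (\<lambda>y. d y ^ n * u y)" if u: "u \<in> C_fun K" for n u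
  proof (induction n)
    case (Suc n)
    have "(\<lambda>y. d y ^ n * u y) \<in> C_fun K" using u by (auto simp: C_fun_def)
    with Suc show ?case by (simp add: mult_op_apply algebra_simps)
  qed simp
  have S: "?S N = mult_op K (\<lambda>y. \<Sum>n<N. d y ^ n /\<^sub>R fact n)" for N
  proof
    fix u show "?S N u = mult_op K (\<lambda>y. \<Sum>n<N. d y ^ n /\<^sub>R fact n) u"
      by (cases "u \<in> C_fun K", simp_all add: pw mult_op_apply) (auto simp: mult_op_def fun_eq_iff sum_fun_apply pointwise_scale_def sum_distrib_right scaleR_conv_of_real
          divide_inverse sum_distrib_left algebra_simps intro!: sum.cong)
  qed
  have lim: "limitin (op_topology pointwise_scale (C_fun K)) ?S (mult_op K (\<lambda>y. exp (d y))) sequentially"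
    unfolding S
  proof (rule limitin_op_C_fun[OF assms])
    fix u y assume u: "u \<in> C_fun K"
    have "(\<lambda>N. \<Sum>n<N. d y ^ n /\<^sub>R fact n) \<longlonglongrightarrow> exp (d y)"
      using exp_converges[of "d y"] by (simp add: sums_def)
    then show "(\<lambda>N. mult_op K (\<lambda>y. \<Sum>n<N. d y ^ n /\<^sub>R fact n) u y) \<longlonglongrightarrow> mult_op K (\<lambda>y. exp (d y)) u y"
      using u by (simp add: mult_op_apply tendsto_mult_right)
  qed (rule mult_op_in_End)+
  show ?thesis
    unfolding op_exp_def
  proof (rule the_equality)
    show "limitin (op_topology pointwise_scale (C_fun K)) ?S (mult_op K (\<lambda>y. exp (d y))) sequentially" by (rule lim)
    fix A assume "limitin (op_topology pointwise_scale (C_fun K)) ?S A sequentially"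
    then show "A = mult_op K (\<lambda>y. exp (d y))"
      using lim trivial_limit_sequentially Hausdorff_op_C_fun by (rule limitin_Hausdorff_unique)
  qed
qed

section \<open>Products of circles\<close>

lemma exp_2pi_eq_1_iff: "exp (2 * of_real pi * \<i> * of_real x) = 1 \<longleftrightarrow> x \<in> \<int>"
proof -
  have "exp (2 * of_real pi * \<i> * of_real x) = 1 \<longleftrightarrow> (\<exists>n::int. 2 * pi * x = of_int (2 * n) * pi)"
    by (simp add: exp_eq_1)
  also have "\<dots> \<longleftrightarrow> (\<exists>n::int. x = of_int n)" by (intro ex_cong1) (auto simp: field_simps)
  finally show ?thesis by (auto simp: Ints_def)
qed

lemma exp_2pi_eq_iff:
  "exp (2 * of_real pi * \<i> * of_real x) = exp (2 * of_real pi * \<i> * of_real y) \<longleftrightarrow> x - y \<in> \<int>"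
proof -
  have "exp (2 * of_real pi * \<i> * of_real x) = exp (2 * of_real pi * \<i> * of_real y) * exp (2 * of_real pi * \<i> * of_real (x - y))"
    by (simp add: algebra_simps flip: exp_add)
  then show ?thesis by (simp flip: exp_2pi_eq_1_iff)
qed

text \<open>The witness yields the value 1/2. This is the passage from congruence to
  equality.\<close>

lemma ex_multiple_not_int:
  fixes c :: real
  assumes "c \<noteq> 0"
  shows "\<exists>r. r * c \<notin> \<int>"
proof (intro exI notI)
  assume "1 / (2 * c) * c \<in> \<int>"
  then obtain n :: int where "real_of_int (2 * n) = of_int 1" using assms by (auto elim!: Ints_cases simp: field_simps)
  then show False unfolding of_int_eq_iff by presburger
qed

definition circles :: "nat \<Rightarrow> (nat \<Rightarrow> complex) topology" where
  "circles k = product_topology (\<lambda>_. top_of_set (sphere 0 1)) {..<k}"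

lemma topspace_circles: "topspace (circles k) = (\<Pi>\<^sub>E j\<in>{..<k}. sphere 0 1)"
  by (simp add: circles_def)

lemma circles_lift:
  assumes "z \<in> topspace (circles k)"
  obtains x where "z = (\<lambda>j\<in>{..<k}. exp (2 * of_real pi * \<i> * of_real (x j)))"
proof
  show "z = (\<lambda>j\<in>{..<k}. exp (2 * of_real pi * \<i> * of_real (Arg (z j) / (2 * pi))))"
  proof
    fix j show "z j = (\<lambda>j\<in>{..<k}. exp (2 * of_real pi * \<i> * of_real (Arg (z j) / (2 * pi)))) j"
    proof (cases "j < k")
      case True
      then have "cmod (z j) = 1" using assms by (auto simp: topspace_circles PiE_def Pi_def)
      then have "z j = exp (\<i> * of_real (Arg (z j)))" using Arg_eq[of "z j"] by fastforce
      then show ?thesis using True by simp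
    qed (use assms in \<open>auto simp: topspace_circles PiE_def extensional_def\<close>)
  qed
qed

lemma compact_circles: "compact_space (circles k)"
  by (simp add: circles_def compact_space_product_topology compact_space_subtopology)

lemma connected_circles: "connected_space (circles k)"
proof -
  have "connectedin euclidean (sphere (0::complex) 1)" by (simp add: connected_sphere)
  then show ?thesis by (simp add: circles_def connected_space_product_topology connectedin_def)
qed

section \<open>Construction M\<close>

locale M_construction =
  fixes s :: "real \<Rightarrow> 't::ab_group_add \<Rightarrow> 't" and t L K F
  assumes data: "M_data s t L K F"
begin

sublocale R: carrier_space s t
  using data by (auto simp: M_data_def findim_space_imp_carrier_space)

sublocale cf: carrier_space "pointwise_scale :: complex \<Rightarrow> (('t \<Rightarrow> real) \<Rightarrow> complex) \<Rightarrow> _" "C_fun K"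
  unfolding C_fun_eq_supported by (rule carrier_space_supported)

abbreviation "\<G> \<equiv> GL (pointwise_scale :: complex \<Rightarrow> (('t \<Rightarrow> real) \<Rightarrow> complex) \<Rightarrow> _) (C_fun K)"

sublocale G: group \<G> by (rule cf.group_GL)

sublocale Gt: group "GL s t" by (rule R.group_GL)

lemma finite_K: "finite K" and subgroup_F: "subgroup F (GL s t)" and finite_F: "finite F"
  and closure_K: "group_closure K = dual_lattice s t L"
  using data by (auto simp: M_data_def)

lemma F_in_GL: "f \<in> F \<Longrightarrow> f \<in> carrier (GL s t)"
  using subgroup.subset[OF subgroup_F] by (rule subsetD)

lemma K_lin: "y \<in> K \<Longrightarrow> lin_on s t (*) y" and K_off: "y \<in> K \<Longrightarrow> x \<notin> t \<Longrightarrow> y x = 0"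
  using data by (auto simp: M_data_def dual_lattice_def dual_space_def)

lemma t_closed: "0 \<in> t" "a \<in> t \<Longrightarrow> b \<in> t \<Longrightarrow> a + b \<in> t" "a \<in> t \<Longrightarrow> s r a \<in> t" "a \<in> t \<Longrightarrow> - a \<in> t"
    "a \<in> t \<Longrightarrow> b \<in> t \<Longrightarrow> a - b \<in> t"
  by (fact R.subspace_0[OF R.subspace_V] R.subspace_add[OF R.subspace_V] R.subspace_scale[OF R.subspace_V]
      R.subspace_neg[OF R.subspace_V] R.subspace_diff[OF R.subspace_V])+

lemma K_add: "y \<in> K \<Longrightarrow> a \<in> t \<Longrightarrow> b \<in> t \<Longrightarrow> y (a + b) = y a + y b"
  and K_scale: "y \<in> K \<Longrightarrow> a \<in> t \<Longrightarrow> y (s r a) = r * y a"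
  using K_lin by (auto simp: lin_on_def)

lemma K_zero: "y \<in> K \<Longrightarrow> y 0 = 0"
  by (rule R.lin_on_zero[OF K_lin])

lemma K_diff: "y \<in> K \<Longrightarrow> a \<in> t \<Longrightarrow> b \<in> t \<Longrightarrow> y (a - b) = y a - y b"
  using K_add[of y "a - b" b] t_closed by simp

lemma contragredient_closed: "f \<in> F \<Longrightarrow> y \<in> K \<Longrightarrow> contragredient s t f y \<in> K"
  using data unfolding M_data_def by (metis imageI)

lemma inv_F: "f \<in> F \<Longrightarrow> inv\<^bsub>GL s t\<^esub> f \<in> F"
  by (rule subgroup.m_inv_closed[OF subgroup_F])

lemma contragredient_mult:
  assumes "f \<in> carrier (GL s t)" "g \<in> carrier (GL s t)"
  shows "contragredient s t (f \<otimes>\<^bsub>GL s t\<^esub> g) y = contragredient s t f (contragredient s t g y)"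
proof
  fix x
  have "(inv\<^bsub>GL s t\<^esub> f) x \<in> t" if "x \<in> t" by (rule R.GL_closed[OF Gt.inv_closed[OF assms(1)] that])
  then show "contragredient s t (f \<otimes>\<^bsub>GL s t\<^esub> g) y x = contragredient s t f (contragredient s t g y) x"
    unfolding contragredient_def Gt.inv_mult_group[OF assms]
    by (simp add: R.mult_GL[OF Gt.inv_closed[OF assms(2)] Gt.inv_closed[OF assms(1)]] compose_eq)
qed

lemma contragredient_one: "y \<in> K \<Longrightarrow> contragredient s t \<one>\<^bsub>GL s t\<^esub> y = y"
  unfolding contragredient_def Gt.inv_one unfolding R.one_GL by (auto simp: K_off)

lemma M_action_apply: "u \<in> C_fun K \<Longrightarrow> y \<in> K \<Longrightarrow> M_action s t K f u y = u (contragredient s t (inv\<^bsub>GL s t\<^esub> f) y)"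
  by (simp add: M_action_def)

lemma M_action_closed: "u \<in> C_fun K \<Longrightarrow> M_action s t K f u \<in> C_fun K"
  by (simp add: M_action_def C_fun_def)

lemma C_fun_eqI: "u \<in> C_fun K \<Longrightarrow> w \<in> C_fun K \<Longrightarrow> (\<And>y. y \<in> K \<Longrightarrow> u y = w y) \<Longrightarrow> u = w"
proof (rule ext)
  fix y assume "u \<in> C_fun K" "w \<in> C_fun K" "\<And>y. y \<in> K \<Longrightarrow> u y = w y"
  then show "u y = w y" by (cases "y \<in> K") (simp_all add: C_fun_def)
qed

lemma M_action_mult_apply:
  assumes "f \<in> F" "g \<in> F" "u \<in> C_fun K"
  shows "M_action s t K f (M_action s t K g u) = M_action s t K (f \<otimes>\<^bsub>GL s t\<^esub> g) u"
proof (rule C_fun_eqI)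
  fix y assume "y \<in> K"
  then show "M_action s t K f (M_action s t K g u) y = M_action s t K (f \<otimes>\<^bsub>GL s t\<^esub> g) u y"
    using assms
    by (simp add: M_action_apply M_action_closed contragredient_closed inv_F Gt.inv_mult_group F_in_GL contragredient_mult)
qed (use assms in \<open>auto intro: M_action_closed\<close>)

lemma M_action_one_apply: "u \<in> C_fun K \<Longrightarrow> M_action s t K \<one>\<^bsub>GL s t\<^esub> u = u"
  by (rule C_fun_eqI) (auto simp: M_action_apply M_action_closed contragredient_one)

lemma M_action_in_GL:
  assumes "f \<in> F"
  shows "M_action s t K f \<in> carrier \<G>"
proof (rule cf.GL_memI[where A' = "M_action s t K (inv\<^bsub>GL s t\<^esub> f)"])
  show "lin_on pointwise_scale (C_fun K) pointwise_scale (M_action s t K f)"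
    by (auto simp: lin_on_def M_action_def C_fun_def pointwise_scale_def fun_eq_iff)
qed (use assms in \<open>auto simp: M_action_closed M_action_mult_apply inv_F M_action_one_apply F_in_GL\<close>, auto simp: M_action_def)

lemma M_action_mult:
  assumes "f \<in> F" "g \<in> F"
  shows "M_action s t K f \<otimes>\<^bsub>\<G>\<^esub> M_action s t K g = M_action s t K (f \<otimes>\<^bsub>GL s t\<^esub> g)"
proof (rule cf.GL_eqI)
  show "M_action s t K (f \<otimes>\<^bsub>GL s t\<^esub> g) \<in> carrier \<G>"
    using assms subgroup_F by (intro M_action_in_GL) (simp add: subgroup.m_closed)
  fix u assume "u \<in> C_fun K"
  then show "(M_action s t K f \<otimes>\<^bsub>\<G>\<^esub> M_action s t K g) u = M_action s t K (f \<otimes>\<^bsub>GL s t\<^esub> g) u"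
    using assms by (simp add: cf.mult_GL M_action_in_GL compose_eq M_action_mult_apply)
qed (use assms M_action_in_GL in auto)

lemma M_action_one: "M_action s t K \<one>\<^bsub>GL s t\<^esub> = \<one>\<^bsub>\<G>\<^esub>"
  by (intro cf.GL_eqI M_action_in_GL G.one_closed subgroup.one_closed[OF subgroup_F]) (simp add: M_action_one_apply cf.one_GL)

lemma subgroup_M_finite: "subgroup (M_finite s t K F) \<G>"
  unfolding M_finite_def
proof (rule G.subgroupI)
  show "M_action s t K ` F \<noteq> {}" using subgroup.one_closed[OF subgroup_F] by auto
  fix A assume "A \<in> M_action s t K ` F"
  then obtain f where f: "f \<in> F" "A = M_action s t K f" by auto
  have "inv\<^bsub>\<G>\<^esub> A = M_action s t K (inv\<^bsub>GL s t\<^esub> f)"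
    using f by (intro G.inv_equality) (auto simp: M_action_mult inv_F M_action_in_GL F_in_GL M_action_one)
  then show "inv\<^bsub>\<G>\<^esub> A \<in> M_action s t K ` F" using f inv_F by auto
next
  fix A A' assume "A \<in> M_action s t K ` F" "A' \<in> M_action s t K ` F"
  then show "A \<otimes>\<^bsub>\<G>\<^esub> A' \<in> M_action s t K ` F"
    using subgroup.m_closed[OF subgroup_F] by (auto simp: M_action_mult)
qed (use M_action_in_GL in auto)

text \<open>\<open>M_exp\<close> at a real point without the cut-off outside \<open>K\<close>; under
  \<open>mult_op\<close> the two agree, because members of \<open>C_fun K\<close> vanish
  there.\<close>

definition torus_char :: "'t \<Rightarrow> ('t \<Rightarrow> real) \<Rightarrow> complex" where
  "torus_char a y = exp (2 * of_real pi * \<i> * of_real (y a))"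

definition torus_op :: "'t \<Rightarrow> (('t \<Rightarrow> real) \<Rightarrow> complex) \<Rightarrow> ('t \<Rightarrow> real) \<Rightarrow> complex" where
  "torus_op a = mult_op K (torus_char a)"

lemma torus_op_M_exp: "mult_op K (M_exp K (a, 0)) = torus_op a"
  unfolding torus_op_def by (rule mult_op_cong) (simp add: M_exp_def torus_char_def K_zero)

lemma M_torus_eq: "M_torus t K = torus_op ` t"
  by (simp add: M_torus_def torus_op_M_exp)

lemma torus_op_in_GL: "torus_op a \<in> carrier \<G>"
  unfolding torus_op_def by (rule mult_op_in_GL) (simp add: torus_char_def)

lemma torus_op_mult: "a \<in> t \<Longrightarrow> b \<in> t \<Longrightarrow> torus_op a \<otimes>\<^bsub>\<G>\<^esub> torus_op b = torus_op (a + b)"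
  by (simp only: cf.mult_GL torus_op_in_GL) (auto simp: torus_op_def compose_mult_op torus_char_def K_add algebra_simps exp_add intro!: mult_op_cong)

lemma torus_op_zero: "torus_op 0 = \<one>\<^bsub>\<G>\<^esub>"
  unfolding cf.one_GL torus_op_def by (subst mult_op_one[symmetric], rule mult_op_cong) (simp add: torus_char_def K_zero)

lemma torus_op_inv: "a \<in> t \<Longrightarrow> inv\<^bsub>\<G>\<^esub> (torus_op a) = torus_op (- a)"
  by (rule G.inv_equality) (auto simp: torus_op_mult t_closed torus_op_zero torus_op_in_GL)

lemma subgroup_M_torus: "subgroup (M_torus t K) \<G>"
  unfolding M_torus_eq
  by (rule G.subgroupI) (use t_closed torus_op_in_GL torus_op_inv torus_op_mult in auto)

text \<open>The action of f replaces \<open>y\<close> by its contragredient image under the inverse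
  of f, whose value at \<open>a\<close> is \<open>y (f a)\<close>. So conjugation by f is the linear
  map f on parameters, and F normalises the torus.\<close>

lemma M_action_torus_op:
  assumes f: "f \<in> F" and a: "a \<in> t"
  shows "M_action s t K f \<otimes>\<^bsub>\<G>\<^esub> torus_op a = torus_op (f a) \<otimes>\<^bsub>\<G>\<^esub> M_action s t K f"
proof (rule cf.GL_eqI)
  fix u assume u: "u \<in> C_fun K"
  have "M_action s t K f (torus_op a u) = torus_op (f a) (M_action s t K f u)"
  proof (rule C_fun_eqI)
    fix y assume y: "y \<in> K"
    have "contragredient s t (inv\<^bsub>GL s t\<^esub> f) y a = y (f a)"
      using f a by (simp add: contragredient_def F_in_GL)
    then show "M_action s t K f (torus_op a u) y = torus_op (f a) (M_action s t K f u) y"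
      using u y
      by (simp add: torus_op_def M_action_apply[OF mult_op_closed] M_action_apply mult_op_apply[OF M_action_closed])
        (simp add: mult_op_apply torus_char_def)
  qed (use u in \<open>auto simp: torus_op_def mult_op_closed M_action_closed\<close>)
  then show "(M_action s t K f \<otimes>\<^bsub>\<G>\<^esub> torus_op a) u = (torus_op (f a) \<otimes>\<^bsub>\<G>\<^esub> M_action s t K f) u"
    using f u by (simp add: cf.mult_GL torus_op_in_GL M_action_in_GL compose_eq)
qed (use f in \<open>auto simp: torus_op_in_GL M_action_in_GL\<close>)

lemma F_closed: "f \<in> F \<Longrightarrow> a \<in> t \<Longrightarrow> f a \<in> t"
  by (rule R.GL_closed[OF F_in_GL])

lemma M_group_left: "M_group s t K F = {M_action s t K f \<otimes>\<^bsub>\<G>\<^esub> torus_op a | f a. f \<in> F \<and> a \<in> t}"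
  by (auto simp: M_group_def set_mult_def M_finite_def M_torus_eq)

lemma M_group_right: "M_group s t K F = {torus_op a \<otimes>\<^bsub>\<G>\<^esub> M_action s t K f | f a. f \<in> F \<and> a \<in> t}"
  unfolding M_group_left
proof safe
  fix f a assume "f \<in> F" "a \<in> t"
  then show "\<exists>f' a'. M_action s t K f \<otimes>\<^bsub>\<G>\<^esub> torus_op a = torus_op a' \<otimes>\<^bsub>\<G>\<^esub> M_action s t K f' \<and> f' \<in> F \<and> a' \<in> t"
    by (intro exI[of _ f] exI[of _ "f a"]) (simp add: M_action_torus_op F_closed)
next
  fix f a assume fa: "f \<in> F" "a \<in> t"
  \<comment> \<open>To move the torus factor to the right, its parameter is pulled back by the
    inverse of f.\<close>
  let ?b = "(inv\<^bsub>GL s t\<^esub> f) a"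
  have "?b \<in> t" by (rule F_closed[OF inv_F[OF fa(1)] fa(2)])
  moreover have "f ?b = a" by (rule R.GL_inv_apply(2)[OF F_in_GL[OF fa(1)] fa(2)])
  ultimately show "\<exists>f' a'. torus_op a \<otimes>\<^bsub>\<G>\<^esub> M_action s t K f = M_action s t K f' \<otimes>\<^bsub>\<G>\<^esub> torus_op a' \<and> f' \<in> F \<and> a' \<in> t"
    using M_action_torus_op[OF fa(1), of ?b] fa(1) by (intro exI[of _ f] exI[of _ ?b]) simp
qed

text \<open>The multiplication rule of a semidirect product. It makes G closed under products and
  lets cosets of the torus multiply.\<close>

lemma torus_action_mult:
  assumes "f \<in> F" "g \<in> F" "a \<in> t" "b \<in> t"
  shows "(torus_op a \<otimes>\<^bsub>\<G>\<^esub> M_action s t K f) \<otimes>\<^bsub>\<G>\<^esub> (torus_op b \<otimes>\<^bsub>\<G>\<^esub> M_action s t K g) =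
    torus_op (a + f b) \<otimes>\<^bsub>\<G>\<^esub> M_action s t K (f \<otimes>\<^bsub>GL s t\<^esub> g)"
proof -
  note c = torus_op_in_GL M_action_in_GL[OF assms(1)] M_action_in_GL[OF assms(2)] G.m_closed
  have "(torus_op a \<otimes>\<^bsub>\<G>\<^esub> M_action s t K f) \<otimes>\<^bsub>\<G>\<^esub> (torus_op b \<otimes>\<^bsub>\<G>\<^esub> M_action s t K g) =
    torus_op a \<otimes>\<^bsub>\<G>\<^esub> (M_action s t K f \<otimes>\<^bsub>\<G>\<^esub> torus_op b) \<otimes>\<^bsub>\<G>\<^esub> M_action s t K g"
    by (simp add: G.m_assoc c)
  also have "\<dots> = torus_op a \<otimes>\<^bsub>\<G>\<^esub> torus_op (f b) \<otimes>\<^bsub>\<G>\<^esub> (M_action s t K f \<otimes>\<^bsub>\<G>\<^esub> M_action s t K g)"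
    by (simp add: M_action_torus_op assms G.m_assoc c)
  finally show ?thesis using assms by (simp add: torus_op_mult M_action_mult F_closed)
qed

lemma subgroup_M_group: "subgroup (M_group s t K F) \<G>"
proof (rule G.subgroupI)
  show "M_group s t K F \<noteq> {}"
    unfolding M_group_right using t_closed(1) subgroup.one_closed[OF subgroup_F] by blast
  show "M_group s t K F \<subseteq> carrier \<G>"
    unfolding M_group_right using torus_op_in_GL M_action_in_GL by auto
  fix A assume "A \<in> M_group s t K F"
  then obtain f a where A: "f \<in> F" "a \<in> t" "A = torus_op a \<otimes>\<^bsub>\<G>\<^esub> M_action s t K f" by (auto simp: M_group_right)
  have "inv\<^bsub>\<G>\<^esub> (M_action s t K f) = M_action s t K (inv\<^bsub>GL s t\<^esub> f)"
    using A by (intro G.inv_equality) (auto simp: M_action_mult inv_F M_action_in_GL F_in_GL M_action_one)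
  then have "inv\<^bsub>\<G>\<^esub> A = M_action s t K (inv\<^bsub>GL s t\<^esub> f) \<otimes>\<^bsub>\<G>\<^esub> torus_op (- a)"
    using A by (simp add: G.inv_mult_group torus_op_in_GL M_action_in_GL torus_op_inv)
  then show "inv\<^bsub>\<G>\<^esub> A \<in> M_group s t K F"
    unfolding M_group_left using A inv_F t_closed by blast
next
  fix A A' assume "A \<in> M_group s t K F" "A' \<in> M_group s t K F"
  then obtain f a g b where A: "f \<in> F" "a \<in> t" "A = torus_op a \<otimes>\<^bsub>\<G>\<^esub> M_action s t K f"
    "g \<in> F" "b \<in> t" "A' = torus_op b \<otimes>\<^bsub>\<G>\<^esub> M_action s t K g" unfolding M_group_right by blast
  then show "A \<otimes>\<^bsub>\<G>\<^esub> A' \<in> M_group s t K F"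
    unfolding M_group_right using torus_action_mult[of f g a b] t_closed(2)[OF _ F_closed] subgroup.m_closed[OF subgroup_F]
    by (intro CollectI exI[of _ "f \<otimes>\<^bsub>GL s t\<^esub> g"] exI[of _ "a + f b"]) simp
qed

lemma torus_op_eq_iff: "torus_op a = torus_op b \<longleftrightarrow> (\<forall>y\<in>K. y a - y b \<in> \<int>)"
  by (simp add: torus_op_def mult_op_eq_iff torus_char_def exp_2pi_eq_iff)

text \<open>Every \<open>M_action\<close> fixes the constant function \<open>1\<close>, and a torus element is determined by its
  value there.\<close>

lemma torus_op_M_action_inj:
  assumes f: "f \<in> F" and g: "g \<in> F" and a: "a \<in> t"
    and eq: "M_action s t K f = torus_op a \<otimes>\<^bsub>\<G>\<^esub> M_action s t K g"
  shows "M_action s t K f = M_action s t K g" "torus_op a = \<one>\<^bsub>\<G>\<^esub>"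
proof -
  define one :: "('t \<Rightarrow> real) \<Rightarrow> complex" where "one = (\<lambda>y. if y \<in> K then 1 else 0)"
  have one: "one \<in> C_fun K" by (simp add: one_def C_fun_def)
  have fix_one: "M_action s t K h one = one" if "h \<in> F" for h
    using that one contragredient_closed[OF inv_F] by (intro C_fun_eqI) (auto simp: M_action_apply M_action_closed, simp_all add: one_def)
  have "M_action s t K f one = torus_op a (M_action s t K g one)"
    using one g by (simp add: eq cf.mult_GL torus_op_in_GL M_action_in_GL compose_eq)
  then have e: "one = torus_op a one" using f g by (simp add: fix_one)
  have "torus_char a y = torus_char 0 y" if "y \<in> K" for y
    using fun_cong[OF e, of y] that one by (simp add: torus_op_def mult_op_apply K_zero) (simp add: one_def torus_char_def K_zero)
  then show "torus_op a = \<one>\<^bsub>\<G>\<^esub>" unfolding torus_op_zero[symmetric] torus_op_def by (rule mult_op_cong)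
  then show "M_action s t K f = M_action s t K g" using eq g by (simp add: M_action_in_GL)
qed

lemma r_coset_torus: "M_torus t K #>\<^bsub>\<G>\<^esub> A = {torus_op a \<otimes>\<^bsub>\<G>\<^esub> A | a. a \<in> t}"
  by (auto simp: r_coset_def M_torus_eq)

text \<open>Multiplying cosets uses the semidirect rule, injectivity uses that the constant function
  1 detects the torus factor, and for surjectivity the torus factor of an element disappears in its
  coset.\<close>

lemma cond_a: "cond_a pointwise_scale (C_fun K) (M_group s t K F) (M_finite s t K F) (M_torus t K)"
  unfolding cond_a_def
proof (intro conjI)
  let ?T = "M_torus t K"
  let ?c = "\<lambda>f. ?T #>\<^bsub>\<G>\<^esub> f"
  show "M_group s t K F = M_finite s t K F <#>\<^bsub>\<G>\<^esub> ?T" by (simp add: M_group_def)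
  show "M_group s t K F = ?T <#>\<^bsub>\<G>\<^esub> M_finite s t K F"
    by (auto simp: M_group_right set_mult_def M_finite_def M_torus_eq)
  have rc: "?T #>\<^bsub>\<G>\<lparr>carrier := M_group s t K F\<rparr>\<^esub> A = ?c A" for A by (simp add: r_coset_def)
  have coset: "?c (torus_op a \<otimes>\<^bsub>\<G>\<^esub> A) = ?c A" if "a \<in> t" "A \<in> carrier \<G>" for a A
    using that subgroup_M_torus
    by (subst G.coset_mult_assoc[symmetric]) (auto simp: torus_op_in_GL subgroup.subset G.coset_join2 M_torus_eq)
  have sub: "M_finite s t K F \<subseteq> M_group s t K F"
  proof
    fix A assume "A \<in> M_finite s t K F"
    then obtain f where "f \<in> F" "A = M_action s t K f" by (auto simp: M_finite_def)
    then have "A = torus_op 0 \<otimes>\<^bsub>\<G>\<^esub> M_action s t K f" by (simp add: torus_op_zero M_action_in_GL)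
    then show "A \<in> M_group s t K F" unfolding M_group_right using \<open>f \<in> F\<close> t_closed(1) by blast
  qed
  show "?c \<in> iso (\<G>\<lparr>carrier := M_finite s t K F\<rparr>) (\<G>\<lparr>carrier := M_group s t K F\<rparr> Mod ?T)"
    unfolding iso_def
  proof (intro CollectI conjI homI)
    fix A assume "A \<in> carrier (\<G>\<lparr>carrier := M_finite s t K F\<rparr>)"
    then show "?c A \<in> carrier (\<G>\<lparr>carrier := M_group s t K F\<rparr> Mod ?T)"
      using sub by (auto simp: FactGroup_def RCOSETS_def rc)
  next
    fix A A' assume "A \<in> carrier (\<G>\<lparr>carrier := M_finite s t K F\<rparr>)" "A' \<in> carrier (\<G>\<lparr>carrier := M_finite s t K F\<rparr>)"
    then obtain f g where fg: "f \<in> F" "g \<in> F" "A = M_action s t K f" "A' = M_action s t K g" by (auto simp: M_finite_def)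
    have "?c (A \<otimes>\<^bsub>\<G>\<^esub> A') = ?c A <#>\<^bsub>\<G>\<^esub> ?c A'"
    proof (intro equalityI subsetI)
      fix x assume "x \<in> ?c (A \<otimes>\<^bsub>\<G>\<^esub> A')"
      then obtain a where a: "a \<in> t" "x = torus_op a \<otimes>\<^bsub>\<G>\<^esub> (A \<otimes>\<^bsub>\<G>\<^esub> A')" unfolding r_coset_torus by blast
      have "x = (torus_op a \<otimes>\<^bsub>\<G>\<^esub> A) \<otimes>\<^bsub>\<G>\<^esub> (torus_op 0 \<otimes>\<^bsub>\<G>\<^esub> A')"
        using a fg by (simp add: G.m_assoc torus_op_in_GL M_action_in_GL torus_op_zero)
      then show "x \<in> ?c A <#>\<^bsub>\<G>\<^esub> ?c A'" unfolding r_coset_torus set_mult_def using a t_closed(1) by blast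
    next
      fix x assume "x \<in> ?c A <#>\<^bsub>\<G>\<^esub> ?c A'"
      then obtain a b where ab: "a \<in> t" "b \<in> t" "x = (torus_op a \<otimes>\<^bsub>\<G>\<^esub> A) \<otimes>\<^bsub>\<G>\<^esub> (torus_op b \<otimes>\<^bsub>\<G>\<^esub> A')"
        unfolding r_coset_torus set_mult_def by blast
      then have "x = torus_op (a + f b) \<otimes>\<^bsub>\<G>\<^esub> (A \<otimes>\<^bsub>\<G>\<^esub> A')" using fg by (simp add: torus_action_mult M_action_mult)
      then show "x \<in> ?c (A \<otimes>\<^bsub>\<G>\<^esub> A')" unfolding r_coset_torus using t_closed(2)[OF ab(1) F_closed[OF fg(1) ab(2)]] by blast
    qed
    then show "?c (A \<otimes>\<^bsub>\<G>\<lparr>carrier := M_finite s t K F\<rparr>\<^esub> A') = ?c A \<otimes>\<^bsub>\<G>\<lparr>carrier := M_group s t K F\<rparr> Mod ?T\<^esub> ?c A'"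
      by (simp add: FactGroup_def set_mult_def)
  next
    show "bij_betw ?c (carrier (\<G>\<lparr>carrier := M_finite s t K F\<rparr>)) (carrier (\<G>\<lparr>carrier := M_group s t K F\<rparr> Mod ?T))"
      unfolding bij_betw_def
    proof
      show "inj_on ?c (carrier (\<G>\<lparr>carrier := M_finite s t K F\<rparr>))"
      proof (rule inj_onI)
        fix A A' assume "A \<in> carrier (\<G>\<lparr>carrier := M_finite s t K F\<rparr>)" "A' \<in> carrier (\<G>\<lparr>carrier := M_finite s t K F\<rparr>)"
        then obtain f g where fg: "f \<in> F" "g \<in> F" "A = M_action s t K f" "A' = M_action s t K g" by (auto simp: M_finite_def)
        assume eq: "?c A = ?c A'"
        have "A = torus_op 0 \<otimes>\<^bsub>\<G>\<^esub> A" using fg by (simp add: torus_op_zero M_action_in_GL)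
        then have "A \<in> ?c A" unfolding r_coset_torus using t_closed(1) by blast
        then have "A \<in> ?c A'" by (simp only: eq)
        then obtain a where "a \<in> t" "A = torus_op a \<otimes>\<^bsub>\<G>\<^esub> A'" unfolding r_coset_torus by blast
        then show "A = A'" using torus_op_M_action_inj fg by metis
      qed
      show "?c ` carrier (\<G>\<lparr>carrier := M_finite s t K F\<rparr>) = carrier (\<G>\<lparr>carrier := M_group s t K F\<rparr> Mod ?T)"
      proof (intro equalityI subsetI)
        fix X assume "X \<in> ?c ` carrier (\<G>\<lparr>carrier := M_finite s t K F\<rparr>)"
        then show "X \<in> carrier (\<G>\<lparr>carrier := M_group s t K F\<rparr> Mod ?T)"
          using sub by (auto simp: FactGroup_def RCOSETS_def rc)
      next
        fix X assume "X \<in> carrier (\<G>\<lparr>carrier := M_group s t K F\<rparr> Mod ?T)"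
        then obtain A where "A \<in> M_group s t K F" "X = ?c A" by (auto simp: FactGroup_def RCOSETS_def rc)
        then obtain f a where "f \<in> F" "a \<in> t" "X = ?c (torus_op a \<otimes>\<^bsub>\<G>\<^esub> M_action s t K f)" unfolding M_group_right by blast
        then have "X = ?c (M_action s t K f)" "f \<in> F" by (auto simp: coset M_action_in_GL)
        then show "X \<in> ?c ` carrier (\<G>\<lparr>carrier := M_finite s t K F\<rparr>)" by (auto simp: M_finite_def)
      qed
    qed
  qed
qed

end

section \<open>The torus as a product of circles and as the identity component\<close>

context M_construction
begin

text \<open>Integrality passes to differences, and \<open>K\<close> generates the dual lattice. This
  gives the injectivity of the parametrisation by circles.\<close>

lemma dual_lattice_integral:
  assumes x: "x \<in> t" and int: "\<And>y. y \<in> K \<Longrightarrow> y x \<in> \<int>" and z: "z \<in> dual_lattice s t L"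
  shows "z x \<in> \<int>"
proof -
  have "z \<in> group_closure K" using z closure_K by simp
  then show ?thesis by induction (auto simp: int)
qed

text \<open>\<open>b\<close> plays a basis of \<open>L\<close> and \<open>e\<close> its dual basis,
  with numerical indices so that they match the factors of a product of circles.\<close>

definition lattice_coordinates :: "nat \<Rightarrow> (nat \<Rightarrow> 't) \<Rightarrow> (nat \<Rightarrow> 't \<Rightarrow> real) \<Rightarrow> bool" where
  "lattice_coordinates k b e \<longleftrightarrow> (\<forall>j<k. b j \<in> t) \<and> (\<forall>x\<in>t. x = (\<Sum>j<k. s (e j x) (b j))) \<and>
    (\<forall>j<k. e j \<in> dual_lattice s t L) \<and> (\<forall>j<k. \<forall>c. e j (\<Sum>i<k. s (c i) (b i)) = c j) \<and>
    (\<forall>j<k. \<forall>y\<in>K. y (b j) \<in> \<int>)"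

lemma ex_lattice_coordinates: "\<exists>k b e. lattice_coordinates k b e"
proof -
  obtain B where B: "finite B" "is_basis s t B" "L = range (\<lambda>c::'t \<Rightarrow> int. \<Sum>b\<in>B. s (of_int (c b)) b)"
    using data by (auto simp: M_data_def is_lattice_def)
  have ind: "R.independent B" and span: "R.span B = t" using B by (auto simp: is_basis_def)
  obtain b where b: "bij_betw b {..<card B} B" using B(1) ex_bij_betw_nat_finite atLeast0LessThan by metis
  define k where "k = card B"
  \<comment> \<open>The value 0 outside \<open>t\<close> is what membership in
    \<open>dual_space\<close> demands.\<close>
  define e where "e j x = (if x \<in> t then R.representation B x (b j) else 0)" for j x
  have bB: "b j \<in> B" if "j < k" for j using b that by (auto simp: k_def bij_betw_def)
  have bt: "b j \<in> t" if "j < k" for j using bB[OF that] span R.span_base by blast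
  have reindex: "(\<Sum>x\<in>B. g x) = (\<Sum>j<k. g (b j))" for g :: "'t \<Rightarrow> 't"
    unfolding k_def using sum.reindex_bij_betw[OF b, of g] by simp
  have exp: "x = (\<Sum>j<k. s (e j x) (b j))" if "x \<in> t" for x
  proof -
    have "x = (\<Sum>v\<in>B. s (R.representation B x v) v)"
      using that by (intro R.sum_representation_eq[symmetric]) (auto simp: ind span B)
    then show ?thesis using that unfolding reindex by (simp add: e_def)
  qed
  have lin: "lin_on s t (*) (e j)" for j
    using R.representation_add[OF ind] R.representation_scale[OF ind]
    by (auto simp: lin_on_def e_def t_closed span)
  have inj: "inj_on b {..<k}" using b by (simp add: k_def bij_betw_def)
  have eb: "e j (b i) = (if i = j then 1 else 0)" if "j < k" "i < k" for i j
    using that inj bt by (auto simp: e_def R.representation_basis[OF ind bB] inj_on_def)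
  have ec: "e j (\<Sum>i<k. s (c i) (b i)) = c j" if "j < k" for j c
  proof -
    have "e j (\<Sum>i<k. s (c i) (b i)) = (\<Sum>i<k. c i * e j (b i))"
      by (rule R.lin_on_lincomb[OF lin]) (simp add: bt)
    also have "\<dots> = (\<Sum>i<k. if i = j then c i else 0)" using that by (intro sum.cong) (auto simp: eb)
    finally show ?thesis using that by simp
  qed
  have "e j x \<in> \<int>" if "j < k" "x \<in> L" for j x
    using that ec[of j] by (auto simp: B(3) reindex)
  then have dual: "e j \<in> dual_lattice s t L" if "j < k" for j
    using that lin by (auto simp: dual_lattice_def dual_space_def e_def)
  have "y (b j) \<in> \<int>" if "j < k" "y \<in> K" for j y
  proof -
    have "b j = (\<Sum>v\<in>B. s (of_int (if v = b j then 1 else 0)) v)"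
      using B(1) bB[OF that(1)] by (simp add: if_distrib[of "\<lambda>r. s r _"] if_distrib[of real_of_int] cong: if_cong)
    then have "b j \<in> L" unfolding B(3) by (rule range_eqI[where x = "\<lambda>v. if v = b j then 1 else 0"])
    then show ?thesis using that data by (auto simp: M_data_def dual_lattice_def)
  qed
  with bt exp dual ec show ?thesis
    by (intro exI[of _ k] exI[of _ b] exI[of _ e]) (simp add: lattice_coordinates_def)
qed

lemma K_lincomb: "y \<in> K \<Longrightarrow> (\<And>j. j < k \<Longrightarrow> b j \<in> t) \<Longrightarrow> y (\<Sum>j<k. s (c j) (b j)) = (\<Sum>j<k. c j * y (b j))"
  using R.lin_on_lincomb[OF K_lin, of y "{..<k}" b c] by simp

text \<open>\<open>y\<close> and \<open>y'\<close> differ at some point of \<open>t\<close>, and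
  rescaling that point makes the difference nonintegral, which the exponential detects.\<close>

lemma separate_points:
  assumes "y \<in> K" "y' \<in> K" "y \<noteq> y'"
  obtains a where "a \<in> t" "torus_char a y \<noteq> torus_char a y'"
proof -
  from \<open>y \<noteq> y'\<close> obtain x where "y x \<noteq> y' x" by blast
  then have x: "x \<in> t" using K_off assms by metis
  obtain r where "r * (y x - y' x) \<notin> \<int>" using \<open>y x \<noteq> y' x\<close> ex_multiple_not_int[of "y x - y' x"] by auto
  then have "y (s r x) - y' (s r x) \<notin> \<int>" using assms x by (simp add: K_scale algebra_simps)
  then show thesis using that[of "s r x"] x t_closed(3) by (simp add: torus_char_def exp_2pi_eq_iff)
qed

abbreviation "op_top \<equiv> op_topology (pointwise_scale :: complex \<Rightarrow> (('t \<Rightarrow> real) \<Rightarrow> complex) \<Rightarrow> _) (C_fun K)"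

text \<open>For a lattice basis \<open>b\<close> the numbers \<open>y (b j)\<close> are integers, so the floor does not round.\<close>

definition torus_param :: "nat \<Rightarrow> (nat \<Rightarrow> 't) \<Rightarrow> (nat \<Rightarrow> complex) \<Rightarrow> (('t \<Rightarrow> real) \<Rightarrow> complex) \<Rightarrow> ('t \<Rightarrow> real) \<Rightarrow> complex" where
  "torus_param k b z = mult_op K (\<lambda>y. \<Prod>j<k. z j powi \<lfloor>y (b j)\<rfloor>)"

text \<open>Because \<open>y (b j)\<close> is an integer, the factor with exponent
  \<open>x j * y (b j)\<close> is an integer power of the circle coordinate; so the character
  factors through the circles.\<close>

lemma torus_param_exp:
  assumes bt: "\<And>j. j < k \<Longrightarrow> b j \<in> t" and int: "\<And>j y. j < k \<Longrightarrow> y \<in> K \<Longrightarrow> y (b j) \<in> \<int>"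
  shows "torus_param k b (\<lambda>j\<in>{..<k}. exp (2 * of_real pi * \<i> * of_real (x j))) = torus_op (\<Sum>j<k. s (x j) (b j))"
  unfolding torus_param_def torus_op_def
proof (rule mult_op_cong)
  fix y assume y: "y \<in> K"
  have "(\<Prod>j<k. (\<lambda>j\<in>{..<k}. exp (2 * of_real pi * \<i> * of_real (x j))) j powi \<lfloor>y (b j)\<rfloor>)
    = (\<Prod>j<k. exp (2 * of_real pi * \<i> * of_real (x j * y (b j))))"
  proof (rule prod.cong[OF refl])
    fix j assume j: "j \<in> {..<k}"
    then obtain n where n: "y (b j) = of_int n" using int[of j y] y by (auto elim: Ints_cases)
    show "(\<lambda>j\<in>{..<k}. exp (2 * of_real pi * \<i> * of_real (x j))) j powi \<lfloor>y (b j)\<rfloor>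
        = exp (2 * of_real pi * \<i> * of_real (x j * y (b j)))"
      using j by (simp add: n exp_power_int algebra_simps)
  qed
  also have "\<dots> = exp (\<Sum>j<k. 2 * of_real pi * \<i> * of_real (x j * y (b j)))" by (simp add: exp_sum)
  also have "\<dots> = torus_char (\<Sum>j<k. s (x j) (b j)) y"
    using y by (simp add: torus_char_def K_lincomb bt sum_distrib_left)
  finally show "(\<Prod>j<k. (\<lambda>j\<in>{..<k}. exp (2 * of_real pi * \<i> * of_real (x j))) j powi \<lfloor>y (b j)\<rfloor>)
    = torus_char (\<Sum>j<k. s (x j) (b j)) y" .
qed

text \<open>Each value is a Laurent monomial in the circle coordinates times a constant, and circles
  avoid 0, where negative powers fail. The factor \<open>M_action s t K f\<close> is included so
  that one statement covers every coset of the torus.\<close>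

lemma continuous_map_action_torus_param:
  assumes f: "f \<in> F"
  shows "continuous_map (circles k) op_top (\<lambda>z. M_action s t K f \<otimes>\<^bsub>\<G>\<^esub> torus_param k b z)"
proof (rule continuous_map_into_op_C_fun[OF finite_K])
  have nz: "(\<Prod>j<k. z j powi m j) \<noteq> 0" if "z \<in> topspace (circles k)" for z m
    using that by (fastforce simp: topspace_circles PiE_def Pi_def)
  have GL: "torus_param k b z \<in> carrier \<G>" if "z \<in> topspace (circles k)" for z
    unfolding torus_param_def by (rule mult_op_in_GL) (rule nz[OF that])
  show "M_action s t K f \<otimes>\<^bsub>\<G>\<^esub> torus_param k b z \<in> End_space pointwise_scale (C_fun K)" if "z \<in> topspace (circles k)" for z
    using GL[OF that] M_action_in_GL[OF f] G.m_closed cf.GL_subset_End by blast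
  fix u y assume u: "u \<in> C_fun K" and y: "y \<in> K"
  define y' where "y' = contragredient s t (inv\<^bsub>GL s t\<^esub> f) y"
  have proj: "continuous_map (circles k) euclidean (\<lambda>z. z j)" if "j < k" for j
    using continuous_map_product_projection[of j "{..<k}" "\<lambda>_. top_of_set (sphere (0::complex) 1)"] that
    by (simp add: circles_def continuous_map_in_subtopology)
  have "continuous_map (circles k) euclidean (\<lambda>z. (\<Prod>j<k. z j powi \<lfloor>y' (b j)\<rfloor>) * u y')"
    unfolding continuous_map_atin
  proof (intro ballI)
    fix z assume z: "z \<in> topspace (circles k)"
    have "z j \<noteq> 0" if "j < k" for j using z that by (auto simp: topspace_circles PiE_def Pi_def)
    then show "limitin euclidean (\<lambda>z. (\<Prod>j<k. z j powi \<lfloor>y' (b j)\<rfloor>) * u y') ((\<Prod>j<k. z j powi \<lfloor>y' (b j)\<rfloor>) * u y') (atin (circles k) z)"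
      using proj z unfolding continuous_map_atin limitin_canonical_iff
      by (intro tendsto_intros tendsto_prod) auto
  qed
  then show "continuous_map (circles k) euclidean (\<lambda>z. (M_action s t K f \<otimes>\<^bsub>\<G>\<^esub> torus_param k b z) u y)"
  proof (rule continuous_map_eq)
    fix z assume "z \<in> topspace (circles k)"
    from GL[OF this] show "(\<Prod>j<k. z j powi \<lfloor>y' (b j)\<rfloor>) * u y' = (M_action s t K f \<otimes>\<^bsub>\<G>\<^esub> torus_param k b z) u y"
      using u y f by (simp add: cf.mult_GL M_action_in_GL compose_eq torus_param_def M_action_apply[OF mult_op_closed] flip: y'_def)
        (simp add: mult_op_apply)
  qed
qed

lemma one_in_F: "\<one>\<^bsub>GL s t\<^esub> \<in> F"
  by (rule subgroup.one_closed[OF subgroup_F])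

lemma torus_param_properties:
  obtains k b where
    "torus_param k b \<in> iso (product_group {..<k} (\<lambda>_. circle_group)) (\<G>\<lparr>carrier := M_torus t K\<rparr>)"
    "torus_param k b ` topspace (circles k) = M_torus t K" "inj_on (torus_param k b) (topspace (circles k))"
    "continuous_map (circles k) op_top (torus_param k b)"
proof -
  obtain k b e where "lattice_coordinates k b e" using ex_lattice_coordinates by blast
  then have bt: "\<And>j. j < k \<Longrightarrow> b j \<in> t" and exp: "\<And>x. x \<in> t \<Longrightarrow> x = (\<Sum>j<k. s (e j x) (b j))"
    and e: "\<And>j. j < k \<Longrightarrow> e j \<in> dual_lattice s t L" and ec: "\<And>j c. j < k \<Longrightarrow> e j (\<Sum>i<k. s (c i) (b i)) = c j"
    and int: "\<And>j y. j < k \<Longrightarrow> y \<in> K \<Longrightarrow> y (b j) \<in> \<int>"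
    by (auto simp: lattice_coordinates_def)
  define Z where "Z x = (\<lambda>j\<in>{..<k}. exp (2 * of_real pi * \<i> * complex_of_real (x j)))" for x
  define X where "X x = (\<Sum>j<k. s (x j) (b j))" for x
  have pZ: "torus_param k b (Z x) = torus_op (X x)" for x unfolding Z_def X_def by (rule torus_param_exp) (use bt int in auto)
  have Xt: "X x \<in> t" for x unfolding X_def by (rule R.subspace_sum[OF R.subspace_V]) (simp add: t_closed bt)
  have Ztop: "Z x \<in> topspace (circles k)" for x by (auto simp: Z_def topspace_circles norm_exp)
  have lift: "\<exists>x. z = Z x" if "z \<in> topspace (circles k)" for z using circles_lift[OF that] by (metis Z_def)
  have img: "torus_param k b ` topspace (circles k) = M_torus t K"
  proof (intro equalityI subsetI)
    fix A assume "A \<in> torus_param k b ` topspace (circles k)"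
    then show "A \<in> M_torus t K" using lift pZ Xt by (fastforce simp: M_torus_eq)
  next
    fix A assume "A \<in> M_torus t K"
    then obtain a where "a \<in> t" "A = torus_op a" by (auto simp: M_torus_eq)
    then have "A = torus_param k b (Z (\<lambda>j. e j a))" using exp[of a] pZ by (simp add: X_def)
    then show "A \<in> torus_param k b ` topspace (circles k)" using Ztop by blast
  qed
  \<comment> \<open>Equal operators have parameters whose difference is integral on
    \<open>K\<close>, hence under the whole dual lattice; the dual basis then reads off integral
    coordinate differences.\<close>
  have inj: "inj_on (torus_param k b) (topspace (circles k))"
  proof (rule inj_onI)
    fix z z' assume "z \<in> topspace (circles k)" "z' \<in> topspace (circles k)" and eq: "torus_param k b z = torus_param k b z'"
    then obtain x x' where x: "z = Z x" "z' = Z x'" using lift by metis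
    have "\<forall>y\<in>K. y (X x) - y (X x') \<in> \<int>" using eq unfolding x pZ torus_op_eq_iff .
    then have K: "y (X x - X x') \<in> \<int>" if "y \<in> K" for y using that by (simp add: K_diff Xt)
    have "x j - x' j \<in> \<int>" if "j < k" for j
    proof -
      have "e j (X x - X x') \<in> \<int>" by (rule dual_lattice_integral) (simp_all add: t_closed Xt K e that)
      moreover have "X x - X x' = X (\<lambda>j. x j - x' j)" by (simp add: X_def R.scale_left_diff_distrib sum_subtractf)
      ultimately show ?thesis using ec[OF that] by (simp add: X_def)
    qed
    then show "z = z'" unfolding x Z_def by (intro restrict_ext) (simp only: exp_2pi_eq_iff lessThan_iff)
  qed
  have hom: "torus_param k b (\<lambda>i\<in>{..<k}. z i * z' i) = torus_param k b z \<otimes>\<^bsub>\<G>\<^esub> torus_param k b z'"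
    if z: "z \<in> topspace (circles k)" "z' \<in> topspace (circles k)" for z z'
  proof -
    from z obtain x x' where x: "z = Z x" "z' = Z x'" using lift by metis
    have "(\<lambda>i\<in>{..<k}. z i * z' i) = Z (\<lambda>j. x j + x' j)"
      unfolding x Z_def by (rule restrict_ext) (simp add: exp_add algebra_simps)
    moreover have "X (\<lambda>j. x j + x' j) = X x + X x'" by (simp add: X_def R.scale_left_distrib sum.distrib)
    ultimately show ?thesis by (simp add: pZ x torus_op_mult Xt)
  qed
  have iso: "torus_param k b \<in> iso (product_group {..<k} (\<lambda>_. circle_group)) (\<G>\<lparr>carrier := M_torus t K\<rparr>)"
    unfolding iso_def
  proof (intro CollectI conjI homI)
    fix z z' assume "z \<in> carrier (product_group {..<k} (\<lambda>_. circle_group))" "z' \<in> carrier (product_group {..<k} (\<lambda>_. circle_group))"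
    then show "torus_param k b (z \<otimes>\<^bsub>product_group {..<k} (\<lambda>_. circle_group)\<^esub> z')
      = torus_param k b z \<otimes>\<^bsub>\<G>\<lparr>carrier := M_torus t K\<rparr>\<^esub> torus_param k b z'"
      using hom[of z z'] by (simp add: circle_group_def topspace_circles)
  qed (use img inj in \<open>auto simp: bij_betw_def circle_group_def topspace_circles\<close>)
  have "continuous_map (circles k) op_top (torus_param k b)"
  proof (rule continuous_map_eq[OF continuous_map_action_torus_param[OF one_in_F, of k b]])
    fix z assume "z \<in> topspace (circles k)"
    then have "torus_param k b z \<in> carrier \<G>" using lift pZ torus_op_in_GL by metis
    then show "M_action s t K \<one>\<^bsub>GL s t\<^esub> \<otimes>\<^bsub>\<G>\<^esub> torus_param k b z = torus_param k b z" by (simp add: M_action_one)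
  qed
  from iso img inj this show thesis by (rule that)
qed

text \<open>A continuous bijection from a compact space onto a Hausdorff space is a
  homeomorphism.\<close>

lemma is_torus_M_torus: "is_torus (\<G>\<lparr>carrier := M_torus t K\<rparr>) (subtopology op_top (M_torus t K))"
proof -
  obtain k b where *:
    "torus_param k b \<in> iso (product_group {..<k} (\<lambda>_. circle_group)) (\<G>\<lparr>carrier := M_torus t K\<rparr>)"
    "torus_param k b ` topspace (circles k) = M_torus t K" "inj_on (torus_param k b) (topspace (circles k))"
    "continuous_map (circles k) op_top (torus_param k b)"
    by (rule torus_param_properties)
  have sub: "M_torus t K \<subseteq> topspace op_top"
    using *(2,4) continuous_map_image_subset_topspace by metis
  have "homeomorphic_map (circles k) (subtopology op_top (M_torus t K)) (torus_param k b)"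
    using * sub
    by (intro continuous_imp_homeomorphic_map compact_circles Hausdorff_space_subtopology Hausdorff_op_C_fun)
      (auto simp: continuous_map_in_subtopology Int_absorb1)
  then show ?thesis using *(1) unfolding is_torus_def circles_def by blast
qed

definition torus_coset :: "('t \<Rightarrow> 't) \<Rightarrow> ((('t \<Rightarrow> real) \<Rightarrow> complex) \<Rightarrow> ('t \<Rightarrow> real) \<Rightarrow> complex) set" where
  "torus_coset f = {M_action s t K f \<otimes>\<^bsub>\<G>\<^esub> A | A. A \<in> M_torus t K}"

lemma compactin_torus_coset: "f \<in> F \<Longrightarrow> compactin op_top (torus_coset f)"
proof -
  assume f: "f \<in> F"
  obtain k b where *: "torus_param k b ` topspace (circles k) = M_torus t K"
    by (rule torus_param_properties)
  have "compactin op_top ((\<lambda>z. M_action s t K f \<otimes>\<^bsub>\<G>\<^esub> torus_param k b z) ` topspace (circles k))"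
    using compact_circles by (intro image_compactin[OF _ continuous_map_action_torus_param[OF f]]) (simp add: compact_space_def)
  also have "(\<lambda>z. M_action s t K f \<otimes>\<^bsub>\<G>\<^esub> torus_param k b z) ` topspace (circles k) = torus_coset f"
    unfolding torus_coset_def *[symmetric] by blast
  finally show ?thesis .
qed

lemma M_group_cosets: "M_group s t K F = \<Union> (torus_coset ` F)"
  by (auto simp: M_group_left torus_coset_def M_torus_eq)

lemma torus_coset_one: "torus_coset \<one>\<^bsub>GL s t\<^esub> = M_torus t K"
proof -
  have "\<one>\<^bsub>\<G>\<^esub> \<otimes>\<^bsub>\<G>\<^esub> A = A" if "A \<in> M_torus t K" for A
    using that subgroup.subset[OF subgroup_M_torus] by (intro G.l_one) blast
  then show ?thesis unfolding torus_coset_def M_action_one by force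
qed

lemma compactin_M_group: "compactin op_top (M_group s t K F)"
  unfolding M_group_cosets using finite_F compactin_torus_coset by (intro compactin_Union) auto

text \<open>Left cosets of a subgroup coincide or are disjoint. Distinct f may give the same coset,
  so the alternative is phrased through the coset itself; the cosets different from the torus make
  up its complement in G.\<close>

lemma torus_coset_cases:
  assumes f: "f \<in> F"
  shows "torus_coset f = M_torus t K \<or> torus_coset f \<inter> M_torus t K = {}"
proof (cases "M_action s t K f \<in> M_torus t K")
  case True
  have "torus_coset f = M_action s t K f <#\<^bsub>\<G>\<^esub> M_torus t K" by (auto simp: torus_coset_def l_coset_def)
  also have "\<dots> = M_torus t K" by (rule G.coset_join3[OF M_action_in_GL[OF f] subgroup_M_torus True])
  finally show ?thesis by simp
next
  case False
  have "M_action s t K f \<otimes>\<^bsub>\<G>\<^esub> A \<notin> M_torus t K" if A: "A \<in> M_torus t K" for A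
  proof
    assume "M_action s t K f \<otimes>\<^bsub>\<G>\<^esub> A \<in> M_torus t K"
    then have "M_action s t K f \<otimes>\<^bsub>\<G>\<^esub> A \<otimes>\<^bsub>\<G>\<^esub> inv\<^bsub>\<G>\<^esub> A \<in> M_torus t K"
      using A subgroup_M_torus by (simp add: subgroup.m_closed subgroup.m_inv_closed)
    moreover have "A \<in> carrier \<G>" using A subgroup.subset[OF subgroup_M_torus] by blast
    ultimately show False using False f by (simp add: G.m_assoc M_action_in_GL)
  qed
  then show ?thesis by (auto simp: torus_coset_def)
qed

lemma M_torus_identity_component:
  "M_torus t K = connected_component_of_set (subtopology op_top (M_group s t K F)) \<one>\<^bsub>\<G>\<^esub>"
proof (rule equalityI)
  let ?X = "subtopology op_top (M_group s t K F)"
  have TG: "M_torus t K \<subseteq> M_group s t K F" unfolding M_group_cosets torus_coset_one[symmetric] using one_in_F by blast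
  have one: "\<one>\<^bsub>\<G>\<^esub> \<in> M_torus t K" by (rule subgroup.one_closed[OF subgroup_M_torus])
  obtain k b where *: "torus_param k b ` topspace (circles k) = M_torus t K" "continuous_map (circles k) op_top (torus_param k b)"
    by (rule torus_param_properties)
  have "connectedin op_top (M_torus t K)"
    unfolding *(1)[symmetric] by (rule connectedin_continuous_map_image[OF *(2)]) (simp add: connectedin_topspace connected_circles)
  then show "M_torus t K \<subseteq> connected_component_of_set ?X \<one>\<^bsub>\<G>\<^esub>"
    using TG one by (intro connected_component_of_maximal) (auto simp: connectedin_subtopology)
  have closed: "closedin ?X (torus_coset f)" if "f \<in> F" for f
    using that by (intro closedin_subset_topspace compactin_imp_closedin compactin_torus_coset Hausdorff_op_C_fun) (auto simp: M_group_cosets)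
  have top: "topspace ?X = M_group s t K F" using compactin_M_group compactin_subset_topspace by fastforce
  have cl: "closedin ?X (M_torus t K)" using closed[OF one_in_F] by (simp add: torus_coset_one)
  have "M_group s t K F - M_torus t K = \<Union> (torus_coset ` {f \<in> F. torus_coset f \<noteq> M_torus t K})"
    unfolding M_group_cosets using torus_coset_cases by blast
  also have "closedin ?X \<dots>" using finite_F closed by (intro closedin_Union) auto
  finally have "openin ?X (M_torus t K)" using TG by (subst openin_closedin_eq) (simp only: top simp_thms)
  \<comment> \<open>A connected set does not cross a set that is open and closed; the identity,
    which lies in both sets, then excludes disjointness.\<close>
  then have "connected_component_of_set ?X \<one>\<^bsub>\<G>\<^esub> \<subseteq> M_torus t K \<or> disjnt (connected_component_of_set ?X \<one>\<^bsub>\<G>\<^esub>) (M_torus t K)"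
    by (intro connectedin_clopen_cases[OF connectedin_connected_component_of cl])
  moreover have "\<one>\<^bsub>\<G>\<^esub> \<in> connected_component_of_set ?X \<one>\<^bsub>\<G>\<^esub>"
    unfolding mem_Collect_eq connected_component_of_refl top by (rule subsetD[OF TG one])
  ultimately show "connected_component_of_set ?X \<one>\<^bsub>\<G>\<^esub> \<subseteq> M_torus t K" using one unfolding disjnt_iff by (elim disjE) simp_all
qed

lemma torus_setting:
  assumes "v \<in> C_fun K"
  shows "torus_setting pointwise_scale (C_fun K) (M_group s t K F) (M_finite s t K F) (M_torus t K) v"
  unfolding torus_setting_def
proof (intro conjI)
  show "findim_space pointwise_scale (C_fun K)" unfolding C_fun_eq_supported by (rule findim_space_supported[OF finite_K])
  show "M_finite s t K F \<subseteq> M_group s t K F"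
  proof
    fix A assume "A \<in> M_finite s t K F"
    then obtain f where f: "f \<in> F" "A = M_action s t K f" by (auto simp: M_finite_def)
    have "A = A \<otimes>\<^bsub>\<G>\<^esub> torus_op 0" using f by (simp add: torus_op_zero M_action_in_GL)
    then show "A \<in> M_group s t K F" unfolding M_group_left using f t_closed(1) by blast
  qed
  show "finite (M_finite s t K F)" using finite_F by (simp add: M_finite_def)
qed (fact assms subgroup_M_group compactin_M_group M_torus_identity_component is_torus_M_torus subgroup_M_finite)+

end

section \<open>Conditions (b) to (e) for Construction M\<close>

context M_construction
begin

lemma torus_op_apply: "u \<in> C_fun K \<Longrightarrow> torus_op a u = (\<lambda>y. torus_char a y * u y)"
  by (simp add: torus_op_def mult_op_apply)

text \<open>\<open>D a\<close>, multiplication by 2 pi i y(a), is the infinitesimal generator: its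
  real multiples exponentiate into the torus, so it lies in the Lie algebra, and its own exponential
  is \<open>torus_op a\<close>.\<close>

lemma torus_op_in_complexified_torus:
  assumes a: "a \<in> t"
  shows "torus_op a \<in> complexified_torus pointwise_scale (C_fun K) (M_torus t K)"
proof -
  define D where "D a = mult_op K (\<lambda>y. 2 * of_real pi * \<i> * of_real (y a))" for a
  have op_exp_D: "op_exp pointwise_scale (C_fun K) (D a) = torus_op a" for a
    unfolding D_def op_exp_mult_op[OF finite_K] torus_op_def torus_char_def ..
  have scale_D: "(\<lambda>u\<in>C_fun K. pointwise_scale (of_real r) (D a u)) = D (s r a)" if "a \<in> t" for r a
  proof -
    have "(\<lambda>u\<in>C_fun K. pointwise_scale (of_real r) (D a u)) = mult_op K (\<lambda>y. of_real r * (2 * of_real pi * \<i> * of_real (y a)))"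
      unfolding mult_op_def by (rule restrict_ext) (simp add: D_def mult_op_apply pointwise_scale_def mult.assoc)
    also have "\<dots> = D (s r a)" unfolding D_def by (rule mult_op_cong) (simp add: K_scale that)
    finally show ?thesis .
  qed
  have lie: "D a \<in> lie_algebra pointwise_scale (C_fun K) (M_torus t K)" if "a \<in> t" for a
    unfolding lie_algebra_def
    using that by (auto simp: scale_D op_exp_D M_torus_eq t_closed, simp add: D_def mult_op_in_End)
  \<comment> \<open>The imaginary part is taken to be \<open>D 0\<close>, the zero operator.\<close>
  have "(\<lambda>u\<in>C_fun K. D a u + pointwise_scale \<i> (D 0 u)) = D a"
  proof -
    have "(\<lambda>u\<in>C_fun K. D a u + pointwise_scale \<i> (D 0 u)) =
        mult_op K (\<lambda>y. 2 * of_real pi * \<i> * of_real (y a) + \<i> * (2 * of_real pi * \<i> * of_real (y 0)))"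
      unfolding mult_op_def by (rule restrict_ext) (simp add: D_def mult_op_apply pointwise_scale_def fun_eq_iff algebra_simps)
    also have "\<dots> = D a" unfolding D_def by (rule mult_op_cong) (simp add: K_zero)
    finally show ?thesis .
  qed
  then have "torus_op a = op_exp pointwise_scale (C_fun K) (\<lambda>u\<in>C_fun K. D a u + pointwise_scale \<i> (D 0 u))"
    by (simp add: op_exp_D)
  then show ?thesis unfolding complexified_torus_def using lie[OF a] lie[OF t_closed(1)] by blast
qed

text \<open>With the torus factor on the left, the factor from F meets \<open>v\<close> first and
  fixes it. So Gv is Tv, and T is contained in its complexification.\<close>

lemma cond_b:
  assumes v: "v \<in> invariant_functions s t K F"
  shows "cond_b pointwise_scale (C_fun K) (M_group s t K F) (M_torus t K) v"
  unfolding cond_b_def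
proof (rule image_subsetI)
  fix A assume "A \<in> M_group s t K F"
  then obtain f a where A: "f \<in> F" "a \<in> t" "A = torus_op a \<otimes>\<^bsub>\<G>\<^esub> M_action s t K f" unfolding M_group_right by blast
  have "v \<in> C_fun K" "M_action s t K f v = v" using v A by (auto simp: invariant_functions_def)
  then have "A v = torus_op a v" using A by (simp add: cf.mult_GL torus_op_in_GL M_action_in_GL compose_eq)
  then show "A v \<in> (\<lambda>g. g v) ` complexified_torus pointwise_scale (C_fun K) (M_torus t K)"
    using torus_op_in_complexified_torus[OF A(2)] by (metis imageI)
qed

lemma cond_d: "v \<in> invariant_functions s t K F \<Longrightarrow> cond_d (M_finite s t K F) v"
  by (auto simp: cond_d_def M_finite_def invariant_functions_def)

text \<open>The operator \<open>\<tau>\<^sub>a - \<tau>\<^sub>a(y\<^sub>1)\<close> kills the coordinate \<open>y\<^sub>1\<close>; if \<open>a\<close> separates \<open>y\<^sub>0\<close> from \<open>y\<^sub>1\<close>,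
  it keeps the coordinate \<open>y\<^sub>0\<close> nonzero.\<close>

lemma invariant_subspace_contains_unit_fun:
  assumes W: "invariant_subspace pointwise_scale (C_fun K) (M_torus t K) W"
    and w: "w \<in> W" "w y\<^sub>0 \<noteq> 0" and y0: "y\<^sub>0 \<in> K"
  shows "unit_fun y\<^sub>0 \<in> W"
proof -
  have sub: "fs.subspace W" and WC: "W \<subseteq> C_fun K" and inv: "\<And>a w. a \<in> t \<Longrightarrow> w \<in> W \<Longrightarrow> torus_op a w \<in> W"
    using W by (auto simp: invariant_subspace_def M_torus_eq)
  have kill: "\<exists>w'\<in>W. w' y\<^sub>0 \<noteq> 0 \<and> (\<forall>y\<in>J. w' y = 0)" if "finite J" "J \<subseteq> K - {y\<^sub>0}" for J
    using that
  proof (induction J)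
    case empty then show ?case using w by blast
  next
    case (insert y1 J)
    then obtain w' where w': "w' \<in> W" "w' y\<^sub>0 \<noteq> 0" "\<forall>y\<in>J. w' y = 0" by blast
    obtain a where a: "a \<in> t" "torus_char a y\<^sub>0 \<noteq> torus_char a y1"
      using separate_points[of y\<^sub>0 y1] insert.prems y0 by blast
    define w'' where "w'' = torus_op a w' - pointwise_scale (torus_char a y1) w'"
    have "w'' \<in> W" unfolding w''_def using inv[OF a(1) w'(1)] w'(1) sub
      by (intro fs.subspace_diff fs.subspace_scale)
    moreover have "w'' y = (torus_char a y - torus_char a y1) * w' y" for y
      using w'(1) WC by (auto simp: w''_def torus_op_apply pointwise_scale_def algebra_simps)
    ultimately show ?case using w' a by (intro bexI[of _ w'']) auto
  qed
  obtain w' where w': "w' \<in> W" "w' y\<^sub>0 \<noteq> 0" "\<forall>y\<in>K - {y\<^sub>0}. w' y = 0"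
    using kill[of "K - {y\<^sub>0}"] finite_K by blast
  have "pointwise_scale (1 / w' y\<^sub>0) w' = unit_fun y\<^sub>0"
  proof
    fix y show "pointwise_scale (1 / w' y\<^sub>0) w' y = unit_fun y\<^sub>0 y"
      using w' WC by (cases "y \<in> K") (auto simp: pointwise_scale_def unit_fun_def C_fun_def y0)
  qed
  then show ?thesis using fs.subspace_scale[OF sub w'(1)] by metis
qed

lemma unit_fun_in_C_fun: "y \<in> K \<Longrightarrow> unit_fun y \<in> C_fun K"
  by (simp add: C_fun_eq_supported unit_fun_in_supported)

lemma torus_op_unit_fun: "y \<in> K \<Longrightarrow> torus_op a (unit_fun y) = pointwise_scale (torus_char a y) (unit_fun y)"
  using unit_fun_in_C_fun[of y] by (auto simp: torus_op_apply pointwise_scale_def unit_fun_def)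

lemma invariant_unit_span:
  assumes y: "y \<in> K"
  shows "invariant_subspace pointwise_scale (C_fun K) (M_torus t K) (fs.span {unit_fun y})"
  unfolding invariant_subspace_def
proof (intro conjI ballI)
  show "fs.span {unit_fun y} \<subseteq> C_fun K"
    using y by (intro fs.span_minimal) (auto simp: unit_fun_in_C_fun C_fun_eq_supported subspace_supported unit_fun_in_supported)
  fix \<tau> assume "\<tau> \<in> M_torus t K"
  then obtain a where a: "\<tau> = torus_op a" by (auto simp: M_torus_eq)
  show "\<tau> ` fs.span {unit_fun y} \<subseteq> fs.span {unit_fun y}"
  proof (rule image_subsetI)
    fix u :: "('t \<Rightarrow> real) \<Rightarrow> complex" assume "u \<in> fs.span {unit_fun y}"
    then obtain c where c: "u = pointwise_scale c (unit_fun y)" by (auto simp: fs.span_singleton)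
    then have "\<tau> u = pointwise_scale c (pointwise_scale (torus_char a y) (unit_fun y))"
      using y by (simp add: a cf.GL_scale[OF torus_op_in_GL] unit_fun_in_C_fun torus_op_unit_fun)
    then show "\<tau> u \<in> fs.span {unit_fun y}"
      by (simp only:) (intro fs.span_scale fs.span_base, simp)
  qed
qed (rule fs.subspace_span)

lemma unit_fun_nonzero: "unit_fun y \<noteq> 0"
  by (metis unit_fun_def zero_fun_apply zero_neq_one)

text \<open>A nonzero member of \<open>W\<close> has a nonzero value at some \<open>y\<close>; the
  line of \<open>unit_fun y\<close> then lies in \<open>W\<close> and is itself invariant, so
  minimality leaves only this line.\<close>

lemma irreducible_is_unit_span:
  assumes W: "irreducible_subspace pointwise_scale (C_fun K) (M_torus t K) W"
  shows "\<exists>y\<in>K. W = fs.span {unit_fun y}"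
proof -
  have inv: "invariant_subspace pointwise_scale (C_fun K) (M_torus t K) W" and "W \<noteq> {0}"
    and min: "\<And>U. invariant_subspace pointwise_scale (C_fun K) (M_torus t K) U \<Longrightarrow> U \<subseteq> W \<Longrightarrow> U = {0} \<or> U = W"
    using W by (auto simp: irreducible_subspace_def)
  then have sub: "fs.subspace W" "W \<subseteq> C_fun K" by (auto simp: invariant_subspace_def)
  then obtain w where w: "w \<in> W" "w \<noteq> 0" using \<open>W \<noteq> {0}\<close> fs.subspace_0 by blast
  then obtain y where y: "w y \<noteq> 0" by (auto simp: fun_eq_iff)
  then have yK: "y \<in> K" using w sub by (auto simp: C_fun_def)
  have "unit_fun y \<in> W" by (rule invariant_subspace_contains_unit_fun[OF inv w(1) y yK])
  then have "fs.span {unit_fun y} \<subseteq> W" using sub by (intro fs.span_minimal) auto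
  moreover have "fs.span {unit_fun y :: ('t \<Rightarrow> real) \<Rightarrow> complex} \<noteq> {0}" using unit_fun_nonzero[of y] fs.span_base[of "unit_fun y" "{unit_fun y}"] by auto
  ultimately show ?thesis using min[OF invariant_unit_span[OF yK]] yK by blast
qed

text \<open>An equivariant isomorphism preserves the scalar by which a torus element acts on a line,
  and a torus element separating \<open>y\<close> from \<open>y'\<close> acts by different
  scalars.\<close>

lemma equivariant_unit_spans:
  assumes y: "y \<in> K" "y' \<in> K"
    and iso: "equivariantly_isomorphic pointwise_scale (M_torus t K) (fs.span {unit_fun y}) (fs.span {unit_fun y'})"
  shows "y = y'"
proof (rule ccontr)
  assume "y \<noteq> y'"
  then obtain a where a: "a \<in> t" "torus_char a y \<noteq> torus_char a y'" using separate_points y by blast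
  from iso obtain \<psi> where \<psi>: "bij_betw \<psi> (fs.span {unit_fun y}) (fs.span {unit_fun y'})"
    and lin: "lin_on pointwise_scale (fs.span {unit_fun y}) pointwise_scale \<psi>"
    and eq: "\<And>w. w \<in> fs.span {unit_fun y} \<Longrightarrow> \<psi> (torus_op a w) = torus_op a (\<psi> w)"
    using a(1) unfolding equivariantly_isomorphic_def M_torus_eq by blast
  have d: "unit_fun y \<in> fs.span {unit_fun y :: ('t \<Rightarrow> real) \<Rightarrow> complex}" by (rule fs.span_base) simp
  have "carrier_space pointwise_scale (fs.span {unit_fun y :: ('t \<Rightarrow> real) \<Rightarrow> complex})"
    by (intro carrier_space.intro carrier_space_axioms.intro vector_space_pointwise_scale fs.subspace_span)
  then have "\<psi> 0 = 0" using lin by (rule carrier_space.lin_on_zero)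
  then have nz: "\<psi> (unit_fun y) \<noteq> 0"
    using \<psi> d fs.span_zero unit_fun_nonzero unfolding bij_betw_def inj_on_def by metis
  have "\<psi> (unit_fun y) \<in> fs.span {unit_fun y'}" using \<psi> d by (auto simp: bij_betw_def)
  then obtain c where c: "\<psi> (unit_fun y) = pointwise_scale c (unit_fun y')" by (auto simp: fs.span_singleton)
  have "\<psi> (torus_op a (unit_fun y)) = pointwise_scale (torus_char a y) (\<psi> (unit_fun y))"
    using lin d y by (simp add: torus_op_unit_fun lin_on_def)
  moreover have "torus_op a (\<psi> (unit_fun y)) = pointwise_scale (torus_char a y') (\<psi> (unit_fun y))"
    using y by (simp add: c cf.GL_scale[OF torus_op_in_GL] unit_fun_in_C_fun torus_op_unit_fun mult.commute)
  ultimately have "pointwise_scale (torus_char a y) (\<psi> (unit_fun y)) = pointwise_scale (torus_char a y') (\<psi> (unit_fun y))"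
    using eq[OF d] by (simp only:)
  then show False using nz a(2) by (simp add: fs.scale_right_imp_eq)
qed

text \<open>Every irreducible subspace is the line of one unit function, and lines of different
  points are not isomorphic, so an isotypical component stays inside a single line.\<close>

lemma simple_spectrum: "simple_spectrum pointwise_scale (C_fun K) (M_torus t K)"
  unfolding simple_spectrum_def
proof (intro allI impI)
  fix W assume "irreducible_subspace pointwise_scale (C_fun K) (M_torus t K) W"
  then obtain y where y: "y \<in> K" "W = fs.span {unit_fun y}" using irreducible_is_unit_span by blast
  have "W' \<subseteq> fs.span {unit_fun y}"
    if "irreducible_subspace pointwise_scale (C_fun K) (M_torus t K) W'" "equivariantly_isomorphic pointwise_scale (M_torus t K) W W'" for W'
    using irreducible_is_unit_span[OF that(1)] equivariant_unit_spans that(2) y by blast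
  then have "isotypical_component pointwise_scale (C_fun K) (M_torus t K) W \<subseteq> fs.span {unit_fun y}"
    unfolding isotypical_component_def by (intro fs.span_minimal fs.subspace_span) blast
  then have "fs.dim (isotypical_component pointwise_scale (C_fun K) (M_torus t K) W) \<le> card {unit_fun y :: ('t \<Rightarrow> real) \<Rightarrow> complex}"
    by (intro fs.dim_le_card) auto
  then show "fs.dim (isotypical_component pointwise_scale (C_fun K) (M_torus t K) W) \<le> 1" by simp
qed

lemma cond_c:
  assumes v: "v \<in> nowhere_vanishing K"
  shows "cond_c pointwise_scale (C_fun K) (M_torus t K) v"
  unfolding cond_c_def
proof (intro conjI simple_spectrum exI[of _ "unit_fun ` K"] ballI)
  show "is_basis pointwise_scale (C_fun K) (unit_fun ` K)"
    unfolding C_fun_eq_supported by (rule is_basis_unit_fun[OF finite_K])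
  fix b :: "('t \<Rightarrow> real) \<Rightarrow> complex" assume "b \<in> unit_fun ` K"
  then obtain y where y: "y \<in> K" "b = unit_fun y" by auto
  then show "joint_eigenvector pointwise_scale (M_torus t K) b"
    unfolding joint_eigenvector_def using unit_fun_nonzero[of y] by (auto simp: M_torus_eq torus_op_unit_fun)
  show "fs.representation (unit_fun ` K) v b \<noteq> 0"
    using v y finite_K by (simp add: nowhere_vanishing_def C_fun_eq_supported representation_unit_fun)
qed

lemma cond_e:
  assumes v: "v \<in> nowhere_vanishing K"
  shows "cond_e pointwise_scale (C_fun K) (M_torus t K) v"
  unfolding cond_e_def
proof
  let ?W = "fs.span ((\<lambda>\<tau>. \<tau> v) ` M_torus t K)"
  have vC: "v \<in> C_fun K" using v by (simp add: nowhere_vanishing_def)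
  have subC: "fs.subspace (C_fun K)" by (simp add: C_fun_eq_supported subspace_supported)
  show WC: "?W \<subseteq> C_fun K"
    using vC by (intro fs.span_minimal subC) (auto simp: M_torus_eq torus_op_def mult_op_closed)
  \<comment> \<open>The induction also carries membership in \<open>C_fun K\<close>, because
    additivity of \<open>torus_op a\<close> is only available there.\<close>
  have inv: "u \<in> C_fun K \<and> torus_op a u \<in> ?W" if a: "a \<in> t" and u: "u \<in> ?W" for a u
    using u
  proof (induction rule: fs.span_induct_alt)
    case base
    have "torus_op a 0 = 0" using torus_op_in_GL[of a] by (intro cf.lin_on_zero[where s' = pointwise_scale]) (simp add: cf.carrier_GL)
    then show ?case using fs.span_zero fs.subspace_0[OF subC] by (simp add: zero_fun_def)
  next
    case (step c x u)
    then obtain a' where a': "a' \<in> t" "x = torus_op a' v" by (auto simp: M_torus_eq)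
    have x: "x \<in> C_fun K" using a' vC by (simp add: torus_op_def mult_op_closed)
    have "torus_op a x = torus_op (a + a') v"
      using fun_cong[OF torus_op_mult[OF a a'(1)], of v] a'(2) vC by (simp add: cf.mult_GL torus_op_in_GL compose_eq)
    then have "torus_op a x \<in> ?W"
      using a a' t_closed(2) by (auto intro!: fs.span_base simp: M_torus_eq)
    moreover have "torus_op a (pointwise_scale c x + u) = pointwise_scale c (torus_op a x) + torus_op a u"
      using x step by (simp add: cf.GL_add[OF torus_op_in_GL] cf.GL_scale[OF torus_op_in_GL] fs.subspace_scale[OF subC])
    ultimately have "pointwise_scale c x + u \<in> C_fun K \<and> torus_op a (pointwise_scale c x + u) \<in> ?W"
      using step x by (simp add: fs.span_add fs.span_scale fs.subspace_add[OF subC] fs.subspace_scale[OF subC])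
    then show ?case by (simp add: plus_fun_def)
  qed
  have "v = torus_op 0 v" using vC by (simp add: torus_op_zero cf.one_GL)
  then have vW: "v \<in> ?W" using t_closed(1) by (intro fs.span_base) (auto simp: M_torus_eq)
  have "invariant_subspace pointwise_scale (C_fun K) (M_torus t K) ?W"
    unfolding invariant_subspace_def using WC inv by (auto simp: M_torus_eq fs.subspace_span)
  then have "unit_fun y \<in> ?W" if "y \<in> K" for y
    using v that by (intro invariant_subspace_contains_unit_fun[OF _ vW]) (auto simp: nowhere_vanishing_def)
  then have "fs.span (unit_fun ` K) \<subseteq> ?W" by (intro fs.span_minimal fs.subspace_span) auto
  then show "C_fun K \<subseteq> ?W" by (simp add: C_fun_eq_supported span_unit_fun[OF finite_K])
qed

lemma conds_M_group:
  assumes "v \<in> nowhere_vanishing K \<inter> invariant_functions s t K F"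
  shows "conds_abcde pointwise_scale (C_fun K) (M_group s t K F) (M_finite s t K F) (M_torus t K) v"
  unfolding conds_abcde_def using assms by (simp add: cond_a cond_b cond_c cond_d cond_e)

end

section \<open>Realizing a diagonal torus\<close>

lemma group_closure_int_multiple:
  fixes g :: "'a \<Rightarrow> real"
  assumes g: "g \<in> group_closure S"
  shows "(\<lambda>x. of_int n * g x) \<in> group_closure S"
proof -
  have nat: "(\<lambda>x. of_nat i * g x) \<in> group_closure S" for i
  proof (induction i)
    case 0 then show ?case using zero_in_group_closure[of S] by (simp add: zero_fun_def)
  next
    case (Suc i)
    have "(\<lambda>x. of_nat (Suc i) * g x) = g + (\<lambda>x. of_nat i * g x)" by (auto simp: algebra_simps)
    then show ?case using group_closure_add[OF g Suc] by simp
  qed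
  show ?thesis
  proof (cases n rule: int_cases2)
    case (nonneg i) then show ?thesis using nat[of i] by simp
  next
    case (nonpos i)
    then have "(\<lambda>x. of_int n * g x) = - (\<lambda>x. of_nat i * g x)" by (auto simp: fun_eq_iff)
    then show ?thesis using nat[of i] by simp
  qed
qed

lemma group_closure_int_combination:
  fixes g :: "'i \<Rightarrow> 'a \<Rightarrow> real"
  assumes "\<And>i. i \<in> I \<Longrightarrow> g i \<in> group_closure S"
  shows "(\<lambda>x. \<Sum>i\<in>I. of_int (n i) * g i x) \<in> group_closure S"
  using assms
proof (induction I rule: infinite_finite_induct)
  case (insert i I)
  have "(\<lambda>x. \<Sum>i\<in>insert i I. of_int (n i) * g i x) = (\<lambda>x. of_int (n i) * g i x) + (\<lambda>x. \<Sum>i\<in>I. of_int (n i) * g i x)"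
    using insert by auto
  moreover have "\<dots> \<in> group_closure S"
    using insert by (intro group_closure_add group_closure_int_multiple) auto
  ultimately show ?case by simp
qed (use zero_in_group_closure[of S] in \<open>auto simp: zero_fun_def\<close>)

text \<open>What remains of the forward direction once the topology has been used up.
  \<open>B\<close> is the eigenbasis scaled so that \<open>v\<close> is its sum, \<open>H\<close>
  lifts the parametrisation of \<open>T\<close> by circles to real vectors, and \<open>m b\<close>
  lists the exponents of the character on \<open>b\<close>. The assumption \<open>kernel\<close>
  says that only integral parameters act trivially, which is faithfulness; \<open>m_inj\<close> says
  that the weights are distinct.\<close>

locale diagonal_torus = carrier_space s V for s :: "complex \<Rightarrow> 'v::ab_group_add \<Rightarrow> 'v" and V +
  fixes B :: "'v set" and k :: nat and m :: "'v \<Rightarrow> nat \<Rightarrow> int" and H :: "(nat \<Rightarrow> real) \<Rightarrow> 'v \<Rightarrow> 'v"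
    and G F T :: "('v \<Rightarrow> 'v) set"
  assumes finite_B: "finite B" and independent_B: "independent B" and span_B: "span B = V"
    and T_eq: "T = H ` supported {..<k}"
    and H_GL: "x \<in> supported {..<k} \<Longrightarrow> H x \<in> carrier (GL s V)"
    and H_eigen: "x \<in> supported {..<k} \<Longrightarrow> b \<in> B \<Longrightarrow>
      H x b = s (exp (2 * of_real pi * \<i> * of_real (\<Sum>j<k. of_int (m b j) * x j))) b"
    and kernel: "x \<in> supported {..<k} \<Longrightarrow> (\<And>b. b \<in> B \<Longrightarrow> (\<Sum>j<k. of_int (m b j) * x j) \<in> \<int>) \<Longrightarrow> j < k \<Longrightarrow> x j \<in> \<int>"
    and m_inj: "b \<in> B \<Longrightarrow> b' \<in> B \<Longrightarrow> (\<And>j. j < k \<Longrightarrow> m b j = m b' j) \<Longrightarrow> b = b'"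
    and subgroup_F: "subgroup F (GL s V)" and finite_F: "finite F"
    and F_normalizes: "f \<in> F \<Longrightarrow> \<tau> \<in> T \<Longrightarrow> \<exists>\<tau>'\<in>T. \<forall>x\<in>V. f (\<tau> x) = \<tau>' (f x)"
    and F_fixes: "f \<in> F \<Longrightarrow> f (\<Sum>b\<in>B. b) = (\<Sum>b\<in>B. b)"
    and G_eq: "G = F <#>\<^bsub>GL s V\<^esub> T"
begin

abbreviation t :: "(nat \<Rightarrow> real) set" where "t \<equiv> supported {..<k}"

text \<open>The cut-off outside \<open>t\<close> places \<open>weight b\<close> in
  \<open>dual_space\<close>.\<close>

definition weight :: "'v \<Rightarrow> (nat \<Rightarrow> real) \<Rightarrow> real" where
  "weight b x = (if x \<in> t then \<Sum>j<k. of_int (m b j) * x j else 0)"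

definition weights :: "((nat \<Rightarrow> real) \<Rightarrow> real) set" where
  "weights = weight ` B"

lemma in_weightsE: "y \<in> weights \<Longrightarrow> (\<And>b. b \<in> B \<Longrightarrow> y = weight b \<Longrightarrow> P) \<Longrightarrow> P"
  by (auto simp: weights_def)

sublocale ct: carrier_space "pointwise_scale :: real \<Rightarrow> (nat \<Rightarrow> real) \<Rightarrow> _" t
  by (rule carrier_space_supported)

lemmas t_closed = fs.subspace_add[OF subspace_supported] fs.subspace_scale[OF subspace_supported] fs.subspace_0[OF subspace_supported]

lemma weight_add: "x \<in> t \<Longrightarrow> y \<in> t \<Longrightarrow> weight b (x + y) = weight b x + weight b y"
  by (simp add: weight_def t_closed sum.distrib algebra_simps)

lemma weight_scale: "x \<in> t \<Longrightarrow> weight b (pointwise_scale r x) = r * weight b x"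
  by (simp add: weight_def t_closed, simp add: pointwise_scale_def sum_distrib_left algebra_simps)

lemma weight_lin: "lin_on pointwise_scale t (*) (weight b)"
  by (simp add: lin_on_def weight_add weight_scale)

lemma unit_in_t: "j < k \<Longrightarrow> unit_fun j \<in> t"
  by (simp add: unit_fun_in_supported)

lemma weight_unit: "j < k \<Longrightarrow> weight b (unit_fun j) = of_int (m b j)"
  by (simp add: weight_def unit_in_t, simp add: unit_fun_def if_distrib cong: if_cong)

lemma inj_weight: "inj_on weight B"
proof (rule inj_onI, rule m_inj)
  fix b b' j assume "weight b = weight b'" "j < k"
  then show "m b j = m b' j" using weight_unit[of j b] weight_unit[of j b'] by simp
qed

lemma B_in_V: "b \<in> B \<Longrightarrow> b \<in> V"
  using span_B span_base by blast

lemma B_nonzero: "b \<in> B \<Longrightarrow> b \<noteq> 0"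
  using independent_B dependent_zero by blast

definition coord :: "'v \<Rightarrow> 'v \<Rightarrow> complex" where
  "coord w b = representation B w b"

lemma coord_expansion: "w \<in> V \<Longrightarrow> w = (\<Sum>b\<in>B. s (coord w b) b)"
  unfolding coord_def by (rule sum_representation_eq[symmetric]) (simp_all add: independent_B span_B finite_B)

lemma coord_add: "w \<in> V \<Longrightarrow> w' \<in> V \<Longrightarrow> coord (w + w') b = coord w b + coord w' b"
  by (simp add: coord_def representation_add independent_B span_B)

lemma coord_scale: "w \<in> V \<Longrightarrow> coord (s c w) b = c * coord w b"
  by (simp add: coord_def representation_scale independent_B span_B)

lemma coord_basis: "b \<in> B \<Longrightarrow> coord b b' = (if b' = b then 1 else 0)"
  by (simp add: coord_def representation_basis independent_B)

lemma coord_lincomb: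
  assumes "finite I" "\<And>i. i \<in> I \<Longrightarrow> w i \<in> V"
  shows "coord (\<Sum>i\<in>I. s (c i) (w i)) b = (\<Sum>i\<in>I. c i * coord (w i) b)"
proof -
  have "lin_on s V (*) (\<lambda>w. coord w b)" by (simp add: lin_on_def coord_add coord_scale)
  from lin_on_lincomb[OF this] assms(2) show ?thesis by blast
qed

lemma coord_lincomb_basis: "b \<in> B \<Longrightarrow> coord (\<Sum>b\<in>B. s (c b) b) b = c b"
  by (simp add: coord_lincomb finite_B B_in_V coord_basis if_distrib cong: if_cong)

lemma coord_eqI:
  assumes "w \<in> V" "w' \<in> V" "\<And>b. b \<in> B \<Longrightarrow> coord w b = coord w' b"
  shows "w = w'"
  using coord_expansion[OF assms(1)] coord_expansion[OF assms(2)] assms(3) by (metis (no_types, lifting) sum.cong)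

abbreviation e2pi :: "real \<Rightarrow> complex" where "e2pi r \<equiv> exp (2 * of_real pi * \<i> * of_real r)"

lemma H_basis: "x \<in> t \<Longrightarrow> b \<in> B \<Longrightarrow> H x b = s (e2pi (weight b x)) b"
  by (simp add: H_eigen weight_def)

lemma coord_H:
  assumes "x \<in> t" "w \<in> V" "b \<in> B"
  shows "coord (H x w) b = e2pi (weight b x) * coord w b"
proof -
  have "H x w = H x (\<Sum>b\<in>B. s (coord w b) b)" using coord_expansion[OF assms(2)] by simp
  also have "\<dots> = (\<Sum>b\<in>B. s (coord w b) (H x b))"
    using H_GL[OF assms(1)] by (intro lin_on_lincomb) (auto simp: carrier_GL B_in_V)
  also have "\<dots> = (\<Sum>b\<in>B. s (coord w b * e2pi (weight b x)) b)" by (simp add: H_basis assms(1))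
  finally show ?thesis using assms(3) by (simp add: coord_lincomb_basis)
qed

lemma weight_separation:
  assumes "b \<in> B" "b' \<in> B" "b \<noteq> b'"
  shows "\<exists>x\<in>t. e2pi (weight b x) \<noteq> e2pi (weight b' x)"
proof -
  obtain x where ne: "weight b x \<noteq> weight b' x" using assms inj_onD[OF inj_weight, of b b'] by blast
  then have x: "x \<in> t" by (auto simp: weight_def split: if_splits)
  obtain r where "r * (weight b x - weight b' x) \<notin> \<int>" using ne ex_multiple_not_int[of "weight b x - weight b' x"] by auto
  then have "weight b (pointwise_scale r x) - weight b' (pointwise_scale r x) \<notin> \<int>"
    using x by (simp add: weight_scale algebra_simps)
  then show ?thesis using x t_closed by (intro bexI[of _ "pointwise_scale r x"]) (auto simp: exp_2pi_eq_iff)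
qed

lemma F_in_GL: "f \<in> F \<Longrightarrow> f \<in> carrier (GL s V)"
  using subgroup.subset[OF subgroup_F] by (rule subsetD)

lemma inv_F: "f \<in> F \<Longrightarrow> inv\<^bsub>GL s V\<^esub> f \<in> F"
  by (rule subgroup.m_inv_closed[OF subgroup_F])

text \<open>Normalisation is used for the inverse of f: it rewrites \<open>H x (f b)\<close> as f
  applied to \<open>H x' b\<close> for some parameter \<open>x'\<close>, and \<open>b\<close> is an
  eigenvector of \<open>H x'\<close>.\<close>

lemma F_basis_eigen:
  assumes f: "f \<in> F" and b: "b \<in> B" and x: "x \<in> t"
  shows "\<exists>c. H x (f b) = s c (f b)"
proof -
  let ?g = "inv\<^bsub>GL s V\<^esub> f"
  note fG = F_in_GL[OF f] and gG = F_in_GL[OF inv_F[OF f]] and HG = H_GL[OF x]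
  obtain \<tau>' where \<tau>': "\<tau>' \<in> T" "\<forall>y\<in>V. ?g (H x y) = \<tau>' (?g y)"
    using F_normalizes[OF inv_F[OF f]] x unfolding T_eq by blast
  obtain x' where x': "x' \<in> t" "\<tau>' = H x'" using \<tau>'(1) by (auto simp: T_eq)
  have fb: "f b \<in> V" by (rule GL_closed[OF fG B_in_V[OF b]])
  have "?g (H x (f b)) = s (e2pi (weight b x')) b"
    using \<tau>'(2) fb x' by (simp add: GL_inv_apply[OF fG B_in_V[OF b]] H_basis b)
  then have "f (?g (H x (f b))) = s (e2pi (weight b x')) (f b)"
    by (simp add: GL_scale[OF fG B_in_V[OF b]])
  then show ?thesis using GL_inv_apply(2)[OF fG GL_closed[OF HG fb]] by auto
qed

text \<open>If \<open>f b\<close> had nonzero coordinates at two basis vectors, a parameter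
  separating their weights would act on this single eigenvector with two eigenvalues.\<close>

lemma F_basis_multiple:
  assumes f: "f \<in> F" and b: "b \<in> B"
  shows "\<exists>b'\<in>B. \<exists>c. c \<noteq> 0 \<and> f b = s c b'"
proof -
  note fG = F_in_GL[OF f]
  have fb: "f b \<in> V" by (rule GL_closed[OF fG B_in_V[OF b]])
  have "f b \<noteq> 0"
  proof
    assume "f b = 0"
    moreover have "f 0 = 0" using fG by (intro lin_on_zero[of s]) (simp add: carrier_GL)
    ultimately have "b = 0" using inj_onD[OF GL_inj[OF fG], of b 0] B_in_V[OF b] subspace_0[OF subspace_V] by simp
    then show False using B_nonzero[OF b] by simp
  qed
  then obtain b' where b': "b' \<in> B" "coord (f b) b' \<noteq> 0"
    using coord_expansion[OF fb] by (metis (no_types, lifting) scale_zero_left sum.neutral)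
  have zero: "coord (f b) b'' = 0" if b'': "b'' \<in> B" "b'' \<noteq> b'" for b''
  proof (rule ccontr)
    assume nz: "coord (f b) b'' \<noteq> 0"
    obtain x where x: "x \<in> t" "e2pi (weight b' x) \<noteq> e2pi (weight b'' x)" using weight_separation[OF b'(1) b''(1)] b''(2) by blast
    obtain c where c: "H x (f b) = s c (f b)" using F_basis_eigen[OF f b x(1)] by blast
    have "e2pi (weight a x) * coord (f b) a = c * coord (f b) a" if "a \<in> B" for a
      using coord_H[OF x(1) fb that, unfolded c coord_scale[OF fb]] by (rule sym)
    then show False using b' b'' nz x(2) by (metis mult_right_cancel)
  qed
  have "f b = s (coord (f b) b') b'"
  proof (rule coord_eqI)
    fix a assume "a \<in> B"
    then show "coord (f b) a = coord (s (coord (f b) b') b') a"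
      using zero b' by (cases "a = b'") (auto simp: coord_scale B_in_V coord_basis)
  qed (use fb b' subspace_scale[OF subspace_V] B_in_V in auto)
  then show ?thesis using b' by blast
qed

text \<open>Since \<open>f\<close> fixes the sum of the basis vectors, the scalar in \<open>f b = c b'\<close> is \<open>1\<close>.\<close>

lemma F_permutes_basis:
  assumes f: "f \<in> F"
  shows "bij_betw f B B"
proof -
  note fG = F_in_GL[OF f]
  \<comment> \<open>Target and scalar are packed into one pair so that a single choice yields
    both.\<close>
  have "\<forall>b\<in>B. \<exists>p. fst p \<in> B \<and> snd p \<noteq> 0 \<and> f b = s (snd p) (fst p)"

  proof
    fix b assume "b \<in> B"
    then obtain b' c where "b' \<in> B" "c \<noteq> 0" "f b = s c b'" using F_basis_multiple[OF f] by blast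
    then show "\<exists>p. fst p \<in> B \<and> snd p \<noteq> 0 \<and> f b = s (snd p) (fst p)" by (intro exI[of _ "(b', c)"]) simp
  qed
  then obtain p where p: "\<forall>b\<in>B. fst (p b) \<in> B \<and> snd (p b) \<noteq> 0 \<and> f b = s (snd (p b)) (fst (p b))"
    using bchoice[of B "\<lambda>b p. fst p \<in> B \<and> snd p \<noteq> 0 \<and> f b = s (snd p) (fst p)"] by blast
  define \<sigma> where "\<sigma> b = fst (p b)" for b
  define c where "c b = snd (p b)" for b
  have \<sigma>: "\<sigma> b \<in> B" "c b \<noteq> 0" "f b = s (c b) (\<sigma> b)" if "b \<in> B" for b using p that by (auto simp: \<sigma>_def c_def)
  have inj: "inj_on \<sigma> B"
  proof (rule inj_onI, rule ccontr)
    fix b1 b2 assume b: "b1 \<in> B" "b2 \<in> B" "\<sigma> b1 = \<sigma> b2" "b1 \<noteq> b2"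
    \<comment> \<open>Scaling each vector by the scalar of the other one sends both to the same
      multiple of the common target.\<close>
    have "f (s (c b2) b1) = f (s (c b1) b2)"
      using b \<sigma> by (simp add: GL_scale[OF fG] B_in_V mult.commute)
    then have "s (c b2) b1 = s (c b1) b2"
      by (rule inj_onD[OF GL_inj[OF fG]]) (simp_all add: subspace_scale[OF subspace_V] B_in_V b)
    then have "coord (s (c b2) b1) b1 = coord (s (c b1) b2) b1" by simp
    then show False using b \<sigma>(2)[OF b(2)] by (simp add: coord_scale B_in_V coord_basis)
  qed
  then have bij: "bij_betw \<sigma> B B" using \<sigma>(1) finite_B by (simp add: bij_betw_def endo_inj_surj image_subsetI)
  have "c b = 1" if b: "b \<in> B" for b
  proof -
    have "(\<Sum>b\<in>B. s 1 b) = f (\<Sum>b\<in>B. s 1 b)" using F_fixes[OF f] by simp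
    also have "\<dots> = (\<Sum>b\<in>B. s 1 (f b))" using fG by (intro lin_on_lincomb) (auto simp: carrier_GL B_in_V)
    also have "\<dots> = (\<Sum>b\<in>B. s (c b) (\<sigma> b))" using \<sigma> by simp
    finally have "coord (\<Sum>b\<in>B. s 1 b) (\<sigma> b) = coord (\<Sum>b\<in>B. s (c b) (\<sigma> b)) (\<sigma> b)" by simp
    moreover have "coord (\<Sum>b\<in>B. s 1 b) (\<sigma> b) = 1" using \<sigma>(1)[OF b] by (rule coord_lincomb_basis)
    moreover have "coord (\<Sum>b\<in>B. s (c b) (\<sigma> b)) (\<sigma> b) = (\<Sum>a\<in>B. c a * (if a = b then 1 else 0))"
      using inj b by (subst coord_lincomb) (auto simp: finite_B B_in_V \<sigma>(1) coord_basis inj_on_def intro!: sum.cong)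
    ultimately show ?thesis using b finite_B by (simp add: if_distrib cong: if_cong)
  qed
  then have "f b = \<sigma> b" if "b \<in> B" for b using \<sigma>(3)[OF that] that by simp
  then show ?thesis using bij by (simp cong: bij_betw_cong)
qed

lemma F_basis: "f \<in> F \<Longrightarrow> b \<in> B \<Longrightarrow> f b \<in> B"
  using F_permutes_basis by (auto simp: bij_betw_def)

lemma coord_F:
  assumes f: "f \<in> F" and w: "w \<in> V" and b: "b \<in> B"
  shows "coord (f w) (f b) = coord w b"
proof -
  note fG = F_in_GL[OF f]
  have "f w = f (\<Sum>b\<in>B. s (coord w b) b)" using coord_expansion[OF w] by simp
  also have "\<dots> = (\<Sum>b\<in>B. s (coord w b) (f b))" using fG by (intro lin_on_lincomb) (auto simp: carrier_GL B_in_V)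
  finally have "coord (f w) (f b) = (\<Sum>a\<in>B. coord w a * coord (f a) (f b))"
    by (simp only:) (rule coord_lincomb, auto simp: finite_B B_in_V F_basis f)
  also have "\<dots> = (\<Sum>a\<in>B. coord w a * (if a = b then 1 else 0))"
    using F_permutes_basis[OF f] b by (intro sum.cong) (auto simp: coord_basis F_basis f bij_betw_def inj_on_def)
  also have "\<dots> = coord w b" using b finite_B by (simp add: if_distrib cong: if_cong)
  finally show ?thesis .
qed

section \<open>The lift of F to linear maps of the real space\<close>

lemma weight_conjugate:
  assumes f: "f \<in> F" and x: "x \<in> t"
  shows "\<exists>x'\<in>t. \<forall>b\<in>B. weight (f b) x' - weight b x \<in> \<int>"
proof -
  \<comment> \<open>Any parameter of the conjugated element will do; a torus element determines the
    values of the weights only modulo the integers.\<close>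
  obtain \<tau>' where \<tau>': "\<tau>' \<in> T" "\<forall>y\<in>V. f (H x y) = \<tau>' (f y)" using F_normalizes[OF f] x unfolding T_eq by blast
  obtain x' where x': "x' \<in> t" "\<tau>' = H x'" using \<tau>'(1) by (auto simp: T_eq)
  have "weight (f b) x' - weight b x \<in> \<int>" if b: "b \<in> B" for b
  proof -
    have "s (e2pi (weight b x)) (f b) = f (H x b)"
      by (simp add: H_basis x b GL_scale[OF F_in_GL[OF f] B_in_V[OF b]])
    also have "\<dots> = s (e2pi (weight (f b) x')) (f b)" using \<tau>'(2) b x' by (simp add: B_in_V H_basis F_basis f)
    finally have "e2pi (weight b x) = e2pi (weight (f b) x')"
      using B_nonzero[OF F_basis[OF f b]] by simp
    then show ?thesis using exp_2pi_eq_iff by metis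
  qed
  then show ?thesis using x' by blast
qed

text \<open>\<open>M\<close> is the group of integer vectors spanned by the exponent vectors. By
  \<open>kernel\<close>, a real vector pairing integrally with \<open>M\<close> is integral, which
  forces \<open>M\<close> to contain all unit vectors. The coefficients form an integral left
  inverse of the weight matrix.\<close>

lemma ex_dual_coefficients: "\<exists>n :: nat \<Rightarrow> 'v \<Rightarrow> int. \<forall>i<k. \<forall>j<k. (\<Sum>b\<in>B. n i b * m b j) = of_bool (j = i)"
proof -
  define M where "M = range (\<lambda>c::'v \<Rightarrow> int. \<lambda>j. if j < k then \<Sum>b\<in>B. c b * m b j else 0)"
  have M: "int_subgroup M" unfolding int_subgroup_def
  proof (intro conjI ballI)
    have "0 = (\<lambda>j. if j < k then \<Sum>b\<in>B. 0 * m b j else 0)" by (auto simp: fun_eq_iff)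
    then show "0 \<in> M" unfolding M_def by (rule range_eqI[where x = "\<lambda>b. 0"])
    fix a a' assume "a \<in> M" "a' \<in> M"
    then obtain c c' where "a = (\<lambda>j. if j < k then \<Sum>b\<in>B. c b * m b j else 0)" "a' = (\<lambda>j. if j < k then \<Sum>b\<in>B. c' b * m b j else 0)"
      by (auto simp: M_def)
    then have "a - a' = (\<lambda>j. if j < k then \<Sum>b\<in>B. (c b - c' b) * m b j else 0)"
      by (auto simp: fun_eq_iff sum_subtractf algebra_simps)
    then show "a - a' \<in> M" unfolding M_def by (rule range_eqI[where x = "\<lambda>b. c b - c' b"])
  qed
  have ann: "\<forall>j<k. x j \<in> \<int>" if x: "\<forall>\<mu>\<in>M. (\<Sum>j<k. of_int (\<mu> j) * x j) \<in> \<int>" for x :: "nat \<Rightarrow> real"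
  proof (intro allI impI)
    fix j assume j: "j < k"
    \<comment> \<open>\<open>kernel\<close> speaks of vectors in \<open>t\<close>, so
      \<open>x\<close> is truncated; the sums involve only entries below \<open>k\<close>.\<close>
    define x' where "x' j = (if j < k then x j else 0)" for j
    have x't: "x' \<in> t" by (simp add: x'_def supported_def)
    have "(\<Sum>j<k. of_int (m b j) * x' j) \<in> \<int>" if b: "b \<in> B" for b
    proof -
      have "(\<lambda>j. if j < k then m b j else 0) = (\<lambda>j. if j < k then \<Sum>a\<in>B. (if a = b then 1 else 0) * m a j else 0)"
        using b finite_B by (auto simp: fun_eq_iff if_distrib[of "\<lambda>x. x * _"] cong: if_cong)
      then have "(\<lambda>j. if j < k then m b j else 0) \<in> M" unfolding M_def by (rule range_eqI[where x = "\<lambda>a. if a = b then 1 else 0"])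
      then have "(\<Sum>j<k. of_int (if j < k then m b j else 0) * x j) \<in> \<int>" by (rule x[rule_format])
      then show ?thesis by (simp add: x'_def)
    qed
    then have "x' j \<in> \<int>" using kernel[OF x't _ j] by blast
    then show "x j \<in> \<int>" using j by (simp add: x'_def)
  qed
  have supp: "\<mu> j = 0" if "\<mu> \<in> M" "j \<ge> k" for \<mu> j using that by (auto simp: M_def)
  have "\<forall>i. \<exists>c::'v \<Rightarrow> int. i < k \<longrightarrow> (\<forall>j<k. (\<Sum>b\<in>B. c b * m b j) = of_bool (j = i))"
  proof
    fix i
    show "\<exists>c::'v \<Rightarrow> int. i < k \<longrightarrow> (\<forall>j<k. (\<Sum>b\<in>B. c b * m b j) = of_bool (j = i))"
    proof (cases "i < k")
      case True
      have "(\<lambda>j. of_bool (j = i)) \<in> M"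
        by (rule int_subgroup_eq_full[where k = k, OF M]) (erule (1) supp, erule ann, rule True)
      then obtain c where "(\<lambda>j. of_bool (j = i)) = (\<lambda>j. if j < k then \<Sum>b\<in>B. c b * m b j else 0)" by (auto simp: M_def)
      then have "\<forall>j<k. (\<Sum>b\<in>B. c b * m b j) = of_bool (j = i)" by (metis (no_types, lifting))
      then show ?thesis by blast
    qed blast
  qed
  from choice[OF this] show ?thesis by blast
qed

definition dual_coeff :: "nat \<Rightarrow> 'v \<Rightarrow> int" where
  "dual_coeff = (SOME n. \<forall>i<k. \<forall>j<k. (\<Sum>b\<in>B. n i b * m b j) = of_bool (j = i))"

lemma dual_coeff: "i < k \<Longrightarrow> j < k \<Longrightarrow> (\<Sum>b\<in>B. dual_coeff i b * m b j) = of_bool (j = i)"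
  using someI_ex[OF ex_dual_coefficients] unfolding dual_coeff_def by blast

lemma coordinate_eq_weights:
  assumes "x \<in> t" "i < k"
  shows "x i = (\<Sum>b\<in>B. of_int (dual_coeff i b) * weight b x)"
proof -
  have "(\<Sum>b\<in>B. of_int (dual_coeff i b) * weight b x) = (\<Sum>b\<in>B. \<Sum>j<k. of_int (dual_coeff i b * m b j) * x j)"
    using assms by (simp add: weight_def sum_distrib_left mult.assoc)
  also have "\<dots> = (\<Sum>j<k. of_int (\<Sum>b\<in>B. dual_coeff i b * m b j) * x j)"
    by (subst sum.swap) (simp add: sum_distrib_right)
  also have "\<dots> = (\<Sum>j<k. if j = i then x j else 0)" using assms by (intro sum.cong) (auto simp: dual_coeff)
  finally show ?thesis using assms by simp
qed

text \<open>Every coordinate is a combination of weights, so the weights separate the points of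
  \<open>t\<close>. Identities between lifts are checked in this way.\<close>

lemma t_eqI:
  assumes "x \<in> t" "y \<in> t" "\<And>b. b \<in> B \<Longrightarrow> weight b x = weight b y"
  shows "x = y"
proof
  fix i show "x i = y i"
  proof (cases "i < k")
    case True then show ?thesis
      unfolding coordinate_eq_weights[OF assms(1) True] coordinate_eq_weights[OF assms(2) True] by (simp add: assms(3))
  qed (use assms in \<open>auto simp: supported_def\<close>)
qed

text \<open>If a parameter \<open>x'\<close> satisfies \<open>weight (f b) x' = weight b x\<close>
  for all \<open>b\<close>, then \<open>coordinate_eq_weights\<close>, reindexed by the permutation
  f of \<open>B\<close>, computes its coordinates by this formula. Thus it is the only candidate,
  and it is visibly linear in \<open>x\<close>.\<close>

definition lift :: "('v \<Rightarrow> 'v) \<Rightarrow> (nat \<Rightarrow> real) \<Rightarrow> nat \<Rightarrow> real" where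
  "lift f = (\<lambda>x\<in>t. \<lambda>i. if i < k then \<Sum>b\<in>B. of_int (dual_coeff i (f b)) * weight b x else 0)"

lemma lift_closed: "x \<in> t \<Longrightarrow> lift f x \<in> t"
  by (simp add: lift_def, simp add: supported_def)

lemma lift_lin: "lin_on pointwise_scale t pointwise_scale (lift f)"
  unfolding lin_on_def
  by (auto simp: lift_def t_closed fun_eq_iff weight_add weight_scale sum.distrib sum_distrib_left algebra_simps)
    (auto simp: pointwise_scale_def sum_distrib_left algebra_simps)

text \<open>Both sides are linear in \<open>x\<close> and agree modulo the integers, hence they are equal.\<close>

lemma weight_lift:
  assumes f: "f \<in> F" and b: "b \<in> B" and x: "x \<in> t"
  shows "weight (f b) (lift f x) = weight b x"
proof (rule ccontr)
  define D where "D x = weight (f b) (lift f x) - weight b x" for x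
  assume "weight (f b) (lift f x) \<noteq> weight b x"
  then have "D x \<noteq> 0" by (simp add: D_def)
  then obtain r where r: "r * D x \<notin> \<int>" using ex_multiple_not_int by blast
  have int: "D x \<in> \<int>" if x: "x \<in> t" for x
  proof -
    obtain x' where x': "x' \<in> t" "\<And>b. b \<in> B \<Longrightarrow> weight (f b) x' - weight b x \<in> \<int>" using weight_conjugate[OF f x] by blast
    \<comment> \<open>The parameter obtained by conjugation obeys the defining formula of
      \<open>lift\<close> up to integers, because the coefficients \<open>dual_coeff\<close> are
      integers; so it differs from \<open>lift f x\<close> by a lattice vector.\<close>
    have "x' i - lift f x i \<in> \<int>" if i: "i < k" for i
    proof -
      have "x' i = (\<Sum>a\<in>B. of_int (dual_coeff i (f a)) * weight (f a) x')"
        unfolding coordinate_eq_weights[OF x'(1) i] by (rule sum.reindex_bij_betw[OF F_permutes_basis[OF f], symmetric])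
      then have "x' i - lift f x i = (\<Sum>a\<in>B. of_int (dual_coeff i (f a)) * (weight (f a) x' - weight a x))"
        using x i by (simp add: lift_def sum_subtractf algebra_simps)
      also have "\<dots> \<in> \<int>" using x'(2) by (intro Ints_sum Ints_mult) auto
      finally show ?thesis .
    qed
    then have "(\<Sum>j<k. of_int (m (f b) j) * (x' j - lift f x j)) \<in> \<int>" by (intro Ints_sum Ints_mult) auto
    also have "(\<Sum>j<k. of_int (m (f b) j) * (x' j - lift f x j)) = weight (f b) x' - weight (f b) (lift f x)"
      using x'(1) lift_closed[OF x] by (simp add: weight_def sum_subtractf algebra_simps)
    finally have "(weight (f b) x' - weight b x) - (weight (f b) x' - weight (f b) (lift f x)) \<in> \<int>"
      using x'(2)[OF b] by (rule Ints_diff[rotated])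
    then show ?thesis by (simp add: D_def)
  qed
  have "D (pointwise_scale r x) = r * D x"
    using x lift_lin[of f] by (simp add: D_def weight_scale lin_on_def lift_closed algebra_simps)
  then show False using r int[OF t_closed(2)[OF x, of r]] by simp
qed

lemma lift_mult_apply:
  assumes f: "f \<in> F" and g: "g \<in> F" and x: "x \<in> t"
  shows "lift f (lift g x) = lift (f \<otimes>\<^bsub>GL s V\<^esub> g) x"
proof (rule t_eqI)
  fix b assume b: "b \<in> B"
  then obtain a where a: "a \<in> B" "b = f (g a)"
    using F_permutes_basis[OF f] F_permutes_basis[OF g] unfolding bij_betw_def by (metis imageE)
  have fg: "(f \<otimes>\<^bsub>GL s V\<^esub> g) a = f (g a)" using a by (simp add: mult_GL F_in_GL f g compose_eq B_in_V)
  have "weight b (lift f (lift g x)) = weight a x" using a f g x by (simp add: weight_lift lift_closed F_basis)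
  also have "\<dots> = weight b (lift (f \<otimes>\<^bsub>GL s V\<^esub> g) x)"
    using weight_lift[OF subgroup.m_closed[OF subgroup_F f g] a(1) x] fg a by simp
  finally show "weight b (lift f (lift g x)) = weight b (lift (f \<otimes>\<^bsub>GL s V\<^esub> g) x)" .
qed (use x lift_closed in auto)

lemma lift_one_apply:
  assumes x: "x \<in> t"
  shows "lift \<one>\<^bsub>GL s V\<^esub> x = x"
proof (rule t_eqI)
  fix b assume b: "b \<in> B"
  then show "weight b (lift \<one>\<^bsub>GL s V\<^esub> x) = weight b x"
    using weight_lift[OF subgroup.one_closed[OF subgroup_F] b x] by (simp add: one_GL B_in_V)
qed (use x lift_closed in auto)

lemma lift_inv_apply:
  assumes f: "f \<in> F" and x: "x \<in> t"
  shows "lift f (lift (inv\<^bsub>GL s V\<^esub> f) x) = x" "lift (inv\<^bsub>GL s V\<^esub> f) (lift f x) = x"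
  using f x group.r_inv[OF group_GL F_in_GL[OF f]] group.l_inv[OF group_GL F_in_GL[OF f]]
  by (simp_all add: lift_mult_apply inv_F lift_one_apply)

lemma lift_in_GL: "f \<in> F \<Longrightarrow> lift f \<in> carrier (GL pointwise_scale t)"
  by (rule ct.GL_memI[where A' = "lift (inv\<^bsub>GL s V\<^esub> f)"])
    (auto simp: lift_lin lift_closed lift_inv_apply, auto simp: lift_def)

lemma inv_lift: "f \<in> F \<Longrightarrow> inv\<^bsub>GL pointwise_scale t\<^esub> (lift f) = lift (inv\<^bsub>GL s V\<^esub> f)"
  by (rule ct.GL_inv_equality) (simp_all add: lift_in_GL inv_F lift_inv_apply)

text \<open>The dual form of \<open>weight_lift\<close>: on the weights the contragredient action is
  the permutation of \<open>B\<close> by f, so \<open>K\<close> is preserved.\<close>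

lemma contragredient_lift:
  assumes f: "f \<in> F" and b: "b \<in> B"
  shows "contragredient pointwise_scale t (lift f) (weight b) = weight (f b)"
proof
  fix x show "contragredient pointwise_scale t (lift f) (weight b) x = weight (f b) x"
  proof (cases "x \<in> t")
    case True
    have "weight b (lift (inv\<^bsub>GL s V\<^esub> f) x) = weight (f b) (lift f (lift (inv\<^bsub>GL s V\<^esub> f) x))"
      by (rule weight_lift[OF f b lift_closed[OF True], symmetric])
    then show ?thesis using True f by (simp add: contragredient_def inv_lift lift_inv_apply)
  qed (simp add: contragredient_def weight_def)
qed

lemma subgroup_lift: "subgroup (lift ` F) (GL pointwise_scale t)"
proof (rule group.subgroupI[OF ct.group_GL])
  show "lift ` F \<noteq> {}" using subgroup.one_closed[OF subgroup_F] by auto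
  fix A assume "A \<in> lift ` F"
  then show "inv\<^bsub>GL pointwise_scale t\<^esub> A \<in> lift ` F" using inv_F by (auto simp: inv_lift)
next
  fix A A' assume "A \<in> lift ` F" "A' \<in> lift ` F"
  then obtain f g where fg: "f \<in> F" "g \<in> F" "A = lift f" "A' = lift g" by blast
  have fgF: "f \<otimes>\<^bsub>GL s V\<^esub> g \<in> F" by (rule subgroup.m_closed[OF subgroup_F fg(1,2)])
  have "A \<otimes>\<^bsub>GL pointwise_scale t\<^esub> A' = lift (f \<otimes>\<^bsub>GL s V\<^esub> g)"
    using fg fgF by (intro ct.GL_eqI group.is_monoid[OF ct.group_GL, THEN monoid.m_closed])
      (auto simp: lift_in_GL ct.mult_GL compose_eq lift_mult_apply)
  then show "A \<otimes>\<^bsub>GL pointwise_scale t\<^esub> A' \<in> lift ` F" using fgF by blast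
qed (use lift_in_GL in auto)

section \<open>The lattice and the data of Construction M\<close>

definition lattice :: "(nat \<Rightarrow> real) set" where
  "lattice = range (\<lambda>c::(nat \<Rightarrow> real) \<Rightarrow> int. \<Sum>u\<in>unit_fun ` {..<k}. pointwise_scale (of_int (c u)) u)"

lemma is_lattice: "is_lattice pointwise_scale t lattice"
  unfolding is_lattice_def lattice_def using is_basis_unit_fun[of "{..<k}"]
  by (intro exI[of _ "unit_fun ` {..<k}"]) auto

lemma unit_in_lattice:
  assumes "j < k"
  shows "unit_fun j \<in> lattice"
proof -
  have "(unit_fun j :: nat \<Rightarrow> real) = (\<Sum>u\<in>unit_fun ` {..<k}. pointwise_scale (of_int (if u = unit_fun j then 1 else 0)) u)"
    using assms by (simp add: if_distrib[of "\<lambda>r. pointwise_scale r _"] if_distrib[of real_of_int] cong: if_cong)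
  then show ?thesis unfolding lattice_def by (rule range_eqI[where x = "\<lambda>u. if u = unit_fun j then 1 else 0"])
qed

lemma weights_dual: "weights \<subseteq> dual_lattice pointwise_scale t lattice"
proof
  fix y assume "y \<in> weights"
  then obtain b where b: "b \<in> B" "y = weight b" by (auto simp: weights_def)
  have "weight b x \<in> \<int>" if x: "x \<in> lattice" for x
  proof -
    obtain c :: "(nat \<Rightarrow> real) \<Rightarrow> int" where "x = (\<Sum>u\<in>unit_fun ` {..<k}. pointwise_scale (of_int (c u)) u)" using x by (auto simp: lattice_def)
    then have "weight b x = (\<Sum>u\<in>unit_fun ` {..<k}. of_int (c u) * weight b u)"
      using ct.lin_on_lincomb[OF weight_lin[of b], of "unit_fun ` {..<k}" "\<lambda>u. u" "\<lambda>u. of_int (c u)"] unit_in_t by auto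
    also have "\<dots> \<in> \<int>" by (intro Ints_sum Ints_mult) (auto simp: weight_unit)
    finally show ?thesis .
  qed
  then show "y \<in> dual_lattice pointwise_scale t lattice"
    using b weight_lin by (auto simp: dual_lattice_def dual_space_def weight_def)
qed

lemma closure_weights: "group_closure weights = dual_lattice pointwise_scale t lattice"
proof (intro equalityI subsetI)
  fix y assume "y \<in> group_closure weights"
  then show "y \<in> dual_lattice pointwise_scale t lattice"
  proof induction
    case (base y)
    then show ?case using weights_dual by (auto simp: dual_lattice_def dual_space_def lin_on_def)
  next
    case (diff y z)
    then show ?case by (auto simp: dual_lattice_def dual_space_def lin_on_def algebra_simps)
  qed
next
  fix y assume y: "y \<in> dual_lattice pointwise_scale t lattice"
  have "\<forall>j. \<exists>c::int. j < k \<longrightarrow> y (unit_fun j) = of_int c"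
    using y unit_in_lattice by (auto simp: dual_lattice_def elim!: Ints_cases)
  then obtain c :: "nat \<Rightarrow> int" where c: "\<And>j. j < k \<Longrightarrow> y (unit_fun j) = of_int (c j)" by metis
  \<comment> \<open>A functional with values \<open>c i\<close> on the unit vectors is the sum of
    \<open>c i\<close> times the i-th coordinate; expanding the coordinates in weights gives these
    coefficients.\<close>
  define n where "n b = (\<Sum>i<k. c i * dual_coeff i b)" for b
  have "y = (\<lambda>x. \<Sum>b\<in>B. of_int (n b) * weight b x)"
  proof
    fix x show "y x = (\<Sum>b\<in>B. of_int (n b) * weight b x)"
    proof (cases "x \<in> t")
      case True
      have lin: "lin_on pointwise_scale t (*) y" using y by (simp add: dual_lattice_def dual_space_def)
      have "y x = y (\<Sum>i<k. pointwise_scale (x i) (unit_fun i))" using unit_fun_expansion[OF _ True] by simp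
      also have "\<dots> = (\<Sum>i<k. x i * y (unit_fun i))" by (rule ct.lin_on_lincomb[OF lin]) (simp add: unit_in_t)
      also have "\<dots> = (\<Sum>i<k. (\<Sum>b\<in>B. of_int (dual_coeff i b) * weight b x) * of_int (c i))"
        by (intro sum.cong) (auto simp: c coordinate_eq_weights[OF True, symmetric])
      also have "\<dots> = (\<Sum>i<k. \<Sum>b\<in>B. of_int (c i * dual_coeff i b) * weight b x)"
        by (simp add: sum_distrib_right sum_distrib_left mult_ac)
      also have "\<dots> = (\<Sum>b\<in>B. of_int (n b) * weight b x)"
        by (subst sum.swap) (simp add: n_def sum_distrib_right)
      finally show ?thesis .
    qed (use y in \<open>auto simp: dual_lattice_def dual_space_def weight_def\<close>)
  qed
  also have "\<dots> \<in> group_closure weights"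
    by (intro group_closure_int_combination group_closure.base) (auto simp: weights_def)
  finally show "y \<in> group_closure weights" .
qed

lemma M_data: "M_data pointwise_scale t lattice weights (lift ` F)"
  unfolding M_data_def
proof (intro conjI ballI)
  show "findim_space pointwise_scale t" by (rule findim_space_supported) simp
  show "finite weights" "finite (lift ` F)" using finite_B finite_F by (auto simp: weights_def)
  fix A assume "A \<in> lift ` F"
  then obtain f where f: "f \<in> F" "A = lift f" by blast
  have "contragredient pointwise_scale t A ` weights = weight ` f ` B"
    unfolding weights_def image_image using f by (intro image_cong) (auto simp: contragredient_lift)
  then show "contragredient pointwise_scale t A ` weights = weights"
    using F_permutes_basis[OF f(1)] by (simp add: weights_def bij_betw_def)
qed (fact is_lattice weights_dual closure_weights subgroup_lift)+

sublocale M: M_construction pointwise_scale t lattice weights "lift ` F"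
  by unfold_locales (rule M_data)

section \<open>The isomorphism onto the functions on the weights\<close>

definition realization :: "'v \<Rightarrow> ((nat \<Rightarrow> real) \<Rightarrow> real) \<Rightarrow> complex" where
  "realization w = (\<lambda>y. if y \<in> weights then coord w (the_inv_into B weight y) else 0)"

lemma realization_weight: "b \<in> B \<Longrightarrow> realization w (weight b) = coord w b"
  by (simp add: realization_def weights_def the_inv_into_f_f[OF inj_weight])

lemma realization_closed: "realization w \<in> C_fun weights"
  by (simp add: realization_def C_fun_def)

lemma realization_eqI:
  "u \<in> C_fun weights \<Longrightarrow> (\<And>b. b \<in> B \<Longrightarrow> u (weight b) = coord w b) \<Longrightarrow> realization w = u"
  by (rule M.C_fun_eqI[OF realization_closed]) (auto simp: realization_weight elim: in_weightsE)

lemma bij_realization: "bij_betw realization V (C_fun weights)"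
  unfolding bij_betw_def
proof
  show "inj_on realization V"
    by (rule inj_onI, rule coord_eqI) (auto simp flip: realization_weight)
  show "realization ` V = C_fun weights"
  proof (intro equalityI subsetI)
    fix u assume u: "u \<in> C_fun weights"
    define w where "w = (\<Sum>b\<in>B. s (u (weight b)) b)"
    have "w \<in> V" unfolding w_def by (intro subspace_sum[OF subspace_V] subspace_scale[OF subspace_V] B_in_V)
    moreover have "realization w = u" by (rule realization_eqI[OF u]) (simp add: w_def coord_lincomb_basis)
    ultimately show "u \<in> realization ` V" by blast
  qed (auto simp: realization_closed)
qed

lemma lin_realization: "lin_on s V pointwise_scale realization"
  by (auto simp: lin_on_def realization_def fun_eq_iff coord_add coord_scale pointwise_scale_def)

lemma conj_op_realization: "w \<in> V \<Longrightarrow> conj_op V (C_fun weights) realization A (realization w) = realization (A w)"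
  using bij_realization by (simp add: conj_op_def realization_closed bij_betw_def)

lemma conj_op_eqI:
  assumes "A' \<in> extensional (C_fun weights)" "\<And>w. w \<in> V \<Longrightarrow> A' (realization w) = realization (A w)"
  shows "conj_op V (C_fun weights) realization A = A'"
proof (rule extensionalityI)
  show "conj_op V (C_fun weights) realization A \<in> extensional (C_fun weights)" by (simp add: conj_op_def)
  fix u assume "u \<in> C_fun weights"
  then obtain w where "w \<in> V" "u = realization w" using bij_realization by (auto simp: bij_betw_def)
  then show "conj_op V (C_fun weights) realization A u = A' u" using assms(2) by (simp add: conj_op_realization)
qed (rule assms)

text \<open>The inverse inside \<open>M_action\<close> matches the transport of coordinates: for
  \<open>b = f a\<close> it leads from \<open>weight b\<close> back to \<open>weight a\<close>, and
  the coordinate of \<open>f w\<close> at \<open>b\<close> is that of \<open>w\<close> at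
  \<open>a\<close>.\<close>

lemma conj_op_F:
  assumes f: "f \<in> F"
  shows "conj_op V (C_fun weights) realization f = M_action pointwise_scale t weights (lift f)"
proof (rule conj_op_eqI)
  fix w assume w: "w \<in> V"
  show "M_action pointwise_scale t weights (lift f) (realization w) = realization (f w)"
  proof (rule realization_eqI[symmetric])
    fix b assume "b \<in> B"
    then obtain a where a: "a \<in> B" "b = f a" using F_permutes_basis[OF f] by (auto simp: bij_betw_def)
    let ?g = "inv\<^bsub>GL s V\<^esub> f"
    have "?g b = a" using a f by (simp add: GL_inv_apply F_in_GL B_in_V)
    then have "contragredient pointwise_scale t (inv\<^bsub>GL pointwise_scale t\<^esub> (lift f)) (weight b) = weight a"
      using contragredient_lift[OF inv_F[OF f] \<open>b \<in> B\<close>] f by (simp add: inv_lift)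
    moreover have "weight b \<in> weights" using \<open>b \<in> B\<close> by (simp add: weights_def)
    ultimately show "M_action pointwise_scale t weights (lift f) (realization w) (weight b) = coord (f w) b"
      using a f w by (simp add: M.M_action_apply realization_closed realization_weight coord_F)
  qed (simp add: M.M_action_closed realization_closed)
qed (simp add: M_action_def)

lemma conj_op_H:
  assumes x: "x \<in> t"
  shows "conj_op V (C_fun weights) realization (H x) = M.torus_op x"
proof (rule conj_op_eqI)
  fix w assume w: "w \<in> V"
  show "M.torus_op x (realization w) = realization (H x w)"
  proof (rule realization_eqI[symmetric])
    fix b assume b: "b \<in> B"
    then show "M.torus_op x (realization w) (weight b) = coord (H x w) b"
      using x w by (simp add: M.torus_op_def mult_op_apply realization_closed realization_weight coord_H M.torus_char_def)
  qed (simp add: M.torus_op_def mult_op_closed realization_closed)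
qed (simp add: M.torus_op_def mult_op_def)

lemma conj_op_mult:
  assumes f: "f \<in> F" and x: "x \<in> t"
  shows "conj_op V (C_fun weights) realization (f \<otimes>\<^bsub>GL s V\<^esub> H x) =
    M_action pointwise_scale t weights (lift f) \<otimes>\<^bsub>M.\<G>\<^esub> M.torus_op x"
proof (rule conj_op_eqI)
  have GL: "M_action pointwise_scale t weights (lift f) \<in> carrier M.\<G>" using f by (intro M.M_action_in_GL) blast
  then have mult: "M_action pointwise_scale t weights (lift f) \<otimes>\<^bsub>M.\<G>\<^esub> M.torus_op x =
      compose (C_fun weights) (M_action pointwise_scale t weights (lift f)) (M.torus_op x)"
    by (rule M.cf.mult_GL[OF _ M.torus_op_in_GL])
  show "M_action pointwise_scale t weights (lift f) \<otimes>\<^bsub>M.\<G>\<^esub> M.torus_op x \<in> extensional (C_fun weights)"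
    unfolding mult by (simp add: compose_def)
  fix w assume w: "w \<in> V"
  have Hw: "H x w \<in> V" by (rule GL_closed[OF H_GL[OF x] w])
  have "M.torus_op x (realization w) = realization (H x w)"
    using conj_op_realization[OF w, of "H x"] by (simp add: conj_op_H x)
  moreover have "M_action pointwise_scale t weights (lift f) (realization (H x w)) = realization (f (H x w))"
    using conj_op_realization[OF Hw, of f] by (simp add: conj_op_F f)
  ultimately show "(M_action pointwise_scale t weights (lift f) \<otimes>\<^bsub>M.\<G>\<^esub> M.torus_op x) (realization w) = realization ((f \<otimes>\<^bsub>GL s V\<^esub> H x) w)"
    unfolding mult mult_GL[OF F_in_GL[OF f] H_GL[OF x]] using w by (simp add: compose_eq realization_closed)
qed

lemma M_realizable: "M_realizable s V G F T (\<Sum>b\<in>B. b)"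
  unfolding M_realizable_def
proof (intro exI conjI)
  let ?v = "\<Sum>b\<in>B. b"
  show "M_data pointwise_scale t lattice weights (lift ` F)" by (rule M_data)
  show "bij_betw realization V (C_fun weights)" by (rule bij_realization)
  show "lin_on s V pointwise_scale realization" by (rule lin_realization)
  show "conj_op V (C_fun weights) realization ` F = M_finite pointwise_scale t weights (lift ` F)"
    unfolding M_finite_def image_image by (intro image_cong) (auto simp: conj_op_F)
  show "conj_op V (C_fun weights) realization ` T = M_torus t weights"
    unfolding M.M_torus_eq T_eq image_image by (intro image_cong) (auto simp: conj_op_H)
  have "G = (\<lambda>(f, x). f \<otimes>\<^bsub>GL s V\<^esub> H x) ` (F \<times> t)"
    by (auto simp: G_eq T_eq set_mult_def)
  then have "conj_op V (C_fun weights) realization ` G =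
      (\<lambda>(f, x). M_action pointwise_scale t weights (lift f) \<otimes>\<^bsub>M.\<G>\<^esub> M.torus_op x) ` (F \<times> t)"
    by (simp only: image_image) (intro image_cong, auto simp: conj_op_mult)
  also have "\<dots> = M_group pointwise_scale t weights (lift ` F)"
    unfolding M.M_group_left by auto
  finally show "conj_op V (C_fun weights) realization ` G = M_group pointwise_scale t weights (lift ` F)" .
  have v: "?v \<in> V" by (intro subspace_sum[OF subspace_V] B_in_V)
  \<comment> \<open>\<open>realization\<close> turns the sum of the basis into the constant function
    1 on the weights.\<close>
  have "coord ?v b = 1" if "b \<in> B" for b using coord_lincomb_basis[OF that, of "\<lambda>_. 1"] by simp
  then have "realization ?v \<in> nowhere_vanishing weights"
    by (auto simp: nowhere_vanishing_def realization_closed realization_weight elim!: in_weightsE)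
  moreover have "M_action pointwise_scale t weights (lift f) (realization ?v) = realization ?v" if "f \<in> F" for f
    using conj_op_realization[OF v, of f] that by (simp add: conj_op_F F_fixes)
  ultimately show "realization ?v \<in> nowhere_vanishing weights \<inter> invariant_functions pointwise_scale t weights (lift ` F)"
    by (auto simp: invariant_functions_def realization_closed)
qed

end

section \<open>From the torus setting to a diagonal torus\<close>

lemma (in vector_space) is_basis_rescale:
  assumes B: "finite B" "is_basis scale V B" and c: "\<And>b. b \<in> B \<Longrightarrow> c b \<noteq> 0"
  shows "is_basis scale V ((\<lambda>b. scale (c b) b) ` B)" "inj_on (\<lambda>b. scale (c b) b) B"
proof -
  have ind: "independent B" and span: "span B = V" using B(2) by (auto simp: is_basis_def)
  let ?g = "\<lambda>b. scale (c b) b"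
  show inj: "inj_on ?g B"
  proof (rule inj_onI)
    fix a b assume ab: "a \<in> B" "b \<in> B" "?g a = ?g b"
    have "representation B (?g a) a = c a" "representation B (?g b) a = c b * (if a = b then 1 else 0)"
      using ab(1,2) by (simp_all add: representation_scale ind span_base representation_basis)
    then show "a = b" using ab(3) c[OF ab(1)] by (auto split: if_splits)
  qed
  have "independent (?g ` B)"
  proof
    assume "dependent (?g ` B)"
    then obtain u b where ub: "b \<in> B" "u (?g b) \<noteq> 0" "(\<Sum>w\<in>?g ` B. scale (u w) w) = 0"
      using B(1) by (auto simp: dependent_finite)
    have "(\<Sum>b\<in>B. scale (u (?g b) * c b) b) = 0" using ub(3) by (simp add: sum.reindex[OF inj])
    moreover have "u (?g b) * c b \<noteq> 0" using ub c by simp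
    ultimately have "dependent B" unfolding dependent_finite[OF B(1)]
      using ub(1) by (intro exI[of _ "\<lambda>b. u (?g b) * c b"]) auto
    then show False using ind by simp
  qed
  moreover have "span (?g ` B) = V"
  proof -
    have "?g ` B \<subseteq> span B" by (auto intro: span_scale span_base)
    moreover have "b \<in> span (?g ` B)" if "b \<in> B" for b
    proof -
      have "b = scale (1 / c b) (?g b)" using c[OF that] by simp
      also have "\<dots> \<in> span (?g ` B)" using that by (intro span_scale span_base) auto
      finally show ?thesis .
    qed
    ultimately show ?thesis using span span_eq[of "?g ` B" B] by blast
  qed
  ultimately show "is_basis scale V (?g ` B)" by (simp add: is_basis_def)
qed

definition circle_exp :: "nat \<Rightarrow> (nat \<Rightarrow> real) \<Rightarrow> nat \<Rightarrow> complex" where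
  "circle_exp k x = (\<lambda>j\<in>{..<k}. exp (2 * of_real pi * \<i> * of_real (x j)))"

lemma circle_exp_in_circles: "circle_exp k x \<in> topspace (circles k)"
  by (auto simp: circle_exp_def topspace_circles norm_exp)

text \<open>Here \<open>p\<close> is the lift to \<open>\<real>\<^sup>k\<close> of a continuous character of \<open>(S\<^sup>1)\<^sup>k\<close>.\<close>

lemma circle_power_character:
  fixes p :: "(nat \<Rightarrow> real) \<Rightarrow> complex"
  assumes mult: "\<And>x y. p (x + y) = p x * p y" and zero: "p 0 = 1"
    and cong: "\<And>x y. circle_exp k x = circle_exp k y \<Longrightarrow> p x = p y"
    and cont: "\<And>j. j < k \<Longrightarrow> continuous_on UNIV (\<lambda>r. p (pointwise_scale r (unit_fun j)))"
  shows "\<exists>m :: nat \<Rightarrow> int. \<forall>x. p x = exp (2 * of_real pi * \<i> * of_real (\<Sum>j<k. of_int (m j) * x j))"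
proof -
  have "\<forall>j. \<exists>n::int. j < k \<longrightarrow> (\<forall>r. p (pointwise_scale r (unit_fun j)) = exp (2 * of_real pi * \<i> * of_real (of_int n * r)))"
  proof (intro allI)
    fix j
    show "\<exists>n::int. j < k \<longrightarrow> (\<forall>r. p (pointwise_scale r (unit_fun j)) = exp (2 * of_real pi * \<i> * of_real (of_int n * r)))"
    proof (cases "j < k")
      case True
      \<comment> \<open>The parameter 1 gives the same point of the circles as 0, which supplies the
        periodicity needed for an integral exponent.\<close>
      have "circle_exp k (pointwise_scale 1 (unit_fun j)) = circle_exp k 0"
        unfolding circle_exp_def by (rule restrict_ext) (simp add: pointwise_scale_def unit_fun_def)
      then have one: "p (pointwise_scale 1 (unit_fun j)) = 1" using cong zero by metis
      have add: "p (pointwise_scale (r + r') (unit_fun j)) = p (pointwise_scale r (unit_fun j)) * p (pointwise_scale r' (unit_fun j))" for r r'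
      proof -
        have "pointwise_scale (r + r') (unit_fun j) = pointwise_scale r (unit_fun j) + pointwise_scale r' (unit_fun j)"
          by (auto simp: pointwise_scale_def algebra_simps)
        then show ?thesis by (simp only: mult)
      qed
      show ?thesis using continuous_periodic_character[OF cont[OF True] add one] by blast
    qed simp
  qed
  from choice[OF this] obtain m :: "nat \<Rightarrow> int" where
    m: "\<And>j r. j < k \<Longrightarrow> p (pointwise_scale r (unit_fun j)) = exp (2 * of_real pi * \<i> * of_real (of_int (m j) * r))" by blast
  \<comment> \<open>Coordinates are added one at a time. Those beyond \<open>k\<close> may be
    dropped, since \<open>p\<close> depends on \<open>circle_exp k x\<close> only.\<close>
  have "p (\<lambda>i. if i < l then x i else 0) = exp (2 * of_real pi * \<i> * of_real (\<Sum>j<l. of_int (m j) * x j))" if "l \<le> k" for l x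
    using that
  proof (induction l)
    case 0 then show ?case using zero by (simp add: zero_fun_def)
  next
    case (Suc l)
    have "(\<lambda>i. if i < Suc l then x i else 0) = (\<lambda>i. if i < l then x i else 0) + pointwise_scale (x l) (unit_fun l)"
      by (auto simp: fun_eq_iff pointwise_scale_def unit_fun_def less_Suc_eq)
    then show ?case using Suc m[of l "x l"] by (simp add: mult exp_add distrib_left flip: exp_add)
  qed
  moreover have "p x = p (\<lambda>i. if i < k then x i else 0)" for x
    by (rule cong) (auto simp: circle_exp_def intro: restrict_ext)
  ultimately show ?thesis by (intro exI[of _ m]) simp
qed

text \<open>Multiplicativity for the pair of f and the identity reads (Tf)T = Tf as sets, and the
  left side contains the product of f and \<tau>. So normalisation is extracted from the coset
  map.\<close>

lemma (in carrier_space) coset_hom_imp_normalizes: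
  assumes T: "T \<subseteq> carrier (GL s V)" "\<one>\<^bsub>GL s V\<^esub> \<in> T" and F: "subgroup F (GL s V)"
    and hom: "(\<lambda>f. T #>\<^bsub>GL s V\<^esub> f) \<in> hom (GL s V\<lparr>carrier := F\<rparr>) (GL s V\<lparr>carrier := G\<rparr> Mod T)"
    and f: "f \<in> F" and \<tau>: "\<tau> \<in> T"
  shows "\<exists>\<tau>'\<in>T. \<forall>x\<in>V. f (\<tau> x) = \<tau>' (f x)"
proof -
  interpret GL: group "GL s V" by (rule group_GL)
  have oneF: "\<one>\<^bsub>GL s V\<^esub> \<in> F" by (rule subgroup.one_closed[OF F])
  have fG: "f \<in> carrier (GL s V)" using f subgroup.subset[OF F] by blast
  have \<tau>G: "\<tau> \<in> carrier (GL s V)" using \<tau> T by blast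
  have "T #>\<^bsub>GL s V\<^esub> (f \<otimes>\<^bsub>GL s V\<^esub> \<one>\<^bsub>GL s V\<^esub>) = (T #>\<^bsub>GL s V\<^esub> f) <#>\<^bsub>GL s V\<^esub> (T #>\<^bsub>GL s V\<^esub> \<one>\<^bsub>GL s V\<^esub>)"
    using hom_mult[OF hom, of f "\<one>\<^bsub>GL s V\<^esub>"] f oneF by (simp add: FactGroup_def set_mult_def)
  moreover have "f \<otimes>\<^bsub>GL s V\<^esub> \<tau> \<in> (T #>\<^bsub>GL s V\<^esub> f) <#>\<^bsub>GL s V\<^esub> (T #>\<^bsub>GL s V\<^esub> \<one>\<^bsub>GL s V\<^esub>)"
  proof -
    have "f \<in> T #>\<^bsub>GL s V\<^esub> f" using T(2) fG unfolding r_coset_def by (metis GL.l_one UN_I singletonI)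
    moreover have "\<tau> \<in> T #>\<^bsub>GL s V\<^esub> \<one>\<^bsub>GL s V\<^esub>" using \<tau> \<tau>G unfolding r_coset_def by (metis GL.r_one UN_I singletonI)
    ultimately show ?thesis unfolding set_mult_def by blast
  qed
  ultimately have "f \<otimes>\<^bsub>GL s V\<^esub> \<tau> \<in> T #>\<^bsub>GL s V\<^esub> f" using fG by simp
  then obtain \<tau>' where \<tau>': "\<tau>' \<in> T" "f \<otimes>\<^bsub>GL s V\<^esub> \<tau> = \<tau>' \<otimes>\<^bsub>GL s V\<^esub> f" by (auto simp: r_coset_def)
  have \<tau>'G: "\<tau>' \<in> carrier (GL s V)" using \<tau>' T by blast
  have "compose V f \<tau> = compose V \<tau>' f" using \<tau>'(2) by (simp only: mult_GL fG \<tau>G \<tau>'G)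
  then have "f (\<tau> x) = \<tau>' (f x)" if "x \<in> V" for x using that by (metis compose_eq)
  then show ?thesis using \<tau>'(1) by blast
qed

lemma torus_realizable:
  fixes s :: "complex \<Rightarrow> 'v::ab_group_add \<Rightarrow> 'v"
  assumes setting: "torus_setting s V G F T v" and conds: "conds_abcde s V G F T v"
  shows "M_realizable s V G F T v"
proof -
  have findim: "findim_space s V" and subgroup_G: "subgroup G (GL s V)"
    and T_comp: "T = connected_component_of_set (subtopology (op_topology s V) G) \<one>\<^bsub>GL s V\<^esub>"
    and torus: "is_torus (GL s V\<lparr>carrier := T\<rparr>) (subtopology (op_topology s V) T)"
    and subgroup_F: "subgroup F (GL s V)" and finite_F: "finite F" and v: "v \<in> V"
    using setting by (auto simp: torus_setting_def)
  interpret carrier_space s V using findim by (rule findim_space_imp_carrier_space)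
  interpret GL: group "GL s V" by (rule group_GL)
  have T_sub: "T \<subseteq> G"
    unfolding T_comp using connected_component_of_subset_topspace[of "subtopology (op_topology s V) G" "\<one>\<^bsub>GL s V\<^esub>"] by auto
  have T_GL: "T \<subseteq> carrier (GL s V)" using T_sub subgroup.subset[OF subgroup_G] by blast
  have one_T: "\<one>\<^bsub>GL s V\<^esub> \<in> T"
  proof -
    have "\<one>\<^bsub>GL s V\<^esub> \<in> End_space s V" using GL_subset_End GL.one_closed by blast
    then show ?thesis
      unfolding T_comp using subgroup.one_closed[OF subgroup_G]
      by (simp add: connected_component_of_refl topspace_op_topology)
  qed
  obtain B0 where B0: "is_basis s V B0" "\<forall>b\<in>B0. joint_eigenvector s T b" "\<forall>b\<in>B0. representation B0 v b \<noteq> 0"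
    using conds by (auto simp: conds_abcde_def cond_c_def)
  obtain S where S: "finite S" "span S = V" using findim by (auto simp: findim_space_def)
  have "finite B0" using independent_span_bound[OF S(1), of B0] B0(1) S(2) span_superset[of B0] by (auto simp: is_basis_def)
  \<comment> \<open>The coordinates of \<open>v\<close> serve as scaling factors; they are nonzero
    by (c), and \<open>v\<close> becomes the sum of the new basis.\<close>
  let ?g = "\<lambda>b. s (representation B0 v b) b"
  define B where "B = ?g ` B0"
  have basis: "is_basis s V B" and inj: "inj_on ?g B0"
    unfolding B_def using is_basis_rescale[OF \<open>finite B0\<close> B0(1), of "representation B0 v"] B0(3) by auto
  have finite_B: "finite B" using \<open>finite B0\<close> by (simp add: B_def)
  have ind: "independent B" and span: "span B = V" using basis by (auto simp: is_basis_def)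
  have BV: "b \<in> V" if "b \<in> B" for b using span span_base that by blast
  have v_sum: "v = (\<Sum>b\<in>B. b)"
  proof -
    have "v = (\<Sum>b\<in>B0. s (representation B0 v b) b)"
      using B0(1) v \<open>finite B0\<close> by (intro sum_representation_eq[symmetric]) (auto simp: is_basis_def)
    also have "\<dots> = (\<Sum>b\<in>B. b)" unfolding B_def by (simp add: sum.reindex[OF inj])
    finally show ?thesis .
  qed
  have eig: "\<exists>c. \<tau> b = s c b" if \<tau>: "\<tau> \<in> T" and b: "b \<in> B" for \<tau> b
  proof -
    obtain b0 where b0: "b0 \<in> B0" "b = ?g b0" using b by (auto simp: B_def)
    have b0V: "b0 \<in> V" using b0 B0(1) span_base by (auto simp: is_basis_def)
    obtain c where "\<tau> b0 = s c b0" using B0(2) b0 \<tau> by (auto simp: joint_eigenvector_def)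
    then have "\<tau> b = s c b" using GL_scale[of \<tau> b0] b0V \<tau> T_GL by (auto simp: b0 mult.commute)
    then show ?thesis by blast
  qed
  obtain k :: nat and h where iso: "h \<in> iso (product_group {..<k} (\<lambda>_. circle_group)) (GL s V\<lparr>carrier := T\<rparr>)"
    and homeo: "homeomorphic_map (circles k) (subtopology (op_topology s V) T) h"
    using torus by (auto simp: is_torus_def circles_def)
  have carr: "carrier (product_group {..<k} (\<lambda>_. circle_group)) = topspace (circles k)"
    by (simp add: topspace_circles circle_group_def)
  have bij: "bij_betw h (topspace (circles k)) T" using iso unfolding iso_def carr by simp
  define H where "H x = h (circle_exp k x)" for x
  have HT: "H x \<in> T" for x using bij circle_exp_in_circles by (auto simp: H_def bij_betw_def)
  have HG: "H x \<in> carrier (GL s V)" for x using HT T_GL by blast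
  have H_lin: "lin_on s V s (H x)" for x using HG[of x] by (simp add: carrier_GL)
  have H_mult: "H (x + y) = H x \<otimes>\<^bsub>GL s V\<^esub> H y" for x y
  proof -
    have eq: "circle_exp k (x + y) = circle_exp k x \<otimes>\<^bsub>product_group {..<k} (\<lambda>_. circle_group)\<^esub> circle_exp k y"
      by (auto simp: circle_exp_def circle_group_def algebra_simps exp_add)
    have hom: "h \<in> hom (product_group {..<k} (\<lambda>_. circle_group)) (GL s V\<lparr>carrier := T\<rparr>)" using iso by (simp add: iso_def)
    have "circle_exp k x \<in> carrier (product_group {..<k} (\<lambda>_. circle_group))" for x
      unfolding carr by (rule circle_exp_in_circles)
    from hom_mult[OF hom this this] show ?thesis unfolding H_def eq by simp
  qed
  \<comment> \<open>The eigenvalue on \<open>b\<close> is read off as the coordinate at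
    \<open>b\<close>. This makes the character a matrix coefficient, hence continuous.\<close>
  define p where "p b x = representation B (H x b) b" for b x
  have H_p: "H x b = s (p b x) b" if b: "b \<in> B" for b x
  proof -
    obtain c where "H x b = s c b" using eig[OF HT b] by blast
    moreover from this have "p b x = c" using b by (simp add: p_def representation_scale ind span BV representation_basis)
    ultimately show ?thesis by simp
  qed
  have p_mult: "p b (x + y) = p b x * p b y" if b: "b \<in> B" for b x y
  proof -
    have "s (p b (x + y)) b = H x (H y b)"
      using H_mult[of x y] b by (simp add: mult_GL HG compose_eq BV flip: H_p)
    also have "\<dots> = s (p b x * p b y) b" using b by (simp add: H_p GL_scale[OF HG] BV mult.commute)
    finally show ?thesis using b ind dependent_zero by (metis scale_right_imp_eq)
  qed
  have p_zero: "p b 0 = 1" if b: "b \<in> B" for b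
  proof -
    have "H 0 \<otimes>\<^bsub>GL s V\<^esub> H 0 = H 0" using H_mult[of 0 0] by simp
    then have "H 0 = \<one>\<^bsub>GL s V\<^esub>" using HG by (metis GL.l_cancel_one')
    then show ?thesis using b by (simp add: p_def one_GL BV representation_basis ind)
  qed
  have p_cont: "continuous_on UNIV (\<lambda>r. p b (pointwise_scale r (unit_fun j)))" if b: "b \<in> B" for b j
  proof -
    have \<phi>: "(\<lambda>w\<in>V. representation B w b) \<in> lin_functionals s V"
      using ind span by (auto simp: lin_functionals_def lin_on_def representation_add representation_scale
          subspace_add[OF subspace_V] subspace_scale[OF subspace_V])
    have "continuous_map euclidean (circles k) (\<lambda>r. circle_exp k (pointwise_scale r (unit_fun j)))"
      unfolding circles_def continuous_map_componentwise
      by (auto simp: circle_exp_def continuous_map_in_subtopology norm_exp pointwise_scale_def intro!: continuous_intros)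
    moreover have "continuous_map (circles k) (op_topology s V) h"
      using homeomorphic_imp_continuous_map[OF homeo] by (simp add: continuous_map_in_subtopology)
    moreover note continuous_map_matrix_coefficient[OF \<phi> BV[OF b]]
    ultimately have "continuous_map euclidean euclidean
        ((\<lambda>A. (\<lambda>w\<in>V. representation B w b) (A b)) \<circ> (h \<circ> (\<lambda>r. circle_exp k (pointwise_scale r (unit_fun j)))))"
      by (intro continuous_map_compose)
    then have "continuous_on UNIV (\<lambda>r. (\<lambda>w\<in>V. representation B w b) (H (pointwise_scale r (unit_fun j)) b))"
      by (simp add: o_def H_def)
    then show ?thesis using GL_closed[OF HG BV[OF b]] by (simp add: p_def)
  qed
  have "\<exists>n :: nat \<Rightarrow> int. b \<in> B \<longrightarrow> (\<forall>x. p b x = exp (2 * of_real pi * \<i> * of_real (\<Sum>j<k. of_int (n j) * x j)))" for b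
  proof (cases "b \<in> B")
    case True
    have cong: "p b x = p b y" if "circle_exp k x = circle_exp k y" for x y using that by (simp add: p_def H_def)
    from circle_power_character[OF p_mult[OF True] p_zero[OF True] cong p_cont[OF True]] show ?thesis by blast
  qed blast
  then obtain m :: "'v \<Rightarrow> nat \<Rightarrow> int" where
    m: "\<And>b x. b \<in> B \<Longrightarrow> p b x = exp (2 * of_real pi * \<i> * of_real (\<Sum>j<k. of_int (m b j) * x j))" by metis
  have "diagonal_torus s V B k m H G F T"
  proof (intro diagonal_torus.intro diagonal_torus_axioms.intro)
    show "carrier_space s V" using findim by (rule findim_space_imp_carrier_space)
    show "H x \<in> carrier (GL s V)" for x by (rule HG)
    show "T = H ` supported {..<k}"
    proof (intro equalityI subsetI)
      fix \<tau> assume "\<tau> \<in> T"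
      then obtain z where z: "z \<in> topspace (circles k)" "\<tau> = h z" using bij by (auto simp: bij_betw_def)
      obtain x where "z = (\<lambda>j\<in>{..<k}. exp (2 * of_real pi * \<i> * of_real (x j)))" using circles_lift[OF z(1)] by blast
      then have "z = circle_exp k (\<lambda>j. if j < k then x j else 0)" by (auto simp: circle_exp_def)
      then have "\<tau> = H (\<lambda>j. if j < k then x j else 0)" using z by (simp add: H_def)
      moreover have "(\<lambda>j. if j < k then x j else 0) \<in> supported {..<k}" by (simp add: supported_def)
      ultimately show "\<tau> \<in> H ` supported {..<k}" by blast
    qed (use HT in auto)
    show "H x b = s (exp (2 * of_real pi * \<i> * of_real (\<Sum>j<k. of_int (m b j) * x j))) b" if "b \<in> B" for x b
      using that by (simp add: H_p m)
    show "x j \<in> \<int>" if x: "\<And>b. b \<in> B \<Longrightarrow> (\<Sum>j<k. of_int (m b j) * x j) \<in> \<int>" and j: "j < k" for x :: "nat \<Rightarrow> real" and j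
    proof -
      \<comment> \<open>Integral weights make \<open>H x\<close> act on the basis like
        \<open>H 0\<close>; injectivity of \<open>h\<close> then leads back to the circle
        coordinates, so \<open>x j\<close> is an integer.\<close>
      have Hb: "H x b = H 0 b" if "b \<in> B" for b
      proof -
        have "p b x = 1" unfolding m[OF that] exp_2pi_eq_1_iff by (rule x[OF that])
        then show ?thesis by (simp add: H_p that p_zero)
      qed
      have "H x = H 0"
      proof (rule GL_eqI[OF HG HG])
        fix w assume w: "w \<in> V"
        show "H x w = H 0 w" by (rule lin_on_eq_on_basis[OF H_lin H_lin finite_B span]) (simp_all add: Hb w)
      qed
      then have "circle_exp k x = circle_exp k 0"
        using bij circle_exp_in_circles by (auto simp: H_def bij_betw_def inj_on_def)
      from fun_cong[OF this, of j] show ?thesis using j exp_2pi_eq_1_iff[of "x j"] by (simp add: circle_exp_def)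
    qed
    show "b = b'" if b: "b \<in> B" "b' \<in> B" and eq: "\<And>j. j < k \<Longrightarrow> m b j = m b' j" for b b'
    proof (rule ccontr)
      assume ne: "b \<noteq> b'"
      \<comment> \<open>The coordinates of \<open>H x v\<close> are the characters themselves. Equal
        exponents would give every orbit point, hence every vector of its span \<open>V\<close>,
        equal coordinates at \<open>b\<close> and \<open>b'\<close>, but those of \<open>b\<close>
        itself are 1 and 0.\<close>
      have rep_H: "representation B (H x v) a = p a x" if a: "a \<in> B" for x a
      proof -
        have "H x v = (\<Sum>c\<in>B. H x c)"
          unfolding v_sum by (rule lin_on_sum[OF H_lin BV])
        then have "representation B (H x v) a = (\<Sum>c\<in>B. representation B (H x c) a)"
          using GL_closed[OF HG BV] by (simp add: representation_sum ind span)
        also have "\<dots> = (\<Sum>c\<in>B. if c = a then p c x else 0)"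
          by (intro sum.cong) (auto simp: H_p representation_scale ind span BV representation_basis)
        finally show ?thesis using a finite_B by simp
      qed
      have pp: "p b x = p b' x" for x using b eq by (simp add: m)
      have "representation B w b = representation B w b'" if "w \<in> V" for w
      proof -
        have "w \<in> span ((\<lambda>\<tau>. \<tau> v) ` T)" using that conds by (simp add: conds_abcde_def cond_e_def)
        moreover have "subspace {w \<in> V. representation B w b = representation B w b'}"
          unfolding subspace_def using subspace_0[OF subspace_V] subspace_add[OF subspace_V] subspace_scale[OF subspace_V]
          by (auto simp: representation_zero representation_add representation_scale ind span)
        moreover have "(\<lambda>\<tau>. \<tau> v) ` T \<subseteq> {w \<in> V. representation B w b = representation B w b'}"
        proof (rule image_subsetI)
          fix \<tau> assume "\<tau> \<in> T"
          then obtain x where "\<tau> = H x"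
            using bij circles_lift unfolding H_def circle_exp_def bij_betw_def by (metis imageE)
          then show "\<tau> v \<in> {w \<in> V. representation B w b = representation B w b'}"
            using rep_H b pp GL_closed[OF HG v] by simp
        qed
        ultimately show ?thesis using span_minimal by blast
      qed
      from this[OF BV[OF b(1)]] show False using b ne by (simp add: representation_basis ind)
    qed
    show "\<exists>\<tau>'\<in>T. \<forall>x\<in>V. f (\<tau> x) = \<tau>' (f x)" if "f \<in> F" "\<tau> \<in> T" for f \<tau>
    proof (rule coset_hom_imp_normalizes[OF T_GL one_T subgroup_F _ that])
      show "(\<lambda>f. T #>\<^bsub>GL s V\<^esub> f) \<in> hom (GL s V\<lparr>carrier := F\<rparr>) (GL s V\<lparr>carrier := G\<rparr> Mod T)"
        using conds unfolding conds_abcde_def cond_a_def iso_def by blast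
    qed
    show "f (\<Sum>b\<in>B. b) = (\<Sum>b\<in>B. b)" if "f \<in> F" for f
      using conds that by (simp add: conds_abcde_def cond_d_def flip: v_sum)
    show "G = F <#>\<^bsub>GL s V\<^esub> T" using conds unfolding conds_abcde_def cond_a_def by blast
  qed (fact finite_B ind span subgroup_F finite_F)+
  then have "M_realizable s V G F T (\<Sum>b\<in>B. b)" by (rule diagonal_torus.M_realizable)
  then show ?thesis by (simp flip: v_sum)
qed

theorem theorem3p5:
  shows "(\<forall>(s :: complex \<Rightarrow> 'v::ab_group_add \<Rightarrow> 'v) V G F T v.
            torus_setting s V G F T v \<and> conds_abcde s V G F T v \<longrightarrow> M_realizable s V G F T v) \<and>
         (\<forall>(s :: real \<Rightarrow> 't::ab_group_add \<Rightarrow> 't) t L K F v.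
            M_data s t L K F \<and> v \<in> nowhere_vanishing K \<inter> invariant_functions s t K F \<longrightarrow>
            torus_setting pointwise_scale (C_fun K) (M_group s t K F) (M_finite s t K F) (M_torus t K) v \<and>
            conds_abcde pointwise_scale (C_fun K) (M_group s t K F) (M_finite s t K F) (M_torus t K) v)"
proof (intro conjI allI impI; elim conjE)
  fix s :: "complex \<Rightarrow> 'v \<Rightarrow> 'v" and V G F T v
  assume "torus_setting s V G F T v" "conds_abcde s V G F T v"
  then show "M_realizable s V G F T v" by (rule torus_realizable)
next
  fix s :: "real \<Rightarrow> 't \<Rightarrow> 't" and t L K F v
  assume data: "M_data s t L K F" and v: "v \<in> nowhere_vanishing K \<inter> invariant_functions s t K F"
  interpret M_construction s t L K F by unfold_locales (rule data)
  have vC: "v \<in> C_fun K" using v by (simp add: nowhere_vanishing_def)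
  show "torus_setting pointwise_scale (C_fun K) (M_group s t K F) (M_finite s t K F) (M_torus t K) v"
    by (rule torus_setting[OF vC])
  show "conds_abcde pointwise_scale (C_fun K) (M_group s t K F) (M_finite s t K F) (M_torus t K) v"
    by (rule conds_M_group[OF v])
qed

end
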